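(* Let $(Q_1,\xi_1)$ and $(Q_2,\xi_2)$ be any pair of contact manifolds, each of which may or may not be coorientable. Then the contact product $(Q_1\star Q_2,\xi_1\star\xi_2)$ is coorientable.
   Context: A contact manifold $(Q,\xi)$ is a smooth manifold with a maximally non-integrable hyperplane distribution $\xi\subset TQ$; it is coorientable if the line bundle $I^\xi:=TQ/\xi$ is trivial. Its canonical symplectization is $SQ=\{\beta\in T^*Q\setminus\{0\}\mid \beta|_\xi=0\}$, with the one-form $\theta$ obtained by restricting the Liouville one-form of $T^*Q$. The contact product is the quotient $Q_1\star Q_2=(SQ_1\times SQ_2)/\mathbb{R}_+$, where $r>0$ acts by $r\cdot(\beta_1,\beta_2)=(r\beta_1,r\beta_2)$ (the flow of the sum of the Liouville/Euler vector fields), with the contact structure $\xi_1\star\xi_2$ given by the projection of the $\mathbb{R}_+$-invariant distribution $\ker(\pi_1^*\theta_1+\pi_2^*\theta_2)$, where $\pi_i:SQ_1\times SQ_2\to SQ_i$ are the projections. *)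

theory Defs
  imports "HOL-Analysis.Analysis"
begin

section \<open>Smooth maps between open subsets of Euclidean spaces\<close>

fun Ck_on :: "nat \<Rightarrow> 'e::euclidean_space set \<Rightarrow> ('e \<Rightarrow> 'f::euclidean_space) \<Rightarrow> bool" where
  "Ck_on 0 S f \<longleftrightarrow> continuous_on S f"
| "Ck_on (Suc k) S f \<longleftrightarrow>
     (\<forall>x\<in>S. f differentiable (at x)) \<and> (\<forall>v. Ck_on k S (\<lambda>x. frechet_derivative f (at x) v))"

text \<open>Only used for open \<open>S\<close>.\<close>

definition smooth_on :: "'e::euclidean_space set \<Rightarrow> ('e \<Rightarrow> 'f::euclidean_space) \<Rightarrow> bool" where
  "smooth_on S f \<longleftrightarrow> (\<forall>k. Ck_on k S f)"

section \<open>Smooth manifolds\<close>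

text \<open>A chart is a domain together with a map that is only meaningful on that domain.
  The dimension of a manifold is that of the model space \<open>'e\<close>.  Atlases are not required to be
  maximal; all notions below only depend on the smooth structure an atlas generates.\<close>

type_synonym ('a, 'e) chart = "'a set \<times> ('a \<Rightarrow> 'e)"
type_synonym ('a, 'e) atlas = "('a, 'e) chart set"

abbreviation chart_inv :: "('a, 'e) chart \<Rightarrow> 'e \<Rightarrow> 'a" where
  "chart_inv c \<equiv> inv_into (fst c) (snd c)"

definition carrier_of :: "('a, 'e) atlas \<Rightarrow> 'a set" where
  "carrier_of A = (\<Union>c\<in>A. fst c)"

definition chart_at :: "('a, 'e) atlas \<Rightarrow> 'a \<Rightarrow> ('a, 'e) chart" where
  "chart_at A p = (SOME c. c \<in> A \<and> p \<in> fst c)"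

text \<open>The topology generated by the charts; \<open>openin_manifold_topology\<close> below shows that this is
  well defined as soon as the charts are injective.\<close>

definition manifold_topology :: "('a, 'e::euclidean_space) atlas \<Rightarrow> 'a topology" where
  "manifold_topology A =
     topology (\<lambda>U. U \<subseteq> carrier_of A \<and> (\<forall>c\<in>A. open (snd c ` (U \<inter> fst c))))"

lemma openin_manifold_topology:
  assumes inj: "\<And>c. c \<in> A \<Longrightarrow> inj_on (snd c) (fst c)"
  shows "openin (manifold_topology A) U \<longleftrightarrow>
           U \<subseteq> carrier_of A \<and> (\<forall>c\<in>A. open (snd c ` (U \<inter> fst c)))"
proof -
  have "istopology (\<lambda>U. U \<subseteq> carrier_of A \<and> (\<forall>c\<in>A. open (snd c ` (U \<inter> fst c))))"
    unfolding istopology_def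
  proof (intro conjI allI impI ballI)
    fix S T c
    assume S: "S \<subseteq> carrier_of A \<and> (\<forall>c\<in>A. open (snd c ` (S \<inter> fst c)))"
      and T: "T \<subseteq> carrier_of A \<and> (\<forall>c\<in>A. open (snd c ` (T \<inter> fst c)))"
    show "S \<inter> T \<subseteq> carrier_of A" using S by blast
    assume c: "c \<in> A"
    have "snd c ` (S \<inter> T \<inter> fst c) = snd c ` (S \<inter> fst c) \<inter> snd c ` (T \<inter> fst c)"
      using inj[OF c] by (auto simp: inj_on_def)
    then show "open (snd c ` (S \<inter> T \<inter> fst c))" using S T c by auto
  next
    fix K c
    assume K: "\<forall>S\<in>K. S \<subseteq> carrier_of A \<and> (\<forall>c\<in>A. open (snd c ` (S \<inter> fst c)))"
    show "\<Union>K \<subseteq> carrier_of A" using K by blast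
    assume c: "c \<in> A"
    have "snd c ` (\<Union>K \<inter> fst c) = (\<Union>S\<in>K. snd c ` (S \<inter> fst c))" by blast
    then show "open (snd c ` (\<Union>K \<inter> fst c))" using K c by auto
  qed
  then show ?thesis by (simp add: manifold_topology_def topology_inverse')
qed

definition smooth_manifold :: "('a, 'e::euclidean_space) atlas \<Rightarrow> bool" where
  "smooth_manifold A \<longleftrightarrow>
     (\<forall>c\<in>A. inj_on (snd c) (fst c) \<and> open (snd c ` fst c)) \<and>
     (\<forall>c\<in>A. \<forall>d\<in>A. open (snd c ` (fst c \<inter> fst d)) \<and>
        smooth_on (snd c ` (fst c \<inter> fst d)) (snd d \<circ> chart_inv c)) \<and>
     Hausdorff_space (manifold_topology A) \<and> second_countable (manifold_topology A)"

definition euclidean_atlas :: "('e, 'e::euclidean_space) atlas" where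
  "euclidean_atlas = {(UNIV, \<lambda>x. x)}"

definition product_atlas :: "('a, 'e) atlas \<Rightarrow> ('b, 'f) atlas \<Rightarrow> ('a \<times> 'b, 'e \<times> 'f) atlas" where
  "product_atlas A B = {(fst c \<times> fst d, map_prod (snd c) (snd d)) | c d. c \<in> A \<and> d \<in> B}"

definition smooth_map_on ::
  "('a, 'e::euclidean_space) atlas \<Rightarrow> ('b, 'f::euclidean_space) atlas \<Rightarrow> 'a set \<Rightarrow> ('a \<Rightarrow> 'b) \<Rightarrow> bool"
  where
  "smooth_map_on A B W F \<longleftrightarrow>
     (\<forall>p\<in>W. \<exists>c\<in>A. \<exists>d\<in>B. \<exists>V. openin (manifold_topology A) V \<and> p \<in> V \<and> V \<subseteq> W \<inter> fst c \<and>
        F ` V \<subseteq> fst d \<and> smooth_on (snd c ` V) (snd d \<circ> F \<circ> chart_inv c))"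

definition diffeomorphism ::
  "('a, 'e::euclidean_space) atlas \<Rightarrow> ('b, 'f::euclidean_space) atlas \<Rightarrow> ('a \<Rightarrow> 'b) \<Rightarrow> bool" where
  "diffeomorphism A B F \<longleftrightarrow> bij_betw F (carrier_of A) (carrier_of B) \<and>
     smooth_map_on A B (carrier_of A) F \<and>
     smooth_map_on B A (carrier_of B) (inv_into (carrier_of A) F)"

section \<open>Submanifolds and quotient manifolds\<close>

text \<open>The smooth structure induced on a subset: charts are the diffeomorphisms from relatively
  open pieces of \<open>S\<close> onto open subsets of \<open>'f\<close>, where smoothness on a piece of \<open>S\<close> means the
  existence of local smooth extensions to the ambient manifold.  If \<open>S\<close> is an embedded
  submanifold of dimension \<open>DIM('f)\<close>, this is its maximal atlas.\<close>

definition submanifold_atlas ::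
  "('a, 'e::euclidean_space) atlas \<Rightarrow> 'a set \<Rightarrow> ('a, 'f::euclidean_space) atlas" where
  "submanifold_atlas A S =
     {(W, \<psi>). openin (subtopology (manifold_topology A) S) W \<and>
        inj_on \<psi> W \<and> open (\<psi> ` W) \<and>
        smooth_map_on euclidean_atlas A (\<psi> ` W) (inv_into W \<psi>) \<and>
        (\<forall>p\<in>W. \<exists>V \<Psi>. openin (manifold_topology A) V \<and> p \<in> V \<and>
           smooth_map_on A (euclidean_atlas :: ('f, 'f) atlas) V \<Psi> \<and> (\<forall>q\<in>V \<inter> W. \<Psi> q = \<psi> q))}"

text \<open>The quotient smooth structure by an equivalence relation \<open>R\<close> on the carrier, characterised
  by the projection \<open>p \<mapsto> R `` {p}\<close> being a submersion: charts are the injective maps \<open>\<phi>\<close> with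
  open image, defined on sets \<open>U\<close> of classes with open preimage, such that the composition of
  \<open>\<phi>\<close> with the projection is a submersion, i.e. is smooth and has smooth local sections through
  every point.  If the quotient manifold exists and has dimension \<open>DIM('f)\<close>, this is its
  maximal atlas.\<close>

definition quotient_atlas ::
  "('a, 'e::euclidean_space) atlas \<Rightarrow> ('a \<times> 'a) set \<Rightarrow> ('a set, 'f::euclidean_space) atlas" where
  "quotient_atlas A R =
     {(U, \<phi>). U \<subseteq> carrier_of A // R \<and> inj_on \<phi> U \<and> open (\<phi> ` U) \<and>
        (let P = {p \<in> carrier_of A. R `` {p} \<in> U}; f = (\<lambda>p. \<phi> (R `` {p})) in
           openin (manifold_topology A) P \<and>
           smooth_map_on A (euclidean_atlas :: ('f, 'f) atlas) P f \<and>
           (\<forall>p\<in>P. \<exists>X \<sigma>. open X \<and> f p \<in> X \<and> smooth_map_on euclidean_atlas A X \<sigma> \<and>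
              \<sigma> (f p) = p \<and> (\<forall>x\<in>X. \<sigma> x \<in> P \<and> f (\<sigma> x) = x)))}"

section \<open>Tangent and cotangent bundles\<close>

text \<open>A tangent vector at \<open>p\<close> is the family of its coordinate vectors in all charts around \<open>p\<close>,
  related by the derivatives of the transition maps (and \<open>0\<close> at all other charts).\<close>

type_synonym ('a, 'e) tvec = "('a, 'e) chart \<Rightarrow> 'e"

definition tangent_space :: "('a, 'e::euclidean_space) atlas \<Rightarrow> 'a \<Rightarrow> ('a, 'e) tvec set" where
  "tangent_space A p =
     {v. (\<forall>c\<in>A. \<forall>d\<in>A. p \<in> fst c \<and> p \<in> fst d \<longrightarrow>
            v d = frechet_derivative (snd d \<circ> chart_inv c) (at (snd c p)) (v c)) \<and>
         (\<forall>c. \<not> (c \<in> A \<and> p \<in> fst c) \<longrightarrow> v c = 0)}"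

definition tangent_linear ::
  "('a, 'e::euclidean_space) atlas \<Rightarrow> 'a \<Rightarrow> (('a, 'e) tvec \<Rightarrow> real) \<Rightarrow> bool" where
  "tangent_linear A p \<beta> \<longleftrightarrow>
     (\<forall>v\<in>tangent_space A p. \<forall>w\<in>tangent_space A p. \<forall>a b.
        \<beta> (\<lambda>c. a *\<^sub>R v c + b *\<^sub>R w c) = a * \<beta> v + b * \<beta> w)"

text \<open>The tangent vector at \<open>p\<close> with coordinate vector \<open>e\<close> in the chart \<open>c\<close>.\<close>

definition coord_vec ::
  "('a, 'e::euclidean_space) atlas \<Rightarrow> ('a, 'e) chart \<Rightarrow> 'a \<Rightarrow> 'e \<Rightarrow> ('a, 'e) tvec" where
  "coord_vec A c p e =
     (\<lambda>d. if d \<in> A \<and> p \<in> fst d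
          then frechet_derivative (snd d \<circ> chart_inv c) (at (snd c p)) e else 0)"

definition tangent_map ::
  "('a, 'e::euclidean_space) atlas \<Rightarrow> ('b, 'f::euclidean_space) atlas \<Rightarrow> ('a \<Rightarrow> 'b) \<Rightarrow> 'a
     \<Rightarrow> ('a, 'e) tvec \<Rightarrow> ('b, 'f) tvec" where
  "tangent_map A B F p v =
     (let c = chart_at A p in
      (\<lambda>d. if d \<in> B \<and> F p \<in> fst d
           then frechet_derivative (snd d \<circ> F \<circ> chart_inv c) (at (snd c p)) (v c) else 0))"

definition tangent_atlas ::
  "('a, 'e::euclidean_space) atlas \<Rightarrow> ('a \<times> ('a, 'e) tvec, 'e \<times> 'e) atlas" where
  "tangent_atlas A =
     {({(p, v). p \<in> fst c \<and> v \<in> tangent_space A p}, \<lambda>(p, v). (snd c p, v c)) | c. c \<in> A}"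

text \<open>Covectors are made to vanish outside the tangent space, so that they are determined by
  their restriction to it.\<close>

definition cotangent_space ::
  "('a, 'e::euclidean_space) atlas \<Rightarrow> 'a \<Rightarrow> (('a, 'e) tvec \<Rightarrow> real) set" where
  "cotangent_space A p =
     {\<beta>. tangent_linear A p \<beta> \<and> (\<forall>v. v \<notin> tangent_space A p \<longrightarrow> \<beta> v = 0)}"

definition cotangent_atlas ::
  "('a, 'e::euclidean_space) atlas \<Rightarrow> ('a \<times> (('a, 'e) tvec \<Rightarrow> real), 'e \<times> 'e) atlas" where
  "cotangent_atlas A =
     {({(p, \<beta>). p \<in> fst c \<and> \<beta> \<in> cotangent_space A p},
       \<lambda>(p, \<beta>). (snd c p, \<Sum>b\<in>Basis. \<beta> (coord_vec A c p b) *\<^sub>R b)) | c. c \<in> A}"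

section \<open>One-forms\<close>

type_synonym ('a, 'e) form1 = "'a \<Rightarrow> ('a, 'e) tvec \<Rightarrow> real"

definition smooth_form1_on :: "('a, 'e::euclidean_space) atlas \<Rightarrow> 'a set \<Rightarrow> ('a, 'e) form1 \<Rightarrow> bool"
  where
  "smooth_form1_on A W \<alpha> \<longleftrightarrow>
     (\<forall>p\<in>W. tangent_linear A p (\<alpha> p)) \<and>
     (\<forall>c\<in>A. \<forall>e. smooth_on (snd c ` (W \<inter> fst c))
        (\<lambda>x. \<alpha> (chart_inv c x) (coord_vec A c (chart_inv c x) e)))"

text \<open>The formula \<open>d\<alpha>(X, Y) = X(\<alpha>(Y)) - Y(\<alpha>(X)) - \<alpha>([X, Y])\<close> for the vector fields \<open>X, Y\<close>
  with constant coordinates in a chart that extend \<open>v\<close> and \<open>w\<close>.\<close>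

definition exterior_deriv ::
  "('a, 'e::euclidean_space) atlas \<Rightarrow> ('a, 'e) form1 \<Rightarrow> 'a \<Rightarrow> ('a, 'e) tvec \<Rightarrow> ('a, 'e) tvec \<Rightarrow> real"
  where
  "exterior_deriv A \<alpha> p v w =
     (let c = chart_at A p;
          \<alpha>c = (\<lambda>e x. \<alpha> (chart_inv c x) (coord_vec A c (chart_inv c x) e))
      in frechet_derivative (\<alpha>c (w c)) (at (snd c p)) (v c)
         - frechet_derivative (\<alpha>c (v c)) (at (snd c p)) (w c))"

definition pullback_form1 ::
  "('a, 'e::euclidean_space) atlas \<Rightarrow> ('b, 'f::euclidean_space) atlas \<Rightarrow> ('a \<Rightarrow> 'b)
     \<Rightarrow> ('b, 'f) form1 \<Rightarrow> ('a, 'e) form1" where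
  "pullback_form1 A B F \<alpha> p v = \<alpha> (F p) (tangent_map A B F p v)"

definition liouville_form ::
  "('a, 'e::euclidean_space) atlas \<Rightarrow> ('a \<times> (('a, 'e) tvec \<Rightarrow> real), 'e \<times> 'e) form1" where
  "liouville_form A x u = snd x (tangent_map (cotangent_atlas A) A fst x u)"

section \<open>Contact manifolds\<close>

type_synonym ('a, 'e) distribution = "'a \<Rightarrow> ('a, 'e) tvec set"

definition local_defining_form ::
  "('a, 'e::euclidean_space) atlas \<Rightarrow> ('a, 'e) distribution \<Rightarrow> 'a set \<Rightarrow> ('a, 'e) form1 \<Rightarrow> bool"
  where
  "local_defining_form A \<xi> W \<alpha> \<longleftrightarrow>
     openin (manifold_topology A) W \<and> smooth_form1_on A W \<alpha> \<and>
     (\<forall>p\<in>W. (\<exists>v\<in>tangent_space A p. \<alpha> p v \<noteq> 0) \<and> \<xi> p = {v \<in> tangent_space A p. \<alpha> p v = 0})"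

definition hyperplane_distribution ::
  "('a, 'e::euclidean_space) atlas \<Rightarrow> ('a, 'e) distribution \<Rightarrow> bool" where
  "hyperplane_distribution A \<xi> \<longleftrightarrow>
     (\<forall>p\<in>carrier_of A. \<exists>W \<alpha>. p \<in> W \<and> local_defining_form A \<xi> W \<alpha>)"

text \<open>Maximal non-integrability: if locally \<open>\<xi> = ker \<alpha>\<close>, then \<open>d\<alpha>\<close> is nondegenerate on \<open>\<xi>\<close>.\<close>

definition maximally_nonintegrable ::
  "('a, 'e::euclidean_space) atlas \<Rightarrow> ('a, 'e) distribution \<Rightarrow> bool" where
  "maximally_nonintegrable A \<xi> \<longleftrightarrow>
     (\<forall>W \<alpha>. local_defining_form A \<xi> W \<alpha> \<longrightarrow>
        (\<forall>p\<in>W. \<forall>v\<in>\<xi> p. v \<noteq> (\<lambda>_. 0) \<longrightarrow> (\<exists>w\<in>\<xi> p. exterior_deriv A \<alpha> p v w \<noteq> 0)))"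

definition contact_manifold ::
  "('a, 'e::euclidean_space) atlas \<Rightarrow> ('a, 'e) distribution \<Rightarrow> bool" where
  "contact_manifold Q \<xi> \<longleftrightarrow>
     smooth_manifold Q \<and> hyperplane_distribution Q \<xi> \<and> maximally_nonintegrable Q \<xi>"

text \<open>The line bundle \<open>TQ/\<xi>\<close>.  Its points are the classes of pairs \<open>(p, v)\<close> with
  \<open>v \<in> T\<^sub>p Q\<close> modulo \<open>\<xi> p\<close>.\<close>

definition normal_rel ::
  "('a, 'e::euclidean_space) atlas \<Rightarrow> ('a, 'e) distribution
     \<Rightarrow> (('a \<times> ('a, 'e) tvec) \<times> ('a \<times> ('a, 'e) tvec)) set" where
  "normal_rel Q \<xi> =
     {((p, v), (p, w)) | p v w. p \<in> carrier_of Q \<and> v \<in> tangent_space Q p \<and> w \<in> tangent_space Q p \<and>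
        (\<lambda>c. v c - w c) \<in> \<xi> p}"

definition normal_line_bundle ::
  "('a, 'e::euclidean_space) atlas \<Rightarrow> ('a, 'e) distribution
     \<Rightarrow> (('a \<times> ('a, 'e) tvec) set, 'e \<times> real) atlas" where
  "normal_line_bundle Q \<xi> = quotient_atlas (tangent_atlas Q) (normal_rel Q \<xi>)"

text \<open>\<open>TQ/\<xi>\<close> is trivial: it is diffeomorphic to \<open>Q \<times> \<real>\<close> by a fibre-preserving,
  fibrewise linear map.  The linear structure of a fibre is the quotient one, so linearity is
  tested on representatives.\<close>

definition coorientable :: "('a, 'e::euclidean_space) atlas \<Rightarrow> ('a, 'e) distribution \<Rightarrow> bool" where
  "coorientable Q \<xi> \<longleftrightarrow>
     (\<exists>F. diffeomorphism (normal_line_bundle Q \<xi>)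
            (product_atlas Q (euclidean_atlas :: (real, real) atlas)) F \<and>
          (\<forall>p\<in>carrier_of Q.
             (\<forall>v\<in>tangent_space Q p. fst (F (normal_rel Q \<xi> `` {(p, v)})) = p) \<and>
             tangent_linear Q p (\<lambda>v. snd (F (normal_rel Q \<xi> `` {(p, v)})))))"

section \<open>Symplectization and contact product\<close>

type_synonym ('a, 'e) spt = "'a \<times> (('a, 'e) tvec \<Rightarrow> real)"

definition symplectization_set ::
  "('a, 'e::euclidean_space) atlas \<Rightarrow> ('a, 'e) distribution \<Rightarrow> ('a, 'e) spt set" where
  "symplectization_set Q \<xi> =
     {(p, \<beta>). p \<in> carrier_of Q \<and> \<beta> \<in> cotangent_space Q p \<and> \<beta> \<noteq> (\<lambda>_. 0) \<and> (\<forall>v\<in>\<xi> p. \<beta> v = 0)}"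

definition symplectization ::
  "('a, 'e::euclidean_space) atlas \<Rightarrow> ('a, 'e) distribution \<Rightarrow> (('a, 'e) spt, 'e \<times> real) atlas" where
  "symplectization Q \<xi> = submanifold_atlas (cotangent_atlas Q) (symplectization_set Q \<xi>)"

definition symplectization_form ::
  "('a, 'e::euclidean_space) atlas \<Rightarrow> ('a, 'e) distribution \<Rightarrow> (('a, 'e) spt, 'e \<times> real) form1" where
  "symplectization_form Q \<xi> =
     pullback_form1 (symplectization Q \<xi>) (cotangent_atlas Q) (\<lambda>x. x) (liouville_form Q)"

definition symplectization_product ::
  "('a, 'e::euclidean_space) atlas \<Rightarrow> ('a, 'e) distribution \<Rightarrow>
   ('b, 'f::euclidean_space) atlas \<Rightarrow> ('b, 'f) distribution \<Rightarrow>
   (('a, 'e) spt \<times> ('b, 'f) spt, ('e \<times> real) \<times> ('f \<times> real)) atlas" where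
  "symplectization_product Q1 \<xi>1 Q2 \<xi>2 =
     product_atlas (symplectization Q1 \<xi>1) (symplectization Q2 \<xi>2)"

definition contact_product_form ::
  "('a, 'e::euclidean_space) atlas \<Rightarrow> ('a, 'e) distribution \<Rightarrow>
   ('b, 'f::euclidean_space) atlas \<Rightarrow> ('b, 'f) distribution \<Rightarrow>
   (('a, 'e) spt \<times> ('b, 'f) spt, ('e \<times> real) \<times> ('f \<times> real)) form1" where
  "contact_product_form Q1 \<xi>1 Q2 \<xi>2 x u =
     pullback_form1 (symplectization_product Q1 \<xi>1 Q2 \<xi>2) (symplectization Q1 \<xi>1) fst
       (symplectization_form Q1 \<xi>1) x u +
     pullback_form1 (symplectization_product Q1 \<xi>1 Q2 \<xi>2) (symplectization Q2 \<xi>2) snd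
       (symplectization_form Q2 \<xi>2) x u"

definition scale_covec :: "real \<Rightarrow> ('a, 'e) spt \<Rightarrow> ('a, 'e) spt" where
  "scale_covec r = (\<lambda>(p, \<beta>). (p, \<lambda>v. r * \<beta> v))"

definition ray_rel ::
  "('a, 'e::euclidean_space) atlas \<Rightarrow> ('a, 'e) distribution \<Rightarrow>
   ('b, 'f::euclidean_space) atlas \<Rightarrow> ('b, 'f) distribution \<Rightarrow>
   ((('a, 'e) spt \<times> ('b, 'f) spt) \<times> (('a, 'e) spt \<times> ('b, 'f) spt)) set" where
  "ray_rel Q1 \<xi>1 Q2 \<xi>2 =
     {((x, y), (scale_covec r x, scale_covec r y)) | x y r.
        x \<in> symplectization_set Q1 \<xi>1 \<and> y \<in> symplectization_set Q2 \<xi>2 \<and> r > 0}"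

definition contact_product ::
  "('a, 'e::euclidean_space) atlas \<Rightarrow> ('a, 'e) distribution \<Rightarrow>
   ('b, 'f::euclidean_space) atlas \<Rightarrow> ('b, 'f) distribution \<Rightarrow>
   ((('a, 'e) spt \<times> ('b, 'f) spt) set, 'e \<times> 'f \<times> real) atlas" where
  "contact_product Q1 \<xi>1 Q2 \<xi>2 =
     quotient_atlas (symplectization_product Q1 \<xi>1 Q2 \<xi>2) (ray_rel Q1 \<xi>1 Q2 \<xi>2)"

definition contact_product_distribution ::
  "('a, 'e::euclidean_space) atlas \<Rightarrow> ('a, 'e) distribution \<Rightarrow>
   ('b, 'f::euclidean_space) atlas \<Rightarrow> ('b, 'f) distribution \<Rightarrow>
   ((('a, 'e) spt \<times> ('b, 'f) spt) set, 'e \<times> 'f \<times> real) distribution" where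
  "contact_product_distribution Q1 \<xi>1 Q2 \<xi>2 z =
     {tangent_map (symplectization_product Q1 \<xi>1 Q2 \<xi>2) (contact_product Q1 \<xi>1 Q2 \<xi>2)
        (\<lambda>x. ray_rel Q1 \<xi>1 Q2 \<xi>2 `` {x}) x u | x u.
      x \<in> carrier_of (symplectization_product Q1 \<xi>1 Q2 \<xi>2) \<and> ray_rel Q1 \<xi>1 Q2 \<xi>2 `` {x} = z \<and>
      u \<in> tangent_space (symplectization_product Q1 \<xi>1 Q2 \<xi>2) x \<and>
      contact_product_form Q1 \<xi>1 Q2 \<xi>2 x u = 0}"

end

theory Submission
  imports Defs
begin

text \<open>
  A coorientation of a contact structure is the same thing as a global contact form, that is, a
  nowhere vanishing one-form whose kernel is the distribution.  On \<open>SQ\<^sub>1 \<times> SQ\<^sub>2\<close> there is the global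
  one-form \<open>\<theta> = \<pi>\<^sub>1\<^sup>*\<theta>\<^sub>1 + \<pi>\<^sub>2\<^sup>*\<theta>\<^sub>2\<close>, whether or not \<open>Q\<^sub>1\<close> and \<open>Q\<^sub>2\<close> are coorientable.  It does not
  descend to the contact product, since it is homogeneous of degree one under scaling by \<open>r > 0\<close>.
  But the scaling group is the contractible group of \<^emph>\<open>positive\<close> reals, so there is a smooth positive
  function \<open>h\<close> on \<open>SQ\<^sub>1 \<times> SQ\<^sub>2\<close> that is also homogeneous of degree one, and \<open>\<theta> / h\<close> descends to a
  global form that defines \<open>\<xi>\<^sub>1 \<star> \<xi>\<^sub>2\<close>.

  The function \<open>h\<close> can be taken to depend on the first covector only, and is glued from local pieces
  (\<open>positive_homogeneous_function\<close>): if \<open>e\<close> is a local vector field transverse to \<open>\<xi>\<^sub>1\<close>, then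
  \<open>\<beta> \<mapsto> \<bar>\<beta>(e)\<bar>\<close> is smooth, positive and homogeneous, and the absolute value makes it insensitive to the
  sign of \<open>e\<close>, the only obstruction to gluing such fields.  The gluing uses a locally finite family of
  bump functions on \<open>Q\<^sub>1\<close> (\<open>locally_finite_bump_family\<close>).

  Descending along the quotient is done through the section \<open>s\<close> of the projection \<open>\<pi>\<close> whose
  image is \<open>{h = 1}\<close>.  The form is \<open>\<alpha> = s\<^sup>*\<theta>\<close>, and \<open>\<pi>\<^sup>*\<alpha> = \<theta> / h\<close> follows from the functoriality of
  tangent maps: \<open>\<theta>\<close> pairs the covectors \<open>\<beta>\<^sub>i\<close> with the tangent maps of the projections to \<open>Q\<^sub>i\<close>, and
  these projections are invariant under scaling.  A trivialisation of the normal line bundle is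
  then given by \<open>[v] \<mapsto> \<alpha>(v)\<close> (\<open>coorientable_if_global_form\<close>).

  For tangent maps and smooth maps to behave as expected, the atlases of the symplectizations and of
  the contact product must be compatible and must cover the spaces.  Compatibility holds for all
  submanifold and quotient atlases (\<open>smooth_atlas_submanifold\<close>, \<open>smooth_atlas_quotient\<close>).  That the
  charts cover is shown by explicit charts (\<open>symplectization_chart\<close>, \<open>contact_product_chart\<close>): a
  covector vanishing on a hyperplane is determined by its value on one transverse vector, which
  adds one coordinate to those of the base point.
\<close>

section \<open>Calculus of smooth maps\<close>

lemma Ck_on_continuous: "Ck_on k S f \<Longrightarrow> continuous_on S f"
proof (cases k)
  case (Suc m)
  assume "Ck_on k S f"
  then have "\<And>x. x \<in> S \<Longrightarrow> isCont f x"
    using Suc differentiable_imp_continuous_within by auto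
  then show ?thesis by (simp add: continuous_at_imp_continuous_on)
qed auto

lemma Ck_on_Suc_imp: "Ck_on (Suc k) S f \<Longrightarrow> Ck_on k S f"
proof (induction k arbitrary: f)
  case 0
  then show ?case using Ck_on_continuous by (metis Ck_on.simps(1))
next
  case (Suc k)
  then show ?case by (metis Ck_on.simps(2))
qed

lemma Ck_on_cong:
  assumes "open S" "\<And>x. x \<in> S \<Longrightarrow> f x = g x" "Ck_on k S f"
  shows "Ck_on k S g"
  using assms(2,3)
proof (induction k arbitrary: f g)
  case 0
  then show ?case using continuous_on_cong by (metis Ck_on.simps(1))
next
  case (Suc k)
  have d: "(g has_derivative frechet_derivative f (at x)) (at x)" if "x \<in> S" for x
    by (rule has_derivative_transform_within_open[OF _ assms(1) that, of f])
      (use Suc.prems that frechet_derivative_works in auto)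
  show ?case
  proof (simp, intro conjI ballI allI)
    show "g differentiable (at x)" if "x \<in> S" for x
      using d[OF that] differentiableI by blast
    show "Ck_on k S (\<lambda>x. frechet_derivative g (at x) v)" for v
    proof (rule Suc.IH)
      show "frechet_derivative f (at x) v = frechet_derivative g (at x) v" if "x \<in> S" for x
        using frechet_derivative_at[OF d[OF that]] by simp
      show "Ck_on k S (\<lambda>x. frechet_derivative f (at x) v)"
        using Suc.prems by simp
    qed
  qed
qed

lemma Ck_on_SucI:
  assumes "open S" "\<And>x. x \<in> S \<Longrightarrow> (f has_derivative f' x) (at x)"
    "\<And>v. Ck_on k S (\<lambda>x. f' x v)"
  shows "Ck_on (Suc k) S f"
proof (simp, intro conjI ballI allI)
  show "f differentiable (at x)" if "x \<in> S" for x
    using assms(2)[OF that] differentiableI by blast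
  show "Ck_on k S (\<lambda>x. frechet_derivative f (at x) v)" for v
  proof (rule Ck_on_cong[OF assms(1) _ assms(3)])
    show "f' x v = frechet_derivative f (at x) v" if "x \<in> S" for x
      using frechet_derivative_at[OF assms(2)[OF that]] by simp
  qed
qed

lemma Ck_on_SucD:
  assumes "Ck_on (Suc k) S f" "x \<in> S"
  shows "(f has_derivative frechet_derivative f (at x)) (at x)"
  using assms frechet_derivative_works by auto

lemma Ck_on_subset: "Ck_on k S f \<Longrightarrow> T \<subseteq> S \<Longrightarrow> Ck_on k T f"
  by (induction k arbitrary: f) (auto intro: continuous_on_subset)

lemma Ck_on_const: "open S \<Longrightarrow> Ck_on k S (\<lambda>x. c)"
proof (induction k arbitrary: c)
  case (Suc k)
  show ?case
    by (rule Ck_on_SucI[where f' = "\<lambda>_ _. 0"]) (use Suc in auto)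
qed auto

lemma Ck_on_bounded_linear:
  assumes "bounded_linear L" "open S" "Ck_on k S f"
  shows "Ck_on k S (\<lambda>x. L (f x))"
  using assms(3)
proof (induction k arbitrary: f)
  case 0
  then show ?case using bounded_linear.continuous_on[OF assms(1)] by auto
next
  case (Suc k)
  show ?case
  proof (rule Ck_on_SucI[OF assms(2)])
    show "((\<lambda>x. L (f x)) has_derivative (\<lambda>v. L (frechet_derivative f (at x) v))) (at x)"
      if "x \<in> S" for x
      by (rule bounded_linear.has_derivative[OF assms(1) Ck_on_SucD[OF Suc.prems that]])
    show "Ck_on k S (\<lambda>x. L (frechet_derivative f (at x) v))" for v
      using Suc by auto
  qed
qed

lemma Ck_on_id: "open S \<Longrightarrow> Ck_on k S (\<lambda>x. x)"
proof (cases k)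
  case (Suc m)
  assume "open S"
  then show ?thesis unfolding Suc
    by (intro Ck_on_SucI[where f' = "\<lambda>_ v. v"]) (auto intro: Ck_on_const)
qed auto

lemma Ck_on_add:
  assumes "open S" "Ck_on k S f" "Ck_on k S g"
  shows "Ck_on k S (\<lambda>x. f x + g x)"
  using assms(2,3)
proof (induction k arbitrary: f g)
  case 0
  then show ?case by (simp add: continuous_on_add)
next
  case (Suc k)
  show ?case
  proof (rule Ck_on_SucI[OF assms(1)])
    show "((\<lambda>x. f x + g x) has_derivative
        (\<lambda>v. frechet_derivative f (at x) v + frechet_derivative g (at x) v)) (at x)"
      if "x \<in> S" for x
      by (rule has_derivative_add[OF Ck_on_SucD[OF Suc.prems(1) that] Ck_on_SucD[OF Suc.prems(2) that]])
    show "Ck_on k S (\<lambda>x. frechet_derivative f (at x) v + frechet_derivative g (at x) v)" for v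
      using Suc by auto
  qed
qed

lemma Ck_on_sum:
  assumes "open S" "\<And>i. i \<in> I \<Longrightarrow> Ck_on k S (f i)"
  shows "Ck_on k S (\<lambda>x. \<Sum>i\<in>I. f i x)"
  using assms(2)
  by (induction I rule: infinite_finite_induct) (auto intro: Ck_on_const Ck_on_add assms(1))

lemma Ck_on_bilinear:
  assumes "bounded_bilinear B" "open S" "Ck_on k S f" "Ck_on k S g"
  shows "Ck_on k S (\<lambda>x. B (f x) (g x))"
  using assms(3,4)
proof (induction k arbitrary: f g)
  case 0
  then show ?case using bounded_bilinear.continuous_on[OF assms(1)] by auto
next
  case (Suc k)
  show ?case
  proof (rule Ck_on_SucI[OF assms(2)])
    show "((\<lambda>x. B (f x) (g x)) has_derivative
        (\<lambda>v. B (f x) (frechet_derivative g (at x) v) + B (frechet_derivative f (at x) v) (g x))) (at x)"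
      if "x \<in> S" for x
      by (rule bounded_bilinear.FDERIV[OF assms(1) Ck_on_SucD[OF Suc.prems(1) that] Ck_on_SucD[OF Suc.prems(2) that]])
    show "Ck_on k S (\<lambda>x. B (f x) (frechet_derivative g (at x) v) + B (frechet_derivative f (at x) v) (g x))" for v
      using Suc.prems Ck_on_Suc_imp[OF Suc.prems(1)] Ck_on_Suc_imp[OF Suc.prems(2)]
      by (intro Ck_on_add Suc.IH assms(2)) auto
  qed
qed

lemma linear_expand_Basis:
  fixes L :: "'e::euclidean_space \<Rightarrow> 'f::real_vector"
  assumes "linear L"
  shows "L e = (\<Sum>b\<in>Basis. (e \<bullet> b) *\<^sub>R L b)"
proof -
  have "L e = L (\<Sum>b\<in>Basis. (e \<bullet> b) *\<^sub>R b)" by (simp add: euclidean_representation)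
  also have "\<dots> = (\<Sum>b\<in>Basis. (e \<bullet> b) *\<^sub>R L b)"
    by (simp add: linear_sum[OF assms] linear_cmul[OF assms])
  finally show ?thesis .
qed

text \<open>The chain rule is expanded in a basis: \<^const>\<open>Ck_on\<close> speaks only about derivatives in a
  direction that does not vary with the point.\<close>

lemma Ck_on_compose:
  fixes f :: "'a::euclidean_space \<Rightarrow> 'b::euclidean_space" and g :: "'b \<Rightarrow> 'c::euclidean_space"
  assumes "open S" "open T" "f ` S \<subseteq> T" "Ck_on k T g" "Ck_on k S f"
  shows "Ck_on k S (\<lambda>x. g (f x))"
  using assms(4,5)
proof (induction k arbitrary: g)
  case 0
  then show ?case using assms(3) continuous_on_compose2 by (metis Ck_on.simps(1))
next
  case (Suc k)
  let ?Df = "\<lambda>x. frechet_derivative f (at x)" and ?Dg = "\<lambda>x. frechet_derivative g (at x)"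
  show ?case
  proof (rule Ck_on_SucI[OF assms(1)])
    fix x assume x: "x \<in> S"
    then have fx: "f x \<in> T" using assms(3) by auto
    have 1: "((\<lambda>x. g (f x)) has_derivative (\<lambda>v. ?Dg (f x) (?Df x v))) (at x)"
      by (rule has_derivative_compose[OF Ck_on_SucD[OF Suc.prems(2) x] Ck_on_SucD[OF Suc.prems(1) fx]])
    have "linear (?Dg (f x))"
      using Ck_on_SucD[OF Suc.prems(1) fx] has_derivative_linear by blast
    then have "(\<lambda>v. ?Dg (f x) (?Df x v)) = (\<lambda>v. \<Sum>b\<in>Basis. (?Df x v \<bullet> b) *\<^sub>R ?Dg (f x) b)"
      by (intro ext linear_expand_Basis)
    with 1 show "((\<lambda>x. g (f x)) has_derivative
        (\<lambda>v. \<Sum>b\<in>Basis. (?Df x v \<bullet> b) *\<^sub>R ?Dg (f x) b)) (at x)" by simp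
  next
    fix v
    have "Ck_on k S (\<lambda>x. ?Dg (f x) b)" for b
      using Suc.IH[of "\<lambda>y. ?Dg y b"] Suc.prems(1) Ck_on_Suc_imp[OF Suc.prems(2)] by auto
    moreover have "Ck_on k S (\<lambda>x. ?Df x v \<bullet> b)" for b
      using Ck_on_bounded_linear[OF bounded_linear_inner_left assms(1), of k "\<lambda>x. ?Df x v"] Suc.prems(2) by auto
    ultimately show "Ck_on k S (\<lambda>x. \<Sum>b\<in>Basis. (?Df x v \<bullet> b) *\<^sub>R ?Dg (f x) b)"
      by (intro Ck_on_sum Ck_on_bilinear[OF bounded_bilinear_scaleR] assms(1))
  qed
qed

lemma Ck_on_local:
  assumes "\<And>x. x \<in> S \<Longrightarrow> \<exists>T. open T \<and> x \<in> T \<and> Ck_on k T f"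
  shows "Ck_on k S f"
  using assms
proof (induction k arbitrary: f)
  case 0
  then have "isCont f x" if "x \<in> S" for x
    using that by (metis Ck_on.simps(1) continuous_on_eq_continuous_at)
  then show ?case by (simp add: continuous_at_imp_continuous_on)
next
  case (Suc k)
  show ?case
  proof (simp, intro conjI ballI allI)
    show "f differentiable (at x)" if "x \<in> S" for x
      using Suc.prems[OF that] by auto
    show "Ck_on k S (\<lambda>x. frechet_derivative f (at x) v)" for v
      by (rule Suc.IH) (use Suc.prems in force)
  qed
qed

lemma smooth_onD: "smooth_on S f \<Longrightarrow> Ck_on k S f"
  by (simp add: smooth_on_def)

lemma smooth_on_compose:
  assumes "smooth_on T g" "smooth_on S f" "open S" "open T" "f ` S \<subseteq> T"
  shows "smooth_on S (\<lambda>x. g (f x))"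
proof (unfold smooth_on_def, rule allI)
  fix k
  show "Ck_on k S (\<lambda>x. g (f x))"
    by (rule Ck_on_compose[OF assms(3,4,5) smooth_onD[OF assms(1)] smooth_onD[OF assms(2)]])
qed

lemma smooth_on_subset: "smooth_on S f \<Longrightarrow> T \<subseteq> S \<Longrightarrow> smooth_on T f"
  unfolding smooth_on_def using Ck_on_subset by blast

lemma smooth_on_cong:
  assumes "open S" "\<And>x. x \<in> S \<Longrightarrow> f x = g x" "smooth_on S f" shows "smooth_on S g"
  unfolding smooth_on_def by (rule allI, rule Ck_on_cong[OF assms(1,2) smooth_onD[OF assms(3)]])

lemma smooth_on_local:
  assumes "\<And>x. x \<in> S \<Longrightarrow> \<exists>T. open T \<and> x \<in> T \<and> smooth_on T f"
  shows "smooth_on S f"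
  unfolding smooth_on_def by (intro allI Ck_on_local) (use assms in \<open>auto simp: smooth_on_def\<close>)

lemma smooth_on_continuous: "smooth_on S f \<Longrightarrow> continuous_on S f"
  unfolding smooth_on_def using Ck_on_continuous by blast

lemma smooth_on_has_derivative:
  assumes "smooth_on S f" "x \<in> S"
  shows "(f has_derivative frechet_derivative f (at x)) (at x)"
  using assms unfolding smooth_on_def by (auto intro: Ck_on_SucD)

lemma smooth_on_frechet_derivative:
  "smooth_on S f \<Longrightarrow> smooth_on S (\<lambda>x. frechet_derivative f (at x) v)"
  unfolding smooth_on_def
proof
  fix k assume "\<forall>k. Ck_on k S f"
  then have "Ck_on (Suc k) S f" ..
  then show "Ck_on k S (\<lambda>x. frechet_derivative f (at x) v)" by simp
qed

lemma smooth_on_bounded_linear: "bounded_linear L \<Longrightarrow> open S \<Longrightarrow> smooth_on S L"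
  unfolding smooth_on_def by (intro allI Ck_on_bounded_linear[OF _ _ Ck_on_id])

lemma smooth_on_linear_image:
  assumes "bounded_linear L" "open S" "smooth_on S f"
  shows "smooth_on S (\<lambda>x. L (f x))"
  unfolding smooth_on_def by (rule allI, rule Ck_on_bounded_linear[OF assms(1,2) smooth_onD[OF assms(3)]])

lemma smooth_on_bilinear:
  assumes "bounded_bilinear B" "open S" "smooth_on S f" "smooth_on S g"
  shows "smooth_on S (\<lambda>x. B (f x) (g x))"
  unfolding smooth_on_def
  by (rule allI, rule Ck_on_bilinear[OF assms(1,2) smooth_onD[OF assms(3)] smooth_onD[OF assms(4)]])

lemma smooth_on_const: "open S \<Longrightarrow> smooth_on S (\<lambda>x. c)"
  unfolding smooth_on_def by (intro allI Ck_on_const)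

lemma smooth_on_add: "open S \<Longrightarrow> smooth_on S f \<Longrightarrow> smooth_on S g \<Longrightarrow> smooth_on S (\<lambda>x. f x + g x)"
  by (simp add: smooth_on_def Ck_on_add)

lemma smooth_on_Pair:
  fixes f :: "'a::euclidean_space \<Rightarrow> 'b::euclidean_space" and g :: "'a \<Rightarrow> 'c::euclidean_space"
  assumes "open S" "smooth_on S f" "smooth_on S g"
  shows "smooth_on S (\<lambda>x. (f x, g x))"
proof -
  have 1: "bounded_linear (\<lambda>y::'b. (y, 0::'c))" "bounded_linear (\<lambda>y::'c. (0::'b, y))"
    by (auto intro: bounded_linear_intros)
  have "smooth_on S (\<lambda>x. (f x, 0::'c))"
    by (rule smooth_on_linear_image[OF 1(1) assms(1,2)])
  moreover have "smooth_on S (\<lambda>x. (0::'b, g x))"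
    by (rule smooth_on_linear_image[OF 1(2) assms(1,3)])
  ultimately have "smooth_on S (\<lambda>x. (f x, 0::'c) + (0::'b, g x))"
    using smooth_on_add assms(1) by blast
  then show ?thesis by simp
qed

lemma smooth_on_inverse: "smooth_on {x::real. x \<noteq> 0} inverse"
proof -
  have op: "open {x::real. x \<noteq> 0}" by (simp add: open_Collect_neq)
  have "Ck_on k {x::real. x \<noteq> 0} inverse" for k
  proof (induction k)
    case 0
    show ?case by (simp add: continuous_on_inverse)
  next
    case (Suc k)
    show ?case
    proof (rule Ck_on_SucI[OF op])
      show "(inverse has_derivative (\<lambda>v. - (inverse x * v * inverse x))) (at x)"
        if "x \<in> {x::real. x \<noteq> 0}" for x
        using that by (auto intro: has_derivative_inverse')
      have "Ck_on k {x::real. x \<noteq> 0} (\<lambda>x. (- v) * (inverse x * inverse x))" for v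
        by (intro Ck_on_bilinear[OF bounded_bilinear_mult] Ck_on_const op Suc)
      then show "Ck_on k {x::real. x \<noteq> 0} (\<lambda>x. - (inverse x * v * inverse x))" for v
        by (simp add: mult.commute mult.left_commute)
    qed
  qed
  then show ?thesis by (simp add: smooth_on_def)
qed

lemma smooth_on_abs: "smooth_on {x::real. x \<noteq> 0} abs"
proof (rule smooth_on_local)
  fix x :: real assume "x \<in> {x. x \<noteq> 0}"
  then consider "x > 0" | "x < 0" by fastforce
  then show "\<exists>T. open T \<and> x \<in> T \<and> smooth_on T abs"
  proof cases
    case 1
    have "smooth_on {0<..} (abs :: real \<Rightarrow> real)"
      by (rule smooth_on_cong[OF _ _ smooth_on_bounded_linear[OF bounded_linear_ident]]) auto
    then show ?thesis using 1 by (intro exI[of _ "{0<..}"]) auto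
  next
    case 2
    have "smooth_on {..<0} (abs :: real \<Rightarrow> real)"
      by (rule smooth_on_cong[OF _ _ smooth_on_bounded_linear[OF bounded_linear_minus[OF bounded_linear_ident]]]) auto
    then show ?thesis using 2 by (intro exI[of _ "{..<0}"]) auto
  qed
qed

text \<open>The functions \<open>exp(-1/t) / t\<^sup>n\<close>, extended by zero to \<open>t \<le> 0\<close>.  Derivatives of members of this
  family are linear combinations of members, so one induction on the order of differentiability
  shows that all of them are smooth.\<close>

definition flat :: "nat \<Rightarrow> real \<Rightarrow> real" where
  "flat n t = (if t > 0 then exp (- inverse t) * inverse t ^ n else 0)"

lemma flat_nonneg: "flat n t \<ge> 0" by (simp add: flat_def)
lemma flat_pos_iff: "flat n t > 0 \<longleftrightarrow> t > 0" by (simp add: flat_def)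
lemma flat_zero_iff: "flat n t = 0 \<longleftrightarrow> t \<le> 0" by (auto simp: flat_def)

lemma flat_tendsto_0: "(flat n \<longlongrightarrow> 0) (at 0)"
proof -
  have "((\<lambda>s::real. s ^ n / exp s) \<longlongrightarrow> 0) at_top" by (rule tendsto_power_div_exp_0)
  then have "((\<lambda>t::real. inverse t ^ n / exp (inverse t)) \<longlongrightarrow> 0) (at_right 0)"
    using filterlim_compose[OF _ filterlim_inverse_at_top_right] by fast
  moreover have "eventually (\<lambda>t. inverse t ^ n / exp (inverse t) = flat n t) (at_right 0)"
    by (auto simp: eventually_at_filter flat_def exp_minus field_simps)
  ultimately have "(flat n \<longlongrightarrow> 0) (at_right 0)" using tendsto_cong by fast
  moreover have "(flat n \<longlongrightarrow> 0) (at_left 0)"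
    by (rule tendsto_eventually) (auto simp: eventually_at_filter flat_def)
  ultimately show ?thesis by (simp add: filterlim_split_at)
qed

lemma flat_has_derivative:
  "(flat n has_real_derivative (flat (n + 2) t - real n * flat (n + 1) t)) (at t)"
proof -
  consider "t > 0" | "t < 0" | "t = 0" by linarith
  then show ?thesis
  proof cases
    case 1
    have e: "((\<lambda>t. exp (- inverse t)) has_real_derivative exp (- inverse t) * (inverse t * inverse t)) (at t)"
      using 1 by (auto intro!: derivative_eq_intros simp: power2_eq_square)
    have i: "((\<lambda>t. inverse t ^ n) has_real_derivative real n * inverse t ^ (n - 1) * - (inverse t * inverse t)) (at t)"
      using 1 by (auto intro!: derivative_eq_intros simp: power2_eq_square)
    have p: "real n * inverse t ^ (n - 1) * (inverse t * inverse t) = real n * inverse t ^ (n + 1)"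
      by (cases n) auto
    have "exp (- inverse t) * (inverse t * inverse t) * inverse t ^ n
        + real n * inverse t ^ (n - 1) * - (inverse t * inverse t) * exp (- inverse t)
        = exp (- inverse t) * (inverse t * inverse t * inverse t ^ n)
          - exp (- inverse t) * (real n * inverse t ^ (n - 1) * (inverse t * inverse t))"
      by (simp add: algebra_simps)
    also have "\<dots> = flat (n + 2) t - real n * flat (n + 1) t"
      using 1 unfolding p by (simp add: flat_def mult.assoc mult.left_commute)
    finally have "((\<lambda>t. exp (- inverse t) * inverse t ^ n) has_real_derivative
        (flat (n + 2) t - real n * flat (n + 1) t)) (at t)"
      using DERIV_mult[OF e i] by simp
    then show ?thesis
      by (rule has_field_derivative_transform_within_open[of _ _ _ "{0<..}"]) (use 1 in \<open>auto simp: flat_def\<close>)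
  next
    case 2
    have "((\<lambda>t. 0) has_real_derivative (flat (n + 2) t - real n * flat (n + 1) t)) (at t)"
      using 2 by (auto simp: flat_def)
    then show ?thesis
      by (rule has_field_derivative_transform_within_open[of _ _ _ "{..<0}"]) (use 2 in \<open>auto simp: flat_def\<close>)
  next
    case 3
    have "((\<lambda>h. (flat n (0 + h) - flat n 0) / h) \<longlongrightarrow> 0) (at 0)"
    proof (rule Lim_transform_eventually[OF flat_tendsto_0[of "Suc n"]])
      show "eventually (\<lambda>h. flat (Suc n) h = (flat n (0 + h) - flat n 0) / h) (at 0)"
        by (auto simp: eventually_at_filter flat_def divide_inverse mult.assoc mult.commute mult.left_commute)
    qed
    moreover have "flat (n + 2) t - real n * flat (n + 1) t = 0" using 3 by (simp add: flat_def)
    ultimately show ?thesis using 3 by (simp only: DERIV_def)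
  qed
qed

lemma smooth_on_flat: "smooth_on UNIV (flat n)"
proof -
  have "Ck_on k UNIV (flat n)" for k n
  proof (induction k arbitrary: n)
    case 0
    then show ?case
      using flat_has_derivative DERIV_isCont continuous_at_imp_continuous_on by (metis Ck_on.simps(1))
  next
    case (Suc k)
    show ?case
    proof (rule Ck_on_SucI)
      show "(flat n has_derivative (\<lambda>v. (flat (n + 2) x - real n * flat (n + 1) x) * v)) (at x)" for x
        using flat_has_derivative[of n x] by (simp add: has_field_derivative_def)
      have "Ck_on k UNIV (\<lambda>x. v * (flat (n + 2) x + (- real n) * flat (n + 1) x))" for v
        by (intro Ck_on_bilinear[OF bounded_bilinear_mult] Ck_on_add Ck_on_const Suc) auto
      then show "Ck_on k UNIV (\<lambda>x. (flat (n + 2) x - real n * flat (n + 1) x) * v)" for v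
        by (simp add: mult.commute)
    qed simp
  qed
  then show ?thesis by (simp add: smooth_on_def)
qed

section \<open>Smooth atlases and germs of smooth maps\<close>

notation euclidean_atlas ("\<E>")

lemma smooth_on_open_preimage:
  "smooth_on S f \<Longrightarrow> open S \<Longrightarrow> open T \<Longrightarrow> open (S \<inter> f -` T)"
  using continuous_open_preimage smooth_on_continuous by blast

text \<open>Compatibility of charts alone, without separation and countability axioms.  It passes to
  bundles, submanifolds and quotients, and it suffices for the calculus of smooth maps and
  their tangent maps.\<close>

definition smooth_atlas :: "('a, 'e::euclidean_space) atlas \<Rightarrow> bool" where
  "smooth_atlas A \<longleftrightarrow>
     (\<forall>c\<in>A. inj_on (snd c) (fst c) \<and> open (snd c ` fst c)) \<and>
     (\<forall>c\<in>A. \<forall>d\<in>A. open (snd c ` (fst c \<inter> fst d)) \<and>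
        smooth_on (snd c ` (fst c \<inter> fst d)) (snd d \<circ> chart_inv c))"

lemma smooth_manifold_atlas: "smooth_manifold A \<Longrightarrow> smooth_atlas A"
  by (simp add: smooth_manifold_def smooth_atlas_def)

text \<open>The pointwise form of \<^const>\<open>smooth_map_on\<close>; it composes without tracking domains.\<close>

definition smooth_at ::
  "('a, 'e::euclidean_space) atlas \<Rightarrow> ('b, 'f::euclidean_space) atlas \<Rightarrow> ('a \<Rightarrow> 'b) \<Rightarrow> 'a \<Rightarrow> bool"
  where
  "smooth_at A B F p \<longleftrightarrow>
     (\<exists>c\<in>A. \<exists>d\<in>B. \<exists>V. openin (manifold_topology A) V \<and> p \<in> V \<and> V \<subseteq> fst c \<and>
        F ` V \<subseteq> fst d \<and> smooth_on (snd c ` V) (snd d \<circ> F \<circ> chart_inv c))"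

context
  fixes A :: "('a, 'e::euclidean_space) atlas"
  assumes A: "smooth_atlas A"
begin

lemma inj_chart: "c \<in> A \<Longrightarrow> inj_on (snd c) (fst c)"
  using A by (simp add: smooth_atlas_def)

lemma open_chart: "c \<in> A \<Longrightarrow> open (snd c ` fst c)"
  using A by (simp add: smooth_atlas_def)

lemma openin_atlas: "openin (manifold_topology A) U \<longleftrightarrow>
    U \<subseteq> carrier_of A \<and> (\<forall>c\<in>A. open (snd c ` (U \<inter> fst c)))"
  by (rule openin_manifold_topology) (rule inj_chart)

lemma chart_inv_apply [simp]: "c \<in> A \<Longrightarrow> p \<in> fst c \<Longrightarrow> chart_inv c (snd c p) = p"
  using inj_chart by (simp add: inv_into_f_f)

lemma transition_smooth:
  "c \<in> A \<Longrightarrow> d \<in> A \<Longrightarrow> smooth_on (snd c ` (fst c \<inter> fst d)) (snd d \<circ> chart_inv c)"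
  using A by (simp add: smooth_atlas_def)

lemma open_chart_overlap: "c \<in> A \<Longrightarrow> d \<in> A \<Longrightarrow> open (snd c ` (fst c \<inter> fst d))"
  using A by (simp add: smooth_atlas_def)

lemma openin_chart_domain: "c \<in> A \<Longrightarrow> openin (manifold_topology A) (fst c)"
  using open_chart_overlap by (auto simp: openin_atlas carrier_of_def Int_commute)

lemma openin_chart_preimage:
  assumes c: "c \<in> A" and N: "open N"
  shows "openin (manifold_topology A) {p \<in> fst c. snd c p \<in> N}"
proof (unfold openin_atlas, intro conjI ballI)
  show "{p \<in> fst c. snd c p \<in> N} \<subseteq> carrier_of A" using c by (auto simp: carrier_of_def)
  fix d assume d: "d \<in> A"
  let ?D = "snd d ` (fst d \<inter> fst c)"
  have "open (?D \<inter> (snd c \<circ> chart_inv d) -` N)"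
    by (rule smooth_on_open_preimage[OF transition_smooth[OF d c] open_chart_overlap[OF d c] N])
  moreover have "snd d ` ({p \<in> fst c. snd c p \<in> N} \<inter> fst d) = ?D \<inter> (snd c \<circ> chart_inv d) -` N"
    using d by (auto simp: image_iff)
  ultimately show "open (snd d ` ({p \<in> fst c. snd c p \<in> N} \<inter> fst d))" by simp
qed

lemma carrierE:
  assumes "p \<in> carrier_of A"
  obtains c where "c \<in> A" "p \<in> fst c"
  using assms by (auto simp: carrier_of_def)

lemma topspace_atlas: "topspace (manifold_topology A) = carrier_of A"
proof -
  have "openin (manifold_topology A) (carrier_of A)"
  proof (unfold openin_atlas, intro conjI ballI subset_refl)
    fix c assume c: "c \<in> A"
    then have "carrier_of A \<inter> fst c = fst c" by (auto simp: carrier_of_def)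
    then show "open (snd c ` (carrier_of A \<inter> fst c))" using open_chart[OF c] by simp
  qed
  then show ?thesis by (metis openin_atlas openin_subset openin_topspace subset_antisym)
qed

lemma openin_carrier: "openin (manifold_topology A) (carrier_of A)"
  using topspace_atlas by (metis openin_topspace)

end

text \<open>It is enough to know some smooth function \<open>g\<close> that agrees with the coordinate expression of \<open>F\<close>
  near \<open>p\<close>; this avoids reasoning about \<^const>\<open>inv_into\<close>.\<close>

lemma smooth_atI:
  assumes A: "smooth_atlas A" and c: "c \<in> A" "p \<in> fst c" and d: "d \<in> B"
    and N: "open N" "snd c p \<in> N"
    and F: "\<And>q. q \<in> fst c \<Longrightarrow> snd c q \<in> N \<Longrightarrow> F q \<in> fst d"
    and s: "\<And>q. q \<in> fst c \<Longrightarrow> snd c q \<in> N \<Longrightarrow> snd d (F q) = g (snd c q)" "smooth_on N g"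
  shows "smooth_at A B F p"
proof -
  let ?V = "{p \<in> fst c. snd c p \<in> N}"
  have V: "openin (manifold_topology A) ?V" by (rule openin_chart_preimage[OF A c(1) N(1)])
  then have "open (snd c ` (?V \<inter> fst c))" using openin_atlas[OF A] c by blast
  moreover have "?V \<inter> fst c = ?V" by auto
  ultimately have op: "open (snd c ` ?V)" by simp
  have "smooth_on (snd c ` ?V) (snd d \<circ> F \<circ> chart_inv c)"
    by (rule smooth_on_cong[OF op _ smooth_on_subset[OF s(2)]]) (use s(1) A c in auto)
  then show ?thesis
    unfolding smooth_at_def using c d N F V
    by (intro bexI[of _ c] bexI[of _ d] exI[of _ ?V]) auto
qed

text \<open>The charts that witness smoothness can be exchanged for any other charts around the two
  points: on the overlaps the coordinate expressions differ by transition maps.\<close>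

lemma smooth_atE:
  assumes A: "smooth_atlas A" and B: "smooth_atlas B" and F: "smooth_at A B F p"
    and c: "c \<in> A" "p \<in> fst c" and d: "d \<in> B" "F p \<in> fst d"
  obtains N where "open N" "snd c p \<in> N" "N \<subseteq> snd c ` fst c"
    "\<And>q. q \<in> fst c \<Longrightarrow> snd c q \<in> N \<Longrightarrow> F q \<in> fst d"
    "smooth_on N (snd d \<circ> F \<circ> chart_inv c)"
proof -
  from F obtain c' d' V where c': "c' \<in> A" and d': "d' \<in> B"
    and V: "openin (manifold_topology A) V" "p \<in> V" "V \<subseteq> fst c'" "F ` V \<subseteq> fst d'"
    and s: "smooth_on (snd c' ` V) (snd d' \<circ> F \<circ> chart_inv c')"
    unfolding smooth_at_def by blast
  let ?g = "snd d' \<circ> F \<circ> chart_inv c'"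
  have Vc': "V \<inter> fst c' = V" using V by auto
  have oV: "open (snd c' ` V)" using V(1) c' openin_atlas[OF A] Vc' by metis
  let ?D = "snd d' ` (fst d' \<inter> fst d)"
  define N' where "N' = snd c' ` V \<inter> ?g -` ?D"
  have oN': "open N'"
    unfolding N'_def by (rule smooth_on_open_preimage[OF s oV open_chart_overlap[OF B d' d(1)]])
  let ?C = "snd c ` (fst c \<inter> fst c')"
  define N where "N = ?C \<inter> (snd c' \<circ> chart_inv c) -` N'"
  have "open N"
    unfolding N_def
    by (rule smooth_on_open_preimage[OF transition_smooth[OF A c(1) c'] open_chart_overlap[OF A c(1) c'] oN'])
  moreover have pN': "snd c' p \<in> N'"
    unfolding N'_def using V d d' c' A subsetD[OF V(3,2)] by auto
  then have "snd c p \<in> N" unfolding N_def using c V A by auto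
  moreover have "N \<subseteq> snd c ` fst c" unfolding N_def by auto
  moreover have q: "q \<in> V \<and> F q \<in> fst d' \<inter> fst d" if "q \<in> fst c" "snd c q \<in> N" for q
  proof -
    have C: "snd c q \<in> ?C" and N: "snd c' q \<in> N'" using that A c unfolding N_def by auto
    have "q \<in> fst c'" using C that inj_chart[OF A c(1)] by (auto dest: inj_onD)
    with N obtain t where t: "t \<in> V" "snd c' t = snd c' q" "?g (snd c' t) \<in> ?D" "q \<in> fst c'"
      unfolding N'_def by auto
    then have "t = q" using inj_chart[OF A c'] V by (auto dest: inj_onD)
    then have "q \<in> V" "F q \<in> fst d'" using t V by auto
    moreover have "snd d' (F q) \<in> ?D" using t \<open>t = q\<close> c' A by auto
    then have "F q \<in> fst d" using inj_chart[OF B d'] \<open>F q \<in> fst d'\<close> by (auto dest: inj_onD)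
    ultimately show ?thesis by auto
  qed
  moreover have "smooth_on N (snd d \<circ> F \<circ> chart_inv c)"
  proof (rule smooth_on_cong[OF \<open>open N\<close>])
    have s1: "smooth_on N (snd c' \<circ> chart_inv c)"
      by (rule smooth_on_subset[OF transition_smooth[OF A c(1) c']]) (auto simp: N_def)
    have s2: "smooth_on N' ?g" by (rule smooth_on_subset[OF s]) (auto simp: N'_def)
    have s3: "smooth_on N' (\<lambda>x. (snd d \<circ> chart_inv d') (?g x))"
      by (rule smooth_on_compose[OF transition_smooth[OF B d' d(1)] s2 oN' open_chart_overlap[OF B d' d(1)]])
        (auto simp: N'_def)
    show "smooth_on N (\<lambda>x. (snd d \<circ> chart_inv d') (?g ((snd c' \<circ> chart_inv c) x)))"
      by (rule smooth_on_compose[OF s3 s1 \<open>open N\<close> oN']) (auto simp: N_def)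
    fix x assume "x \<in> N"
    then obtain q' where q': "q' \<in> fst c" "x = snd c q'" using \<open>N \<subseteq> snd c ` fst c\<close> by auto
    with q[of q'] \<open>x \<in> N\<close> show "(snd d \<circ> chart_inv d') (?g ((snd c' \<circ> chart_inv c) x)) = (snd d \<circ> F \<circ> chart_inv c) x"
      using A B c c' d' V by (auto simp: subset_iff)
  qed
  ultimately show thesis using that by blast
qed

lemma smooth_at_carrier: "smooth_at A B F p \<Longrightarrow> p \<in> carrier_of A \<and> F p \<in> carrier_of B"
  unfolding smooth_at_def carrier_of_def by blast

lemma smooth_at_continuous:
  assumes A: "smooth_atlas A" and B: "smooth_atlas B" and F: "smooth_at A B F p"
    and U: "openin (manifold_topology B) U" "F p \<in> U"
  obtains V where "openin (manifold_topology A) V" "p \<in> V" "F ` V \<subseteq> U"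
proof -
  obtain c where c: "c \<in> A" "p \<in> fst c" using smooth_at_carrier[OF F] carrierE[OF A] by blast
  obtain d where d: "d \<in> B" "F p \<in> fst d" using smooth_at_carrier[OF F] carrierE[OF B] by blast
  from smooth_atE[OF A B F c d] obtain N where N: "open N" "snd c p \<in> N" "N \<subseteq> snd c ` fst c"
    and Fd: "\<And>q. q \<in> fst c \<Longrightarrow> snd c q \<in> N \<Longrightarrow> F q \<in> fst d"
    and s: "smooth_on N (snd d \<circ> F \<circ> chart_inv c)" by blast
  let ?N = "N \<inter> (snd d \<circ> F \<circ> chart_inv c) -` (snd d ` (U \<inter> fst d))"
  have "open (snd d ` (U \<inter> fst d))" using U d openin_atlas[OF B] by blast
  then have "open ?N" by (rule smooth_on_open_preimage[OF s N(1)])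
  then have "openin (manifold_topology A) {q \<in> fst c. snd c q \<in> ?N}" by (rule openin_chart_preimage[OF A c(1)])
  moreover have "p \<in> {q \<in> fst c. snd c q \<in> ?N}" using c d N U A by auto
  moreover have "F ` {q \<in> fst c. snd c q \<in> ?N} \<subseteq> U"
  proof
    fix y assume "y \<in> F ` {q \<in> fst c. snd c q \<in> ?N}"
    then obtain q where q: "q \<in> fst c" "snd c q \<in> ?N" "y = F q" by blast
    then have "snd d (F q) \<in> snd d ` (U \<inter> fst d)" using A c by auto
    moreover have "F q \<in> fst d" using Fd q by auto
    ultimately show "y \<in> U" using inj_chart[OF B d(1)] q by (auto dest: inj_onD)
  qed
  ultimately show thesis using that by blast
qed

lemma smooth_at_cong:
  assumes A: "smooth_atlas A" and F: "smooth_at A B F p"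
    and V: "openin (manifold_topology A) V" "p \<in> V" "\<And>q. q \<in> V \<Longrightarrow> F q = G q"
  shows "smooth_at A B G p"
proof -
  from F obtain c d W where c: "c \<in> A" and d: "d \<in> B"
    and W: "openin (manifold_topology A) W" "p \<in> W" "W \<subseteq> fst c" "F ` W \<subseteq> fst d"
    and s: "smooth_on (snd c ` W) (snd d \<circ> F \<circ> chart_inv c)"
    unfolding smooth_at_def by blast
  have VW: "openin (manifold_topology A) (V \<inter> W)" using V W by auto
  have "V \<inter> W \<inter> fst c = V \<inter> W" using W by auto
  then have op: "open (snd c ` (V \<inter> W))" using VW openin_atlas[OF A] c by metis
  have "smooth_on (snd c ` (V \<inter> W)) (snd d \<circ> G \<circ> chart_inv c)"
    by (rule smooth_on_cong[OF op _ smooth_on_subset[OF s]]) (use V W A c in \<open>auto simp: subset_iff\<close>)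
  then show ?thesis unfolding smooth_at_def using c d V W VW
    by (intro bexI[of _ c] bexI[of _ d] exI[of _ "V \<inter> W"]) auto
qed

lemma smooth_map_on_iff:
  assumes A: "smooth_atlas A"
  shows "smooth_map_on A B W F \<longleftrightarrow> openin (manifold_topology A) W \<and> (\<forall>p\<in>W. smooth_at A B F p)"
proof
  assume L: "smooth_map_on A B W F"
  have ex: "\<exists>c\<in>A. \<exists>d\<in>B. \<exists>V. openin (manifold_topology A) V \<and> p \<in> V \<and> V \<subseteq> W \<inter> fst c \<and>
      F ` V \<subseteq> fst d \<and> smooth_on (snd c ` V) (snd d \<circ> F \<circ> chart_inv c)" if "p \<in> W" for p
    using L that by (simp add: smooth_map_on_def)
  have "\<exists>V. openin (manifold_topology A) V \<and> p \<in> V \<and> V \<subseteq> W" if "p \<in> W" for p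
    using ex[OF that] by (elim bexE exE conjE) (rule exI, intro conjI, assumption+, simp)
  then have "\<forall>p\<in>W. \<exists>V. openin (manifold_topology A) V \<and> p \<in> V \<and> V \<subseteq> W" by simp
  then have "openin (manifold_topology A) W" by (rule iffD2[OF openin_subopen])
  moreover have "smooth_at A B F p" if "p \<in> W" for p
  proof -
    from ex[OF that] obtain c d V where cdV: "c \<in> A" "d \<in> B" "openin (manifold_topology A) V" "p \<in> V"
        "V \<subseteq> W \<inter> fst c" "F ` V \<subseteq> fst d" "smooth_on (snd c ` V) (snd d \<circ> F \<circ> chart_inv c)" by blast
    then have "V \<subseteq> fst c" by simp
    with cdV show ?thesis unfolding smooth_at_def by blast
  qed
  ultimately show "openin (manifold_topology A) W \<and> (\<forall>p\<in>W. smooth_at A B F p)" by blast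
next
  assume R: "openin (manifold_topology A) W \<and> (\<forall>p\<in>W. smooth_at A B F p)"
  show "smooth_map_on A B W F"
    unfolding smooth_map_on_def
  proof
    fix p assume p: "p \<in> W"
    then obtain c d V where *: "c \<in> A" "d \<in> B" "openin (manifold_topology A) V" "p \<in> V" "V \<subseteq> fst c"
        "F ` V \<subseteq> fst d" "smooth_on (snd c ` V) (snd d \<circ> F \<circ> chart_inv c)"
      using R unfolding smooth_at_def by meson
    then show "\<exists>c\<in>A. \<exists>d\<in>B. \<exists>V. openin (manifold_topology A) V \<and> p \<in> V \<and> V \<subseteq> W \<inter> fst c \<and>
        F ` V \<subseteq> fst d \<and> smooth_on (snd c ` V) (snd d \<circ> F \<circ> chart_inv c)"
      using R p by (intro bexI[of _ c] bexI[of _ d] exI[of _ "V \<inter> W"])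
        (auto intro: smooth_on_subset[of "snd c ` V"])
  qed
qed

lemma smooth_at_compose:
  assumes A: "smooth_atlas A" and B: "smooth_atlas B" and C: "smooth_atlas C"
    and F: "smooth_at A B F p" and G: "smooth_at B C G (F p)"
  shows "smooth_at A C (\<lambda>x. G (F x)) p"
proof -
  obtain c where c: "c \<in> A" "p \<in> fst c" using smooth_at_carrier[OF F] carrierE[OF A] by blast
  obtain d where d: "d \<in> B" "F p \<in> fst d" using smooth_at_carrier[OF F] carrierE[OF B] by blast
  obtain e where e: "e \<in> C" "G (F p) \<in> fst e" using smooth_at_carrier[OF G] carrierE[OF C] by blast
  from smooth_atE[OF A B F c d] obtain N where N: "open N" "snd c p \<in> N" "N \<subseteq> snd c ` fst c"
    and Fd: "\<And>q. q \<in> fst c \<Longrightarrow> snd c q \<in> N \<Longrightarrow> F q \<in> fst d"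
    and s: "smooth_on N (snd d \<circ> F \<circ> chart_inv c)" by blast
  from smooth_atE[OF B C G d e] obtain P where P: "open P" "snd d (F p) \<in> P" "P \<subseteq> snd d ` fst d"
    and Ge: "\<And>q. q \<in> fst d \<Longrightarrow> snd d q \<in> P \<Longrightarrow> G q \<in> fst e"
    and t: "smooth_on P (snd e \<circ> G \<circ> chart_inv d)" by blast
  let ?N = "N \<inter> (snd d \<circ> F \<circ> chart_inv c) -` P"
  have op: "open ?N" by (rule smooth_on_open_preimage[OF s N(1) P(1)])
  show ?thesis
  proof (rule smooth_atI[OF A c e(1) op])
    show "snd c p \<in> ?N" using c N P A by auto
    show "smooth_on ?N (\<lambda>x. (snd e \<circ> G \<circ> chart_inv d) ((snd d \<circ> F \<circ> chart_inv c) x))"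
      by (rule smooth_on_compose[OF t smooth_on_subset[OF s] op P(1)]) auto
    fix q assume q: "q \<in> fst c" "snd c q \<in> ?N"
    show "G (F q) \<in> fst e" using q Fd Ge c A by auto
    show "snd e (G (F q)) = (snd e \<circ> G \<circ> chart_inv d) ((snd d \<circ> F \<circ> chart_inv c) (snd c q))"
      using q Fd c d A B by auto
  qed
qed

subsection \<open>Euclidean spaces\<close>

lemma smooth_atlas_euclidean: "smooth_atlas (\<E> :: ('e, 'e::euclidean_space) atlas)"
proof -
  have "smooth_on UNIV (\<lambda>x::'e. x)" by (rule smooth_on_bounded_linear) auto
  moreover have "inv_into UNIV (\<lambda>x::'e. x) = (\<lambda>x. x)"
    by (rule ext, rule inv_into_f_eq) auto
  ultimately show ?thesis
    by (simp add: smooth_atlas_def euclidean_atlas_def comp_def)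
qed

lemma carrier_euclidean [simp]: "carrier_of \<E> = UNIV"
  by (simp add: carrier_of_def euclidean_atlas_def)

lemma openin_euclidean: "openin (manifold_topology \<E>) U \<longleftrightarrow> open U"
  unfolding openin_atlas[OF smooth_atlas_euclidean] by (simp add: euclidean_atlas_def carrier_of_def)

lemma euclidean_chart: "(UNIV, \<lambda>x. x) \<in> \<E>" by (simp add: euclidean_atlas_def)

lemma smooth_at_from_euclidean:
  assumes "d \<in> B" "open N" "y \<in> N" "\<And>x. x \<in> N \<Longrightarrow> F x \<in> fst d"
    "\<And>x. x \<in> N \<Longrightarrow> snd d (F x) = g x" "smooth_on N g"
  shows "smooth_at \<E> B F y"
  by (rule smooth_atI[OF smooth_atlas_euclidean euclidean_chart _ assms(1,2)]) (use assms in auto)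

lemma smooth_at_euclideanI:
  assumes "open N" "y \<in> N" "smooth_on N g"
  shows "smooth_at \<E> \<E> g y"
  by (rule smooth_at_from_euclidean[OF euclidean_chart assms(1,2) _ _ assms(3)]) auto

lemma smooth_at_euclideanE:
  assumes "smooth_at \<E> \<E> g y"
  obtains N where "open N" "y \<in> N" "smooth_on N g"
proof -
  have i: "inv_into UNIV (\<lambda>x::'c. x) = (\<lambda>x. x)" for x by (rule ext, rule inv_into_f_eq) auto
  show thesis
    by (rule smooth_atE[OF smooth_atlas_euclidean smooth_atlas_euclidean assms euclidean_chart _ euclidean_chart])
      (use that in \<open>auto simp: comp_def inv_into_f_eq\<close>)
qed

lemma smooth_at_euclidean_fst:
  "smooth_at \<E> \<E> (fst :: 'e::euclidean_space \<times> 'f::euclidean_space \<Rightarrow> 'e) z"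
  by (rule smooth_at_euclideanI[OF open_UNIV UNIV_I smooth_on_bounded_linear[OF bounded_linear_fst open_UNIV]])

lemma smooth_at_euclidean_snd:
  "smooth_at \<E> \<E> (snd :: 'e::euclidean_space \<times> 'f::euclidean_space \<Rightarrow> 'f) z"
  by (rule smooth_at_euclideanI[OF open_UNIV UNIV_I smooth_on_bounded_linear[OF bounded_linear_snd open_UNIV]])

lemma smooth_on_if_smooth_at:
  assumes "\<And>y. y \<in> N \<Longrightarrow> smooth_at \<E> \<E> g y"
  shows "smooth_on N g"
  by (rule smooth_on_local) (use assms smooth_at_euclideanE in metis)

lemma smooth_atlasI:
  assumes "\<And>c. c \<in> A \<Longrightarrow> inj_on (snd c) (fst c)" "\<And>c. c \<in> A \<Longrightarrow> open (snd c ` fst c)"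
    and tr: "\<And>c d p. c \<in> A \<Longrightarrow> d \<in> A \<Longrightarrow> p \<in> fst c \<Longrightarrow> p \<in> fst d \<Longrightarrow>
      (\<exists>N. open N \<and> snd c p \<in> N \<and> N \<subseteq> snd c ` (fst c \<inter> fst d)) \<and>
      smooth_at \<E> \<E> (snd d \<circ> chart_inv c) (snd c p)"
  shows "smooth_atlas A"
  unfolding smooth_atlas_def
proof (intro conjI ballI assms(1,2))
  fix c d assume cd: "c \<in> A" "d \<in> A"
  show "open (snd c ` (fst c \<inter> fst d))"
  proof (subst open_subopen, intro ballI)
    fix y assume "y \<in> snd c ` (fst c \<inter> fst d)"
    then obtain p where "p \<in> fst c" "p \<in> fst d" "y = snd c p" by blast
    then show "\<exists>T. open T \<and> y \<in> T \<and> T \<subseteq> snd c ` (fst c \<inter> fst d)" using tr[OF cd] by simp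
  qed
  show "smooth_on (snd c ` (fst c \<inter> fst d)) (snd d \<circ> chart_inv c)"
  proof (rule smooth_on_if_smooth_at)
    fix y assume "y \<in> snd c ` (fst c \<inter> fst d)"
    then obtain p where "p \<in> fst c" "p \<in> fst d" "y = snd c p" by blast
    then show "smooth_at \<E> \<E> (snd d \<circ> chart_inv c) y" using tr[OF cd] by simp
  qed
qed

lemma smooth_at_chart:
  assumes A: "smooth_atlas A" and c: "c \<in> A" "p \<in> fst c"
  shows "smooth_at A \<E> (snd c) p"
  by (rule smooth_atI[OF A c euclidean_chart open_chart[OF A c(1)], where g = "\<lambda>x. x"])
    (use c in \<open>auto intro: smooth_on_bounded_linear open_chart[OF A]\<close>)

lemma smooth_at_chart_inv:
  assumes A: "smooth_atlas A" and c: "c \<in> A" "y \<in> snd c ` fst c"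
  shows "smooth_at \<E> A (chart_inv c) y"
  by (rule smooth_at_from_euclidean[OF c(1) open_chart[OF A c(1)] c(2), where g = "\<lambda>x. x"])
    (use c A in \<open>auto intro: smooth_on_bounded_linear open_chart[OF A]\<close>)

text \<open>Smoothness of a map into one chart domain is smoothness of its coordinates, because
  the inverse of a chart is smooth.\<close>

lemma smooth_at_into_chart:
  assumes A: "smooth_atlas A" and B: "smooth_atlas B" and d: "d \<in> B"
    and V: "openin (manifold_topology A) V" "p \<in> V" "F ` V \<subseteq> fst d"
    and s: "smooth_at A \<E> (\<lambda>q. snd d (F q)) p"
  shows "smooth_at A B F p"
proof (rule smooth_at_cong[OF A _ V(1,2)])
  have "smooth_at \<E> B (chart_inv d) (snd d (F p))"
    by (rule smooth_at_chart_inv[OF B d]) (use V in auto)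
  from smooth_at_compose[OF A smooth_atlas_euclidean B s this]
  show "smooth_at A B (\<lambda>x. chart_inv d (snd d (F x))) p" .
  show "\<And>q. q \<in> V \<Longrightarrow> chart_inv d (snd d (F q)) = F q"
    using V B d by auto
qed

lemma smooth_at_id:
  assumes A: "smooth_atlas A" and p: "p \<in> carrier_of A"
  shows "smooth_at A A (\<lambda>x. x) p"
proof -
  obtain c where c: "c \<in> A" "p \<in> fst c" using p carrierE[OF A] by blast
  show ?thesis
    by (rule smooth_at_into_chart[OF A A c(1) openin_chart_domain[OF A c(1)] c(2) _ smooth_at_chart[OF A c]]) auto
qed

lemma smooth_at_const:
  assumes A: "smooth_atlas A" and B: "smooth_atlas B" and p: "p \<in> carrier_of A" and b: "b \<in> carrier_of B"
  shows "smooth_at A B (\<lambda>x. b) p"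
proof -
  obtain c where c: "c \<in> A" "p \<in> fst c" using p carrierE[OF A] by blast
  obtain d where d: "d \<in> B" "b \<in> fst d" using b carrierE[OF B] by blast
  show ?thesis
    by (rule smooth_atI[OF A c d(1) open_UNIV, where g = "\<lambda>_. snd d b"]) (use d in \<open>auto intro: smooth_on_const\<close>)
qed

lemma smooth_at_euclidean_compose:
  assumes A: "smooth_atlas A" and f: "smooth_at A \<E> f p"
    and g: "open N" "f p \<in> N" "smooth_on N g"
  shows "smooth_at A \<E> (\<lambda>x. g (f x)) p"
  by (rule smooth_at_compose[OF A smooth_atlas_euclidean smooth_atlas_euclidean f smooth_at_euclideanI[OF g]])

lemma smooth_at_linear:
  assumes A: "smooth_atlas A" and L: "bounded_linear L" and f: "smooth_at A \<E> f p"
  shows "smooth_at A \<E> (\<lambda>x. L (f x)) p"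
  by (rule smooth_at_euclidean_compose[OF A f open_UNIV _ smooth_on_bounded_linear[OF L]]) auto

lemma smooth_at_Pair:
  fixes f :: "'a \<Rightarrow> 'f::euclidean_space" and g :: "'a \<Rightarrow> 'g::euclidean_space"
  assumes A: "smooth_atlas (A :: ('a, 'e::euclidean_space) atlas)"
    and f: "smooth_at A \<E> f p" and g: "smooth_at A \<E> g p"
  shows "smooth_at A \<E> (\<lambda>x. (f x, g x)) p"
proof -
  obtain c where c: "c \<in> A" "p \<in> fst c" using smooth_at_carrier[OF f] carrierE[OF A] by blast
  let ?y = "snd c p"
  have i: "smooth_at \<E> A (chart_inv c) ?y" by (rule smooth_at_chart_inv[OF A c(1)]) (use c in auto)
  have f': "smooth_at \<E> \<E> (\<lambda>y. f (chart_inv c y)) ?y"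
    by (rule smooth_at_compose[OF smooth_atlas_euclidean A smooth_atlas_euclidean i]) (use f c A in simp)
  have g': "smooth_at \<E> \<E> (\<lambda>y. g (chart_inv c y)) ?y"
    by (rule smooth_at_compose[OF smooth_atlas_euclidean A smooth_atlas_euclidean i]) (use g c A in simp)
  obtain N where N: "open N" "?y \<in> N" "smooth_on N (\<lambda>y. f (chart_inv c y))" by (rule smooth_at_euclideanE[OF f'])
  obtain P where P: "open P" "?y \<in> P" "smooth_on P (\<lambda>y. g (chart_inv c y))" by (rule smooth_at_euclideanE[OF g'])
  have OP: "open (N \<inter> P)" using N P by auto
  have "smooth_on (N \<inter> P) (\<lambda>y. (f (chart_inv c y), g (chart_inv c y)))"
    by (rule smooth_on_Pair[OF OP smooth_on_subset[OF N(3)] smooth_on_subset[OF P(3)]]) auto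
  then show ?thesis
    by (intro smooth_atI[OF A c euclidean_chart OP]) (use N P A c in auto)
qed

lemma smooth_at_bilinear:
  fixes f :: "'a \<Rightarrow> 'f::euclidean_space" and g :: "'a \<Rightarrow> 'g::euclidean_space"
    and H :: "'f \<Rightarrow> 'g \<Rightarrow> 'h::euclidean_space"
  assumes A: "smooth_atlas A" and H: "bounded_bilinear H"
    and f: "smooth_at A \<E> f p" and g: "smooth_at A \<E> g p"
  shows "smooth_at A \<E> (\<lambda>x. H (f x) (g x)) p"
proof -
  have "smooth_on UNIV (\<lambda>x::'f \<times> 'g. H (fst x) (snd x))"
    by (rule smooth_on_bilinear[OF H]) (auto intro: smooth_on_bounded_linear bounded_linear_fst bounded_linear_snd)
  from smooth_at_euclidean_compose[OF A smooth_at_Pair[OF A f g] open_UNIV _ this] show ?thesis by simp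
qed

lemma smooth_at_mult:
  fixes f g :: "'a \<Rightarrow> real"
  assumes "smooth_atlas A" "smooth_at A \<E> f p" "smooth_at A \<E> g p"
  shows "smooth_at A \<E> (\<lambda>x. f x * g x) p"
  by (rule smooth_at_bilinear[OF assms(1) bounded_bilinear_mult assms(2,3)])

lemma smooth_at_scaleR:
  assumes "smooth_atlas A" "smooth_at A \<E> f p" "smooth_at A \<E> g p"
  shows "smooth_at A \<E> (\<lambda>x. f x *\<^sub>R g x) p"
  by (rule smooth_at_bilinear[OF assms(1) bounded_bilinear_scaleR assms(2,3)])

lemma smooth_at_inner:
  assumes "smooth_atlas A" "smooth_at A \<E> f p" "smooth_at A \<E> g p"
  shows "smooth_at A \<E> (\<lambda>x. f x \<bullet> g x) p"
  by (rule smooth_at_bilinear[OF assms(1) bounded_bilinear_inner assms(2,3)])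

lemma smooth_at_add:
  fixes f g :: "'a \<Rightarrow> 'f::euclidean_space"
  assumes A: "smooth_atlas A" and f: "smooth_at A \<E> f p" and g: "smooth_at A \<E> g p"
  shows "smooth_at A \<E> (\<lambda>x. f x + g x) p"
proof -
  have "bounded_linear (\<lambda>x::'f \<times> 'f. fst x + snd x)"
    by (intro bounded_linear_add bounded_linear_fst bounded_linear_snd)
  from smooth_at_linear[OF A this smooth_at_Pair[OF A f g]] show ?thesis by simp
qed

lemma smooth_at_uminus:
  fixes f :: "'a \<Rightarrow> 'f::euclidean_space"
  assumes A: "smooth_atlas A" and f: "smooth_at A \<E> f p"
  shows "smooth_at A \<E> (\<lambda>x. - f x) p"
  by (rule smooth_at_linear[OF A bounded_linear_minus[OF bounded_linear_ident] f])

lemma smooth_at_sum: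
  fixes f :: "'i \<Rightarrow> 'a \<Rightarrow> 'f::euclidean_space"
  assumes A: "smooth_atlas A" and p: "p \<in> carrier_of A"
    and f: "\<And>i. i \<in> I \<Longrightarrow> smooth_at A \<E> (f i) p"
  shows "smooth_at A \<E> (\<lambda>x. \<Sum>i\<in>I. f i x) p"
  using f by (induction I rule: infinite_finite_induct)
    (auto intro: smooth_at_const[OF A smooth_atlas_euclidean p] smooth_at_add[OF A])

lemma smooth_at_prod:
  fixes f :: "'i \<Rightarrow> 'a \<Rightarrow> real"
  assumes A: "smooth_atlas A" and p: "p \<in> carrier_of A"
    and f: "\<And>i. i \<in> I \<Longrightarrow> smooth_at A \<E> (f i) p"
  shows "smooth_at A \<E> (\<lambda>x. \<Prod>i\<in>I. f i x) p"
  using f by (induction I rule: infinite_finite_induct)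
    (auto intro: smooth_at_const[OF A smooth_atlas_euclidean p] smooth_at_mult[OF A])

lemma smooth_at_inverse:
  fixes f :: "'a \<Rightarrow> real"
  assumes A: "smooth_atlas A" and f: "smooth_at A \<E> f p" and "f p \<noteq> 0"
  shows "smooth_at A \<E> (\<lambda>x. inverse (f x)) p"
  by (rule smooth_at_euclidean_compose[OF A f _ _ smooth_on_inverse]) (use assms in \<open>auto simp: open_Collect_neq\<close>)

lemma smooth_at_divide:
  fixes f g :: "'a \<Rightarrow> real"
  assumes A: "smooth_atlas A" and f: "smooth_at A \<E> f p"
    and g: "smooth_at A \<E> g p" and "g p \<noteq> 0"
  shows "smooth_at A \<E> (\<lambda>x. f x / g x) p"
  unfolding divide_inverse by (intro smooth_at_mult smooth_at_inverse assms)

lemma smooth_at_abs: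
  fixes f :: "'a \<Rightarrow> real"
  assumes A: "smooth_atlas A" and f: "smooth_at A \<E> f p" and "f p \<noteq> 0"
  shows "smooth_at A \<E> (\<lambda>x. \<bar>f x\<bar>) p"
  by (rule smooth_at_euclidean_compose[OF A f _ _ smooth_on_abs]) (use assms in \<open>auto simp: open_Collect_neq\<close>)

lemma smooth_at_flat:
  assumes A: "smooth_atlas A" and f: "smooth_at A \<E> f p"
  shows "smooth_at A \<E> (\<lambda>x. flat n (f x)) p"
  by (rule smooth_at_euclidean_compose[OF A f _ _ smooth_on_flat]) auto

section \<open>Tangent maps\<close>

text \<open>The derivative at \<open>p\<close> of the coordinate expression of \<open>F\<close>.  For \<open>F\<close> the identity this is the
  derivative of a transition map, so that the chain rule for \<open>rep_deriv\<close> also contains the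
  transformation law of tangent vectors.\<close>

definition rep_deriv ::
  "('a, 'e::euclidean_space) chart \<Rightarrow> ('b, 'f::euclidean_space) chart \<Rightarrow> ('a \<Rightarrow> 'b) \<Rightarrow> 'a \<Rightarrow> 'e \<Rightarrow> 'f" where
  "rep_deriv c d F p = frechet_derivative (snd d \<circ> F \<circ> chart_inv c) (at (snd c p))"

lemma transition_rep_deriv:
  "frechet_derivative (snd d \<circ> chart_inv c) (at (snd c p)) = rep_deriv c d (\<lambda>x. x) p"
  by (simp add: rep_deriv_def comp_def)

lemma rep_deriv_has_derivative:
  assumes A: "smooth_atlas A" and B: "smooth_atlas B" and F: "smooth_at A B F p"
    and c: "c \<in> A" "p \<in> fst c" and d: "d \<in> B" "F p \<in> fst d"
  shows "((snd d \<circ> F \<circ> chart_inv c) has_derivative rep_deriv c d F p) (at (snd c p))"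
  unfolding rep_deriv_def
  by (rule smooth_atE[OF A B F c d]) (rule smooth_on_has_derivative)

lemma rep_deriv_linear:
  assumes "smooth_atlas A" "smooth_atlas B" "smooth_at A B F p"
    "c \<in> A" "p \<in> fst c" "d \<in> B" "F p \<in> fst d"
  shows "linear (rep_deriv c d F p)"
  using rep_deriv_has_derivative[OF assms] by (rule has_derivative_linear)

lemma rep_deriv_cong:
  assumes A: "smooth_atlas A" and B: "smooth_atlas B" and F: "smooth_at A B F p"
    and c: "c \<in> A" "p \<in> fst c" and d: "d \<in> B" "F p \<in> fst d"
    and V: "openin (manifold_topology A) V" "p \<in> V" "\<And>q. q \<in> V \<Longrightarrow> F q = G q"
  shows "rep_deriv c d G p = rep_deriv c d F p"
proof -
  have o: "open (snd c ` (V \<inter> fst c))" using V c openin_atlas[OF A] by blast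
  have "((snd d \<circ> G \<circ> chart_inv c) has_derivative rep_deriv c d F p) (at (snd c p))"
    by (rule has_derivative_transform_within_open[OF rep_deriv_has_derivative[OF A B F c d] o])
      (use V c A in auto)
  from frechet_derivative_at[OF this, symmetric] show ?thesis by (simp add: rep_deriv_def)
qed

lemma rep_deriv_compose:
  assumes A: "smooth_atlas A" and B: "smooth_atlas B" and C: "smooth_atlas C"
    and F: "smooth_at A B F p" and G: "smooth_at B C G (F p)"
    and c: "c \<in> A" "p \<in> fst c" and d: "d \<in> B" "F p \<in> fst d" and e: "e \<in> C" "G (F p) \<in> fst e"
  shows "rep_deriv c e (\<lambda>x. G (F x)) p v = rep_deriv d e G (F p) (rep_deriv c d F p v)"
proof -
  have D: "((\<lambda>x. (snd e \<circ> G \<circ> chart_inv d) ((snd d \<circ> F \<circ> chart_inv c) x)) has_derivative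
      (\<lambda>v. rep_deriv d e G (F p) (rep_deriv c d F p v))) (at (snd c p))"
  proof (rule has_derivative_compose[OF rep_deriv_has_derivative[OF A B F c d]])
    have "(snd d \<circ> F \<circ> chart_inv c) (snd c p) = snd d (F p)" using c A by simp
    then show "((snd e \<circ> G \<circ> chart_inv d) has_derivative rep_deriv d e G (F p))
        (at ((snd d \<circ> F \<circ> chart_inv c) (snd c p)))"
      using rep_deriv_has_derivative[OF B C G d e] by simp
  qed
  obtain N where N: "open N" "snd c p \<in> N" "N \<subseteq> snd c ` fst c"
      "\<And>q. q \<in> fst c \<Longrightarrow> snd c q \<in> N \<Longrightarrow> F q \<in> fst d"
    using smooth_atE[OF A B F c d] by metis
  have "((snd e \<circ> (\<lambda>x. G (F x)) \<circ> chart_inv c) has_derivative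
      (\<lambda>v. rep_deriv d e G (F p) (rep_deriv c d F p v))) (at (snd c p))"
  proof (rule has_derivative_transform_within_open[OF D N(1,2)])
    fix x assume "x \<in> N"
    then obtain q where "q \<in> fst c" "x = snd c q" using N by auto
    then show "(snd e \<circ> G \<circ> chart_inv d) ((snd d \<circ> F \<circ> chart_inv c) x) =
        (snd e \<circ> (\<lambda>x. G (F x)) \<circ> chart_inv c) x"
      using N(4) \<open>x \<in> N\<close> A B c d by simp
  qed
  from frechet_derivative_at[OF this, symmetric] show ?thesis by (simp add: rep_deriv_def)
qed

lemma rep_deriv_id:
  assumes A: "smooth_atlas A" and c: "c \<in> A" "p \<in> fst c"
  shows "rep_deriv c c (\<lambda>x. x) p v = v"
proof -
  have "((snd c \<circ> (\<lambda>x. x) \<circ> chart_inv c) has_derivative (\<lambda>v. v)) (at (snd c p))"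
    by (rule has_derivative_transform_within_open[OF has_derivative_ident open_chart[OF A c(1)]])
      (use A c in auto)
  from frechet_derivative_at[OF this, symmetric] show ?thesis by (simp add: rep_deriv_def)
qed

context
  fixes A :: "('a, 'e::euclidean_space) atlas"
  assumes A: "smooth_atlas A"
begin

lemma smooth_at_id_chart: "c \<in> A \<Longrightarrow> p \<in> fst c \<Longrightarrow> smooth_at A A (\<lambda>x. x) p"
  by (rule smooth_at_id[OF A]) (auto simp: carrier_of_def)

lemma tangent_space_iff:
  "v \<in> tangent_space A p \<longleftrightarrow>
     (\<forall>c\<in>A. \<forall>d\<in>A. p \<in> fst c \<and> p \<in> fst d \<longrightarrow> v d = rep_deriv c d (\<lambda>x. x) p (v c)) \<and>
     (\<forall>c. \<not> (c \<in> A \<and> p \<in> fst c) \<longrightarrow> v c = 0)"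
  by (simp add: tangent_space_def transition_rep_deriv)

lemma tangent_vec_change_chart:
  "v \<in> tangent_space A p \<Longrightarrow> c \<in> A \<Longrightarrow> d \<in> A \<Longrightarrow> p \<in> fst c \<Longrightarrow> p \<in> fst d \<Longrightarrow>
    v d = rep_deriv c d (\<lambda>x. x) p (v c)"
  unfolding tangent_space_iff by blast

lemma tangent_vec_zero: "v \<in> tangent_space A p \<Longrightarrow> \<not> (c \<in> A \<and> p \<in> fst c) \<Longrightarrow> v c = 0"
  unfolding tangent_space_iff by blast

lemma coord_vec_apply:
  "coord_vec A c p e d = (if d \<in> A \<and> p \<in> fst d then rep_deriv c d (\<lambda>x. x) p e else 0)"
  by (simp add: coord_vec_def transition_rep_deriv)

lemma coord_vec_self: "c \<in> A \<Longrightarrow> p \<in> fst c \<Longrightarrow> coord_vec A c p e c = e"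
  by (simp add: coord_vec_apply rep_deriv_id[OF A])

lemma coord_vec_in_tangent_space:
  assumes c: "c \<in> A" "p \<in> fst c"
  shows "coord_vec A c p e \<in> tangent_space A p"
  unfolding tangent_space_iff
proof (intro conjI ballI allI impI)
  fix d d' assume d: "d \<in> A" "d' \<in> A" "p \<in> fst d \<and> p \<in> fst d'"
  then show "coord_vec A c p e d' = rep_deriv d d' (\<lambda>x. x) p (coord_vec A c p e d)"
    using rep_deriv_compose[OF A A A smooth_at_id_chart[OF c] smooth_at_id_chart[OF c] c, of d d' e]
    by (simp add: coord_vec_apply)
qed (auto simp: coord_vec_apply)

lemma tangent_vec_eq_coord_vec:
  assumes "c \<in> A" "p \<in> fst c" "v \<in> tangent_space A p"
  shows "v = coord_vec A c p (v c)"
proof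
  fix d
  show "v d = coord_vec A c p (v c) d"
    using tangent_vec_change_chart[OF assms(3,1) _ assms(2), of d] tangent_vec_zero[OF assms(3), of d]
    by (auto simp: coord_vec_apply)
qed

lemma tangent_vec_eqI:
  assumes "c \<in> A" "p \<in> fst c" "v \<in> tangent_space A p" "w \<in> tangent_space A p" "v c = w c"
  shows "v = w"
  using tangent_vec_eq_coord_vec[OF assms(1,2,3)] tangent_vec_eq_coord_vec[OF assms(1,2,4)] assms(5) by simp

lemma rep_deriv_id_linear:
  "c \<in> A \<Longrightarrow> d \<in> A \<Longrightarrow> p \<in> fst c \<Longrightarrow> p \<in> fst d \<Longrightarrow> linear (rep_deriv c d (\<lambda>x. x) p)"
  by (rule rep_deriv_linear[OF A A smooth_at_id_chart])

lemma tangent_space_lincomb: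
  assumes "v \<in> tangent_space A p" "w \<in> tangent_space A p"
  shows "(\<lambda>c. a *\<^sub>R v c + b *\<^sub>R w c) \<in> tangent_space A p"
  unfolding tangent_space_iff
proof (intro conjI ballI allI impI)
  fix c d assume "c \<in> A" "d \<in> A" "p \<in> fst c \<and> p \<in> fst d"
  moreover from this have "linear (rep_deriv c d (\<lambda>x. x) p)" using rep_deriv_id_linear by blast
  moreover from calculation have "v d = rep_deriv c d (\<lambda>x. x) p (v c)" "w d = rep_deriv c d (\<lambda>x. x) p (w c)"
    using assms tangent_vec_change_chart by blast+
  ultimately show "a *\<^sub>R v d + b *\<^sub>R w d = rep_deriv c d (\<lambda>x. x) p (a *\<^sub>R v c + b *\<^sub>R w c)"
    by (simp only: linear_add linear_cmul)
next
  fix c assume "\<not> (c \<in> A \<and> p \<in> fst c)"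
  then have "v c = 0" "w c = 0" using assms tangent_vec_zero by blast+
  then show "a *\<^sub>R v c + b *\<^sub>R w c = 0" by simp
qed

lemma zero_in_tangent_space: "(\<lambda>_. 0) \<in> tangent_space A p"
  unfolding tangent_space_iff by (auto simp: linear_0[OF rep_deriv_id_linear])

lemma tangent_space_diff:
  assumes "v \<in> tangent_space A p" "w \<in> tangent_space A p"
  shows "(\<lambda>c. v c - w c) \<in> tangent_space A p"
  using tangent_space_lincomb[OF assms, of 1 "-1"] by simp

lemma tangent_linear_diff:
  assumes "tangent_linear A p \<beta>" "v \<in> tangent_space A p" "w \<in> tangent_space A p"
  shows "\<beta> (\<lambda>c. v c - w c) = \<beta> v - \<beta> w"
proof -
  have "\<beta> (\<lambda>c. 1 *\<^sub>R v c + (-1) *\<^sub>R w c) = 1 * \<beta> v + (-1) * \<beta> w"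
    using assms unfolding tangent_linear_def by blast
  then show ?thesis by simp
qed

lemma tangent_linear_zero:
  assumes "tangent_linear A p \<beta>" shows "\<beta> (\<lambda>_. 0) = 0"
  using tangent_linear_diff[OF assms zero_in_tangent_space zero_in_tangent_space] by simp

lemma linear_covector_coord:
  assumes c: "c \<in> A" "p \<in> fst c" and "tangent_linear A p \<beta>"
  shows "linear (\<lambda>e. \<beta> (coord_vec A c p e))"
proof -
  have *: "\<beta> (coord_vec A c p (a *\<^sub>R x + b *\<^sub>R y)) = a * \<beta> (coord_vec A c p x) + b * \<beta> (coord_vec A c p y)" for a b x y
  proof -
    have "coord_vec A c p (a *\<^sub>R x + b *\<^sub>R y) =
        (\<lambda>d. a *\<^sub>R coord_vec A c p x d + b *\<^sub>R coord_vec A c p y d)"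
      by (rule tangent_vec_eqI[OF c])
        (simp_all add: coord_vec_in_tangent_space[OF c] coord_vec_self[OF c] tangent_space_lincomb)
    then show ?thesis
      using assms(3) coord_vec_in_tangent_space[OF c] unfolding tangent_linear_def by simp
  qed
  show ?thesis
    using *[of 1 _ 1] *[of _ _ 0] by (intro linearI) auto
qed

lemma covector_expand:
  assumes c: "c \<in> A" "p \<in> fst c" and \<beta>: "tangent_linear A p \<beta>" and v: "v \<in> tangent_space A p"
  shows "\<beta> v = (\<Sum>b\<in>Basis. (v c \<bullet> b) * \<beta> (coord_vec A c p b))"
  using linear_expand_Basis[OF linear_covector_coord[OF c \<beta>], of "v c"]
    tangent_vec_eq_coord_vec[OF c v] by simp

end

context
  fixes A :: "('a, 'e::euclidean_space) atlas" and B :: "('b, 'f::euclidean_space) atlas" and F p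
  assumes A: "smooth_atlas A" and B: "smooth_atlas B" and F: "smooth_at A B F p"
begin

text \<open>The chart chosen in the definition of \<^const>\<open>tangent_map\<close> is irrelevant: tangent vectors
  transform by the derivatives of the transition maps.\<close>

lemma tangent_map_apply:
  assumes v: "v \<in> tangent_space A p" and c: "c \<in> A" "p \<in> fst c" and d: "d \<in> B" "F p \<in> fst d"
  shows "tangent_map A B F p v d = rep_deriv c d F p (v c)"
proof -
  let ?c = "chart_at A p"
  have c': "?c \<in> A \<and> p \<in> fst ?c"
    unfolding chart_at_def by (rule someI[of _ c]) (use c in auto)
  have "tangent_map A B F p v d = rep_deriv ?c d F p (v ?c)"
    using d by (simp add: tangent_map_def rep_deriv_def Let_def)
  also have "v ?c = rep_deriv c ?c (\<lambda>x. x) p (v c)" using tangent_vec_change_chart[OF A v c(1) _ c(2)] c' by blast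
  also have "rep_deriv ?c d F p \<dots> = rep_deriv c d F p (v c)"
    by (rule rep_deriv_compose[OF A A B smooth_at_id_chart[OF A c] F c _ _ d, symmetric]) (use c' in auto)
  finally show ?thesis .
qed

lemma tangent_map_in_tangent_space:
  assumes v: "v \<in> tangent_space A p"
  shows "tangent_map A B F p v \<in> tangent_space B (F p)"
proof -
  obtain c where c: "c \<in> A" "p \<in> fst c" using smooth_at_carrier[OF F] carrierE[OF A] by blast
  show ?thesis
    unfolding tangent_space_iff[OF B]
  proof (intro conjI ballI allI impI)
    fix d d' assume d: "d \<in> B" "d' \<in> B" "F p \<in> fst d \<and> F p \<in> fst d'"
    then show "tangent_map A B F p v d' = rep_deriv d d' (\<lambda>x. x) (F p) (tangent_map A B F p v d)"
      using rep_deriv_compose[OF A B B F smooth_at_id_chart[OF B, of d] c, of d d'] tangent_map_apply[OF v c]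
      by simp
  next
    fix d assume "\<not> (d \<in> B \<and> F p \<in> fst d)"
    then show "tangent_map A B F p v d = 0" by (auto simp: tangent_map_def Let_def)
  qed
qed

lemma tangent_map_lincomb:
  assumes v: "v \<in> tangent_space A p" and w: "w \<in> tangent_space A p"
  shows "tangent_map A B F p (\<lambda>c. a *\<^sub>R v c + b *\<^sub>R w c) =
    (\<lambda>d. a *\<^sub>R tangent_map A B F p v d + b *\<^sub>R tangent_map A B F p w d)"
proof -
  obtain c where c: "c \<in> A" "p \<in> fst c" using smooth_at_carrier[OF F] carrierE[OF A] by blast
  obtain d where d: "d \<in> B" "F p \<in> fst d" using smooth_at_carrier[OF F] carrierE[OF B] by blast
  show ?thesis
    by (rule tangent_vec_eqI[OF B d])
      (simp_all add: tangent_map_in_tangent_space v w tangent_space_lincomb[OF A] tangent_space_lincomb[OF B]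
        tangent_map_apply[OF _ c d] linear_add[OF rep_deriv_linear[OF A B F c d]] linear_cmul[OF rep_deriv_linear[OF A B F c d]])
qed

lemma tangent_map_coord_vec:
  assumes c: "c \<in> A" "p \<in> fst c" and d: "d \<in> B" "F p \<in> fst d"
  shows "tangent_map A B F p (coord_vec A c p e) = coord_vec B d (F p) (rep_deriv c d F p e)"
  by (rule tangent_vec_eqI[OF B d])
    (simp_all add: tangent_map_in_tangent_space coord_vec_in_tangent_space[OF A c] coord_vec_in_tangent_space[OF B d]
      tangent_map_apply[OF _ c d] coord_vec_self[OF A c] coord_vec_self[OF B d])

lemma tangent_map_cong:
  assumes V: "openin (manifold_topology A) V" "p \<in> V" "\<And>q. q \<in> V \<Longrightarrow> F q = G q"
  shows "tangent_map A B G p v = tangent_map A B F p v"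
proof -
  obtain c where c: "c \<in> A" "p \<in> fst c" using smooth_at_carrier[OF F] carrierE[OF A] by blast
  then have "c \<in> A \<and> p \<in> fst c" ..
  then have c': "chart_at A p \<in> A \<and> p \<in> fst (chart_at A p)"
    unfolding chart_at_def by (rule someI)
  have "rep_deriv (chart_at A p) d G p = rep_deriv (chart_at A p) d F p" if "d \<in> B" "F p \<in> fst d" for d
    using rep_deriv_cong[OF A B F _ _ that V] c' by blast
  moreover have "G p = F p" using V by simp
  ultimately have "tangent_map A B G p v d = tangent_map A B F p v d" for d
    by (cases "d \<in> B \<and> F p \<in> fst d") (auto simp: tangent_map_def Let_def rep_deriv_def)
  then show ?thesis ..
qed

end

lemma tangent_map_compose:
  assumes A: "smooth_atlas A" and B: "smooth_atlas B" and C: "smooth_atlas C"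
    and F: "smooth_at A B F p" and G: "smooth_at B C G (F p)" and v: "v \<in> tangent_space A p"
  shows "tangent_map A C (\<lambda>x. G (F x)) p v = tangent_map B C G (F p) (tangent_map A B F p v)"
proof -
  obtain c where c: "c \<in> A" "p \<in> fst c" using smooth_at_carrier[OF F] carrierE[OF A] by blast
  obtain d where d: "d \<in> B" "F p \<in> fst d" using smooth_at_carrier[OF F] carrierE[OF B] by blast
  obtain e where e: "e \<in> C" "G (F p) \<in> fst e" using smooth_at_carrier[OF G] carrierE[OF C] by blast
  have GF: "smooth_at A C (\<lambda>x. G (F x)) p" by (rule smooth_at_compose[OF A B C F G])
  have Fv: "tangent_map A B F p v \<in> tangent_space B (F p)" by (rule tangent_map_in_tangent_space[OF A B F v])
  show ?thesis
    by (rule tangent_vec_eqI[OF C e])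
      (simp_all add: tangent_map_in_tangent_space[OF A C GF v] tangent_map_in_tangent_space[OF B C G Fv]
        tangent_map_apply[OF A C GF v c e] tangent_map_apply[OF B C G Fv d e] tangent_map_apply[OF A B F v c d]
        rep_deriv_compose[OF A B C F G c d e])
qed

lemma tangent_map_id:
  assumes A: "smooth_atlas A" and p: "p \<in> carrier_of A" and v: "v \<in> tangent_space A p"
  shows "tangent_map A A (\<lambda>x. x) p v = v"
proof -
  obtain c where c: "c \<in> A" "p \<in> fst c" using p carrierE[OF A] by blast
  have s: "smooth_at A A (\<lambda>x. x) p" by (rule smooth_at_id[OF A p])
  show ?thesis
    by (rule tangent_vec_eqI[OF A c])
      (simp_all add: tangent_map_in_tangent_space[OF A A s v] v tangent_map_apply[OF A A s v c c] rep_deriv_id[OF A c])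
qed

lemma tangent_map_const:
  "tangent_map A B (\<lambda>_. q) p v = (\<lambda>_. 0)"
  by (auto simp: tangent_map_def Let_def comp_def fun_eq_iff frechet_derivative_const)

section \<open>Products\<close>

lemma carrier_product: "carrier_of (product_atlas A B) = carrier_of A \<times> carrier_of B"
  by (force simp: carrier_of_def product_atlas_def)

lemma product_atlasE:
  assumes "x \<in> product_atlas A B"
  obtains c d where "c \<in> A" "d \<in> B" "x = (fst c \<times> fst d, map_prod (snd c) (snd d))"
  using assms by (auto simp: product_atlas_def)

lemma product_atlasI: "c \<in> A \<Longrightarrow> d \<in> B \<Longrightarrow> (fst c \<times> fst d, map_prod (snd c) (snd d)) \<in> product_atlas A B"
  unfolding product_atlas_def by blast

lemma map_prod_image_Times: "map_prod f g ` (S \<times> T) = f ` S \<times> g ` T"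
  by auto

lemma smooth_atlas_product:
  fixes A :: "('a, 'e::euclidean_space) atlas" and B :: "('b, 'f::euclidean_space) atlas"
  assumes A: "smooth_atlas A" and B: "smooth_atlas B"
  shows "smooth_atlas (product_atlas A B)"
  unfolding smooth_atlas_def
proof (intro conjI ballI)
  fix x assume "x \<in> product_atlas A B"
  then obtain c d where cd: "c \<in> A" "d \<in> B" and x: "x = (fst c \<times> fst d, map_prod (snd c) (snd d))"
    by (rule product_atlasE)
  show inj: "inj_on (snd x) (fst x)"
    using inj_chart[OF A cd(1)] inj_chart[OF B cd(2)] unfolding x by (auto intro: map_prod_inj_on)
  show "open (snd x ` fst x)"
    using open_chart[OF A cd(1)] open_chart[OF B cd(2)] unfolding x
    by (simp add: map_prod_image_Times open_Times)
  fix y assume "y \<in> product_atlas A B"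
  then obtain c' d' where cd': "c' \<in> A" "d' \<in> B" and y: "y = (fst c' \<times> fst d', map_prod (snd c') (snd d'))"
    by (rule product_atlasE)
  have im: "snd x ` (fst x \<inter> fst y) = snd c ` (fst c \<inter> fst c') \<times> snd d ` (fst d \<inter> fst d')"
    unfolding x y by (simp add: Times_Int_Times map_prod_image_Times)
  have oc: "open (snd c ` (fst c \<inter> fst c'))" and od: "open (snd d ` (fst d \<inter> fst d'))"
    using open_chart_overlap A B cd cd' by blast+
  then show op: "open (snd x ` (fst x \<inter> fst y))" unfolding im by (rule open_Times)
  show "smooth_on (snd x ` (fst x \<inter> fst y)) (snd y \<circ> chart_inv x)"
  proof (rule smooth_on_cong[OF op])
    show "smooth_on (snd x ` (fst x \<inter> fst y))
        (\<lambda>z. ((snd c' \<circ> chart_inv c) (fst z), (snd d' \<circ> chart_inv d) (snd z)))"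
    proof (rule smooth_on_Pair[OF op])
      show "smooth_on (snd x ` (fst x \<inter> fst y)) (\<lambda>z. (snd c' \<circ> chart_inv c) (fst z))"
        by (rule smooth_on_compose[OF transition_smooth[OF A cd(1) cd'(1)] smooth_on_bounded_linear[OF bounded_linear_fst op] op oc])
          (auto simp: im)
      show "smooth_on (snd x ` (fst x \<inter> fst y)) (\<lambda>z. (snd d' \<circ> chart_inv d) (snd z))"
        by (rule smooth_on_compose[OF transition_smooth[OF B cd(2) cd'(2)] smooth_on_bounded_linear[OF bounded_linear_snd op] op od])
          (auto simp: im)
    qed
    fix z assume "z \<in> snd x ` (fst x \<inter> fst y)"
    then obtain p q where z: "z = (snd c p, snd d q)" "p \<in> fst c" "q \<in> fst d" "(p, q) \<in> fst x"
      unfolding x by auto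
    have "chart_inv x z = (p, q)"
      using inv_into_f_f[OF inj z(4)] z(1) by (simp add: x)
    then show "((snd c' \<circ> chart_inv c) (fst z), (snd d' \<circ> chart_inv d) (snd z)) = (snd y \<circ> chart_inv x) z"
      using z A B cd by (simp add: y)
  qed
qed

lemma smooth_at_fst:
  assumes A: "smooth_atlas A" and B: "smooth_atlas B" and p: "p \<in> carrier_of (product_atlas A B)"
  shows "smooth_at (product_atlas A B) A fst p"
proof -
  have P: "smooth_atlas (product_atlas A B)" by (rule smooth_atlas_product[OF A B])
  obtain c d where cd: "c \<in> A" "d \<in> B" "fst p \<in> fst c" "snd p \<in> fst d"
    using p unfolding carrier_product by (auto simp: carrier_of_def)
  show ?thesis
    by (rule smooth_atI[OF P product_atlasI[OF cd(1,2)] _ cd(1) open_UNIV, where g = fst])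
      (use cd in \<open>auto intro: smooth_on_bounded_linear bounded_linear_fst simp: mem_Times_iff\<close>)
qed

lemma smooth_at_snd:
  assumes A: "smooth_atlas A" and B: "smooth_atlas B" and p: "p \<in> carrier_of (product_atlas A B)"
  shows "smooth_at (product_atlas A B) B snd p"
proof -
  have P: "smooth_atlas (product_atlas A B)" by (rule smooth_atlas_product[OF A B])
  obtain c d where cd: "c \<in> A" "d \<in> B" "fst p \<in> fst c" "snd p \<in> fst d"
    using p unfolding carrier_product by (auto simp: carrier_of_def)
  show ?thesis
    by (rule smooth_atI[OF P product_atlasI[OF cd(1,2)] _ cd(2) open_UNIV, where g = snd])
      (use cd in \<open>auto intro: smooth_on_bounded_linear bounded_linear_snd simp: mem_Times_iff\<close>)
qed

lemma smooth_at_Pair_product: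
  assumes C: "smooth_atlas C" and A: "smooth_atlas A" and B: "smooth_atlas B"
    and f: "smooth_at C A f p" and g: "smooth_at C B g p"
  shows "smooth_at C (product_atlas A B) (\<lambda>x. (f x, g x)) p"
proof -
  obtain c where c: "c \<in> A" "f p \<in> fst c" using smooth_at_carrier[OF f] carrierE[OF A] by blast
  obtain d where d: "d \<in> B" "g p \<in> fst d" using smooth_at_carrier[OF g] carrierE[OF B] by blast
  obtain V where V: "openin (manifold_topology C) V" "p \<in> V" "f ` V \<subseteq> fst c"
    using smooth_at_continuous[OF C A f openin_chart_domain[OF A c(1)] c(2)] by blast
  obtain W where W: "openin (manifold_topology C) W" "p \<in> W" "g ` W \<subseteq> fst d"
    using smooth_at_continuous[OF C B g openin_chart_domain[OF B d(1)] d(2)] by blast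
  have "smooth_at C \<E> (\<lambda>x. (snd c (f x), snd d (g x))) p"
    by (intro smooth_at_Pair C smooth_at_compose[OF C A smooth_atlas_euclidean f smooth_at_chart[OF A c]]
        smooth_at_compose[OF C B smooth_atlas_euclidean g smooth_at_chart[OF B d]])
  then show ?thesis
    by (intro smooth_at_into_chart[OF C smooth_atlas_product[OF A B] product_atlasI[OF c(1) d(1)] openin_Int[OF V(1) W(1)]])
      (use V W in auto)
qed

section \<open>Tangent and cotangent bundles\<close>

lemma smooth_at_transition:
  assumes A: "smooth_atlas A" and c: "c \<in> A" "d \<in> A" and y: "y \<in> snd c ` (fst c \<inter> fst d)"
  shows "smooth_at \<E> \<E> (snd d \<circ> chart_inv c) y"
  by (rule smooth_at_euclideanI[OF open_chart_overlap[OF A c] y transition_smooth[OF A c]])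

lemma smooth_at_transition_deriv:
  assumes A: "smooth_atlas A" and c: "c \<in> A" "d \<in> A" and y: "y \<in> snd c ` (fst c \<inter> fst d)"
  shows "smooth_at \<E> \<E> (\<lambda>x. frechet_derivative (snd d \<circ> chart_inv c) (at x) e) y"
  by (rule smooth_at_euclideanI[OF open_chart_overlap[OF A c] y smooth_on_frechet_derivative[OF transition_smooth[OF A c]]])

abbreviation tangent_chart ::
  "('a, 'e::euclidean_space) atlas \<Rightarrow> ('a, 'e) chart \<Rightarrow> ('a \<times> ('a, 'e) tvec, 'e \<times> 'e) chart" where
  "tangent_chart A c \<equiv> ({(p, v). p \<in> fst c \<and> v \<in> tangent_space A p}, \<lambda>(p, v). (snd c p, v c))"

abbreviation cotangent_chart ::
  "('a, 'e::euclidean_space) atlas \<Rightarrow> ('a, 'e) chart \<Rightarrow> ('a \<times> (('a, 'e) tvec \<Rightarrow> real), 'e \<times> 'e) chart" where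
  "cotangent_chart A c \<equiv> ({(p, \<beta>). p \<in> fst c \<and> \<beta> \<in> cotangent_space A p},
      \<lambda>(p, \<beta>). (snd c p, \<Sum>b\<in>Basis. \<beta> (coord_vec A c p b) *\<^sub>R b))"

lemma tangent_atlas_image: "tangent_atlas A = tangent_chart A ` A"
  unfolding tangent_atlas_def image_def by blast

lemma cotangent_atlas_image: "cotangent_atlas A = cotangent_chart A ` A"
  unfolding cotangent_atlas_def image_def by blast

lemma tangent_chart_in: "c \<in> A \<Longrightarrow> tangent_chart A c \<in> tangent_atlas A"
  unfolding tangent_atlas_image by (rule imageI)

lemma cotangent_chart_in: "c \<in> A \<Longrightarrow> cotangent_chart A c \<in> cotangent_atlas A"
  unfolding cotangent_atlas_image by (rule imageI)

lemma carrier_tangent: "carrier_of (tangent_atlas A) = {(p, v). p \<in> carrier_of A \<and> v \<in> tangent_space A p}"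
  unfolding tangent_atlas_image carrier_of_def by (simp, blast)

lemma carrier_cotangent: "carrier_of (cotangent_atlas A) = {(p, v). p \<in> carrier_of A \<and> v \<in> cotangent_space A p}"
  unfolding cotangent_atlas_image carrier_of_def by (simp, blast)

text \<open>A fibre bundle with fibre \<^typ>\<open>'e\<close>, given by trivialisations \<open>L\<close> over the chart domains
  and the coordinate expressions \<open>g\<close> of their transition functions.  The tangent and the cotangent
  bundle are the two instances.\<close>

lemma smooth_atlas_bundle:
  fixes A :: "('a, 'e::euclidean_space) atlas" and F :: "'a \<Rightarrow> 'v set"
    and L :: "('a, 'e) chart \<Rightarrow> 'a \<Rightarrow> 'v \<Rightarrow> 'e"
  assumes A: "smooth_atlas A"
    and bij: "\<And>c p. c \<in> A \<Longrightarrow> p \<in> fst c \<Longrightarrow> bij_betw (L c p) (F p) UNIV"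
    and tr: "\<And>c d p v. c \<in> A \<Longrightarrow> d \<in> A \<Longrightarrow> p \<in> fst c \<Longrightarrow> p \<in> fst d \<Longrightarrow> v \<in> F p \<Longrightarrow>
      L d p v = g c d (snd c p) (L c p v)"
    and sm: "\<And>c d z. c \<in> A \<Longrightarrow> d \<in> A \<Longrightarrow> fst z \<in> snd c ` (fst c \<inter> fst d) \<Longrightarrow>
      smooth_at \<E> \<E> (\<lambda>z. g c d (fst z) (snd z)) z"
  shows "smooth_atlas ((\<lambda>c. ({(p, v). p \<in> fst c \<and> v \<in> F p}, \<lambda>(p, v). (snd c p, L c p v))) ` A)"
proof (rule smooth_atlasI)
  note SE = smooth_atlas_euclidean
  let ?K = "\<lambda>c. ({(p, v). p \<in> fst c \<and> v \<in> F p}, \<lambda>(p, v). (snd c p, L c p v))"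
  have im: "snd (?K c) ` {(p, v). p \<in> S \<and> v \<in> F p} = snd c ` S \<times> UNIV" if "c \<in> A" "S \<subseteq> fst c" for c S
  proof (intro equalityI subsetI)
    fix y assume "y \<in> snd c ` S \<times> (UNIV :: 'e set)"
    then obtain p where p: "p \<in> S" "y = (snd c p, snd y)" by auto
    then obtain v where "v \<in> F p" "L c p v = snd y"
      using bij[OF \<open>c \<in> A\<close>, of p] \<open>S \<subseteq> fst c\<close> unfolding bij_betw_def by (metis UNIV_I imageE subsetD)
    then have "y = snd (?K c) (p, v)" using p(2) by simp
    then show "y \<in> snd (?K c) ` {(p, v). p \<in> S \<and> v \<in> F p}" using p(1) \<open>v \<in> F p\<close> by blast
  qed auto
  have inj: "inj_on (snd (?K c)) (fst (?K c))" if c: "c \<in> A" for c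
  proof (rule inj_onI, clarsimp)
    fix p v q w assume *: "p \<in> fst c" "v \<in> F p" "q \<in> fst c" "w \<in> F q" "snd c p = snd c q" "L c p v = L c q w"
    then have "p = q" using inj_chart[OF A c] by (auto dest: inj_onD)
    then show "p = q \<and> v = w" using * bij[OF c *(1)] by (auto simp: bij_betw_def dest: inj_onD)
  qed
  show "inj_on (snd x) (fst x)" if "x \<in> ?K ` A" for x using that inj by auto
  show "open (snd x ` fst x)" if x: "x \<in> ?K ` A" for x
  proof -
    obtain c where c: "c \<in> A" "x = ?K c" using x by blast
    have "snd x ` fst x = snd c ` fst c \<times> UNIV" using im[OF c(1) subset_refl] unfolding c(2) by simp
    then show ?thesis using open_chart[OF A c(1)] by (simp add: open_Times)
  qed
  fix x y z assume "x \<in> ?K ` A" "y \<in> ?K ` A" and z: "z \<in> fst x" "z \<in> fst y"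
  then obtain c d where c: "c \<in> A" "x = ?K c" and d: "d \<in> A" "y = ?K d" by blast
  have "fst x \<inter> fst y = {(p, v). p \<in> fst c \<inter> fst d \<and> v \<in> F p}" unfolding c d by auto
  then have imxy: "snd x ` (fst x \<inter> fst y) = snd c ` (fst c \<inter> fst d) \<times> UNIV"
    using im[OF c(1) Int_lower1, of "fst d"] unfolding c(2) by simp
  have op: "open (snd x ` (fst x \<inter> fst y))"
    unfolding imxy using open_chart_overlap[OF A c(1) d(1)] by (simp add: open_Times)
  have zi: "snd x z \<in> snd x ` (fst x \<inter> fst y)" using z by blast
  then have z1: "fst (snd x z) \<in> snd c ` (fst c \<inter> fst d)" unfolding imxy by auto
  let ?g = "\<lambda>z. ((snd d \<circ> chart_inv c) (fst z), g c d (fst z) (snd z))"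
  have "smooth_at \<E> \<E> (snd y \<circ> chart_inv x) (snd x z)"
  proof (rule smooth_at_cong[OF SE _ _ zi])
    show "smooth_at \<E> \<E> ?g (snd x z)"
      by (rule smooth_at_Pair[OF SE smooth_at_compose[OF SE SE SE smooth_at_euclidean_fst smooth_at_transition[OF A c(1) d(1) z1]]
            sm[OF c(1) d(1) z1]])
    show "openin (manifold_topology \<E>) (snd x ` (fst x \<inter> fst y))" using op by (simp add: openin_euclidean)
    fix t assume "t \<in> snd x ` (fst x \<inter> fst y)"
    then obtain p v where t: "t = (snd c p, L c p v)" "p \<in> fst c" "p \<in> fst d" "v \<in> F p" "(p, v) \<in> fst x"
      unfolding c(2) d(2) by auto
    have "chart_inv x t = (p, v)"
      using inv_into_f_f[OF inj[OF c(1)], of "(p, v)"] t(1,2,4) by (simp add: c(2))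
    then show "?g t = (snd y \<circ> chart_inv x) t"
      using tr[OF c(1) d(1) t(2,3,4)] t(1,2) A c(1) by (simp add: d(2))
  qed
  with op zi show "(\<exists>N. open N \<and> snd x z \<in> N \<and> N \<subseteq> snd x ` (fst x \<inter> fst y)) \<and>
      smooth_at \<E> \<E> (snd y \<circ> chart_inv x) (snd x z)" by blast
qed

lemma smooth_atlas_tangent:
  fixes A :: "('a, 'e::euclidean_space) atlas"
  assumes A: "smooth_atlas A"
  shows "smooth_atlas (tangent_atlas A)"
  unfolding tangent_atlas_image
proof (rule smooth_atlas_bundle[OF A, where L = "\<lambda>c p v. v c" and F = "tangent_space A" and
      g = "\<lambda>c d x e. \<Sum>b\<in>Basis. (e \<bullet> b) *\<^sub>R frechet_derivative (snd d \<circ> chart_inv c) (at x) b"])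
  note SE = smooth_atlas_euclidean
  fix c p assume c: "c \<in> A" "p \<in> fst c"
  show "bij_betw (\<lambda>v. v c) (tangent_space A p) UNIV"
    by (rule bij_betw_byWitness[where f' = "coord_vec A c p"])
      (use tangent_vec_eq_coord_vec[OF A c] coord_vec_self[OF A c] coord_vec_in_tangent_space[OF A c] in auto)
next
  fix c d p v assume c: "c \<in> A" "d \<in> A" "p \<in> fst c" "p \<in> fst d" and v: "v \<in> tangent_space A p"
  show "v d = (\<Sum>b\<in>Basis. (v c \<bullet> b) *\<^sub>R frechet_derivative (snd d \<circ> chart_inv c) (at (snd c p)) b)"
    unfolding transition_rep_deriv linear_expand_Basis[OF rep_deriv_id_linear[OF A c], symmetric]
    by (rule tangent_vec_change_chart[OF A v c])
next
  note SE = smooth_atlas_euclidean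
  fix c d and z :: "'e \<times> 'e" assume z: "c \<in> A" "d \<in> A" "fst z \<in> snd c ` (fst c \<inter> fst d)"
  show "smooth_at \<E> \<E>
      (\<lambda>z. \<Sum>b\<in>Basis. (snd z \<bullet> b) *\<^sub>R frechet_derivative (snd d \<circ> chart_inv c) (at (fst z)) b) z"
    by (intro smooth_at_sum[OF SE] smooth_at_scaleR[OF SE]
        smooth_at_linear[OF SE bounded_linear_inner_left smooth_at_euclidean_snd]
        smooth_at_compose[OF SE SE SE smooth_at_euclidean_fst smooth_at_transition_deriv[OF A z]]) simp
qed

text \<open>The covector with coordinate vector \<open>\<eta>\<close> in the chart \<open>c\<close>.\<close>

definition covector_of :: "('a, 'e::euclidean_space) atlas \<Rightarrow> ('a, 'e) chart \<Rightarrow> 'a \<Rightarrow> 'e \<Rightarrow> ('a, 'e) tvec \<Rightarrow> real" where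
  "covector_of A c p \<eta> v = (if v \<in> tangent_space A p then \<eta> \<bullet> v c else 0)"

lemma covector_of_in: "smooth_atlas A \<Longrightarrow> covector_of A c p \<eta> \<in> cotangent_space A p"
  by (auto simp: cotangent_space_def tangent_linear_def covector_of_def tangent_space_lincomb inner_add_right)

lemma covector_of_coord_vec:
  assumes "smooth_atlas A" "c \<in> A" "p \<in> fst c"
  shows "covector_of A c p \<eta> (coord_vec A c p e) = \<eta> \<bullet> e"
  by (simp add: covector_of_def coord_vec_in_tangent_space[OF assms] coord_vec_self[OF assms])

lemma covector_change_chart:
  assumes A: "smooth_atlas A" and c: "c \<in> A" "p \<in> fst c" and \<beta>: "\<beta> \<in> cotangent_space A p"
    and v: "v \<in> tangent_space A p"
  shows "\<beta> v = (\<Sum>b\<in>Basis. \<beta> (coord_vec A c p b) *\<^sub>R b) \<bullet> v c"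
  using covector_expand[OF A c _ v, of \<beta>] \<beta>
  by (simp add: cotangent_space_def inner_sum_left inner_sum_right inner_commute mult.commute)

lemma smooth_atlas_cotangent:
  fixes A :: "('a, 'e::euclidean_space) atlas"
  assumes A: "smooth_atlas A"
  shows "smooth_atlas (cotangent_atlas A)"
  unfolding cotangent_atlas_image
proof (rule smooth_atlas_bundle[OF A, where L = "\<lambda>c p \<beta>. \<Sum>b\<in>Basis. \<beta> (coord_vec A c p b) *\<^sub>R b"
      and F = "cotangent_space A" and g = "\<lambda>c d x \<eta>. \<Sum>b\<in>Basis.
        (\<eta> \<bullet> frechet_derivative (snd c \<circ> chart_inv d) (at ((snd d \<circ> chart_inv c) x)) b) *\<^sub>R b"])
  fix c p assume c: "c \<in> A" "p \<in> fst c"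
  let ?L = "\<lambda>\<beta>. \<Sum>b\<in>Basis. \<beta> (coord_vec A c p b) *\<^sub>R b"
  have "covector_of A c p (?L \<beta>) = \<beta>" if "\<beta> \<in> cotangent_space A p" for \<beta>
    using covector_change_chart[OF A c that] that by (auto simp: covector_of_def cotangent_space_def fun_eq_iff)
  moreover have "?L (covector_of A c p \<eta>) = \<eta>" for \<eta>
    by (simp add: covector_of_coord_vec[OF A c] euclidean_representation)
  ultimately show "bij_betw ?L (cotangent_space A p) UNIV"
    by (intro bij_betw_byWitness[where f' = "covector_of A c p"]) (auto intro: covector_of_in[OF A])
next
  fix c d p \<beta> assume c: "c \<in> A" "d \<in> A" "p \<in> fst c" "p \<in> fst d" and \<beta>: "\<beta> \<in> cotangent_space A p"
  show "(\<Sum>b\<in>Basis. \<beta> (coord_vec A d p b) *\<^sub>R b) = (\<Sum>b\<in>Basis.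
      ((\<Sum>b\<in>Basis. \<beta> (coord_vec A c p b) *\<^sub>R b) \<bullet>
        frechet_derivative (snd c \<circ> chart_inv d) (at ((snd d \<circ> chart_inv c) (snd c p))) b) *\<^sub>R b)"
    using covector_change_chart[OF A c(1,3) \<beta> coord_vec_in_tangent_space[OF A c(2,4)]] A c
    by (simp add: coord_vec_apply[OF A] transition_rep_deriv)
next
  note SE = smooth_atlas_euclidean
  fix c d and z :: "'e \<times> 'e" assume z: "c \<in> A" "d \<in> A" "fst z \<in> snd c ` (fst c \<inter> fst d)"
  let ?\<tau> = "snd d \<circ> chart_inv c" and ?\<sigma> = "snd c \<circ> chart_inv d"
  have z2: "?\<tau> (fst z) \<in> snd d ` (fst d \<inter> fst c)" using A z by auto
  have \<tau>: "smooth_at \<E> \<E> (\<lambda>z::'e \<times> 'e. ?\<tau> (fst z)) z"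
    by (rule smooth_at_compose[OF SE SE SE smooth_at_euclidean_fst smooth_at_transition[OF A z]])
  have "smooth_at \<E> \<E> (\<lambda>z::'e \<times> 'e. snd z \<bullet> frechet_derivative ?\<sigma> (at (?\<tau> (fst z))) b) z" for b
    by (rule smooth_at_inner[OF SE smooth_at_euclidean_snd
          smooth_at_compose[OF SE SE SE \<tau> smooth_at_transition_deriv[OF A z(2,1) z2]]])
  then show "smooth_at \<E> \<E>
      (\<lambda>z. \<Sum>b\<in>Basis. (snd z \<bullet> frechet_derivative ?\<sigma> (at (?\<tau> (fst z))) b) *\<^sub>R b) z"
    by (intro smooth_at_sum[OF SE] smooth_at_linear[OF SE bounded_linear_scaleR_left]) simp
qed

text \<open>A projection is smooth if it becomes the first projection in suitable charts.\<close>

lemma smooth_at_bundle_projection: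
  assumes A: "smooth_atlas A" and T: "smooth_atlas T" and x: "x \<in> carrier_of T"
    and ch: "\<And>t. t \<in> T \<Longrightarrow> \<exists>c\<in>A. \<forall>z\<in>fst t. fst z \<in> fst c \<and> snd c (fst z) = fst (snd t z)"
  shows "smooth_at T A fst x"
proof -
  obtain t where t: "t \<in> T" "x \<in> fst t" using x carrierE[OF T] by blast
  from ch[OF t(1)] obtain c where c: "c \<in> A" "\<And>z. z \<in> fst t \<Longrightarrow> fst z \<in> fst c \<and> snd c (fst z) = fst (snd t z)" by blast
  show ?thesis
    by (rule smooth_atI[OF T t c(1) open_UNIV, where g = fst])
      (use c(2) in \<open>auto intro: smooth_on_bounded_linear bounded_linear_fst\<close>)
qed

lemma smooth_at_tangent_fst:
  assumes A: "smooth_atlas A" and x: "x \<in> carrier_of (tangent_atlas A)"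
  shows "smooth_at (tangent_atlas A) A fst x"
proof (rule smooth_at_bundle_projection[OF A smooth_atlas_tangent[OF A] x])
  fix t assume "t \<in> tangent_atlas A"
  then obtain c where c: "c \<in> A" "t = tangent_chart A c" unfolding tangent_atlas_image by blast
  then show "\<exists>c\<in>A. \<forall>z\<in>fst t. fst z \<in> fst c \<and> snd c (fst z) = fst (snd t z)"
    by (intro bexI[OF _ c(1)]) auto
qed

lemma smooth_at_cotangent_fst:
  assumes A: "smooth_atlas A" and x: "x \<in> carrier_of (cotangent_atlas A)"
  shows "smooth_at (cotangent_atlas A) A fst x"
proof (rule smooth_at_bundle_projection[OF A smooth_atlas_cotangent[OF A] x])
  fix t assume "t \<in> cotangent_atlas A"
  then obtain c where c: "c \<in> A" "t = cotangent_chart A c" unfolding cotangent_atlas_image by blast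
  then show "\<exists>c\<in>A. \<forall>z\<in>fst t. fst z \<in> fst c \<and> snd c (fst z) = fst (snd t z)"
    by (intro bexI[OF _ c(1)]) auto
qed

section \<open>Submanifolds\<close>

lemma submanifold_atlas_iff:
  fixes A :: "('a, 'e::euclidean_space) atlas" and \<psi> :: "'a \<Rightarrow> 'f::euclidean_space"
  assumes A: "smooth_atlas A"
  shows "(W, \<psi>) \<in> submanifold_atlas A S \<longleftrightarrow>
    openin (subtopology (manifold_topology A) S) W \<and> inj_on \<psi> W \<and> open (\<psi> ` W) \<and>
    (\<forall>y\<in>\<psi> ` W. smooth_at \<E> A (inv_into W \<psi>) y) \<and>
    (\<forall>p\<in>W. \<exists>V \<Psi>. openin (manifold_topology A) V \<and> p \<in> V \<and>
      (\<forall>q\<in>V. smooth_at A \<E> \<Psi> q) \<and> (\<forall>q\<in>V \<inter> W. \<Psi> q = \<psi> q))"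
  unfolding submanifold_atlas_def mem_Collect_eq prod.case smooth_map_on_iff[OF A]
    smooth_map_on_iff[OF smooth_atlas_euclidean] openin_euclidean
  by blast

context
  fixes A :: "('a, 'e::euclidean_space) atlas" and S :: "'a set"
    and M :: "('a, 'f::euclidean_space) atlas"
  assumes A: "smooth_atlas A" and M: "M = submanifold_atlas A S"
begin

lemma submanifold_chart:
  assumes "c \<in> M"
  shows "openin (subtopology (manifold_topology A) S) (fst c)" "inj_on (snd c) (fst c)" "open (snd c ` fst c)"
    "\<And>y. y \<in> snd c ` fst c \<Longrightarrow> smooth_at \<E> A (chart_inv c) y"
    "\<And>p. p \<in> fst c \<Longrightarrow> \<exists>V \<Psi>. openin (manifold_topology A) V \<and> p \<in> V \<and>
      (\<forall>q\<in>V. smooth_at A \<E> \<Psi> q) \<and> (\<forall>q\<in>V \<inter> fst c. \<Psi> q = snd c q)"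
proof -
  have "(fst c, snd c) \<in> submanifold_atlas A S" using assms M by simp
  note c = this[unfolded submanifold_atlas_iff[OF A]]
  show "openin (subtopology (manifold_topology A) S) (fst c)" "inj_on (snd c) (fst c)" "open (snd c ` fst c)"
    "\<And>y. y \<in> snd c ` fst c \<Longrightarrow> smooth_at \<E> A (chart_inv c) y"
    "\<And>p. p \<in> fst c \<Longrightarrow> \<exists>V \<Psi>. openin (manifold_topology A) V \<and> p \<in> V \<and>
      (\<forall>q\<in>V. smooth_at A \<E> \<Psi> q) \<and> (\<forall>q\<in>V \<inter> fst c. \<Psi> q = snd c q)"
    using c by blast+
qed

text \<open>Near \<open>p\<close> the chart \<open>d\<close> extends to a smooth map \<open>\<Psi>\<close> on the ambient manifold, and the
  transition map is the composition of \<open>\<Psi>\<close> with the inverse of \<open>c\<close>, which is smooth as a map into the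
  ambient manifold.  The overlap is open because the domain of \<open>d\<close> is cut out of \<open>S\<close> by an open set.\<close>

lemma submanifold_chart_transition:
  assumes c: "c \<in> M" and d: "d \<in> M" and p: "p \<in> fst c" "p \<in> fst d"
  shows "(\<exists>N. open N \<and> snd c p \<in> N \<and> N \<subseteq> snd c ` (fst c \<inter> fst d)) \<and>
    smooth_at \<E> \<E> (snd d \<circ> chart_inv c) (snd c p)"
proof -
  note SE = smooth_atlas_euclidean
  obtain W where W: "openin (manifold_topology A) W" "fst d = W \<inter> S"
    using submanifold_chart(1)[OF d] by (auto simp: openin_subtopology)
  have cS: "fst c \<subseteq> S" using submanifold_chart(1)[OF c] openin_imp_subset by blast
  have i: "smooth_at \<E> A (chart_inv c) (snd c p)" using submanifold_chart(4)[OF c] p by blast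
  have ip: "chart_inv c (snd c p) = p" using submanifold_chart(2)[OF c] p by simp
  obtain V \<Psi> where V: "openin (manifold_topology A) V" "p \<in> V"
    "\<forall>q\<in>V. smooth_at A \<E> \<Psi> q" "\<forall>q\<in>V \<inter> fst d. \<Psi> q = snd d q"
    using submanifold_chart(5)[OF d p(2)] by blast
  have "openin (manifold_topology A) (V \<inter> W)" using V W by blast
  then obtain N where N: "openin (manifold_topology \<E>) N" "snd c p \<in> N" "chart_inv c ` N \<subseteq> V \<inter> W"
    using smooth_at_continuous[OF SE A i, of "V \<inter> W"] ip V W p by auto
  let ?N = "N \<inter> snd c ` fst c"
  have oN: "open ?N" using N(1) submanifold_chart(3)[OF c] by (auto simp: openin_euclidean)
  have in_d: "chart_inv c y \<in> V \<inter> fst d" "chart_inv c y \<in> fst c" "snd c (chart_inv c y) = y" if "y \<in> ?N" for y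
  proof -
    show "chart_inv c y \<in> fst c" "snd c (chart_inv c y) = y" using that by (auto intro: inv_into_into f_inv_into_f)
    then show "chart_inv c y \<in> V \<inter> fst d" using that N(3) cS W by blast
  qed
  have "?N \<subseteq> snd c ` (fst c \<inter> fst d)"
  proof
    fix y assume "y \<in> ?N"
    from in_d[OF this] show "y \<in> snd c ` (fst c \<inter> fst d)" by (metis IntD2 IntI image_eqI)
  qed
  moreover have "smooth_at \<E> \<E> (snd d \<circ> chart_inv c) (snd c p)"
  proof (rule smooth_at_cong[OF SE])
    show "smooth_at \<E> \<E> (\<lambda>y. \<Psi> (chart_inv c y)) (snd c p)"
      by (rule smooth_at_compose[OF SE A SE i]) (use V ip in simp)
    show "openin (manifold_topology \<E>) ?N" using oN by (simp add: openin_euclidean)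
    show "snd c p \<in> ?N" using N p by blast
    show "\<Psi> (chart_inv c y) = (snd d \<circ> chart_inv c) y" if "y \<in> ?N" for y using in_d[OF that] V by simp
  qed
  ultimately show ?thesis using oN N(2) p(1) by blast
qed

lemma smooth_atlas_submanifold: "smooth_atlas M"
  by (rule smooth_atlasI) (use submanifold_chart(2,3) submanifold_chart_transition in auto)

lemma carrier_submanifold_subset: "carrier_of M \<subseteq> S"
  using submanifold_chart(1) openin_imp_subset by (fastforce simp: carrier_of_def)

lemma smooth_at_inclusion:
  assumes p: "p \<in> carrier_of M"
  shows "smooth_at M A (\<lambda>x. x) p"
proof -
  obtain c where c: "c \<in> M" "p \<in> fst c" using p by (auto simp: carrier_of_def)
  note SM = smooth_atlas_submanifold
  show ?thesis
  proof (rule smooth_at_cong[OF SM _ openin_chart_domain[OF SM c(1)] c(2)])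
    show "smooth_at M A (\<lambda>x. chart_inv c (snd c x)) p"
      by (rule smooth_at_compose[OF SM smooth_atlas_euclidean A smooth_at_chart[OF SM c]])
        (use submanifold_chart(4)[OF c(1)] c in blast)
    show "chart_inv c (snd c q) = q" if "q \<in> fst c" for q using SM c that by simp
  qed
qed

text \<open>Here the local extensions of the charts are used once more: the coordinates of \<open>F\<close> near \<open>p\<close>
  are the composition of such an extension with \<open>F\<close>.\<close>

lemma smooth_at_into_submanifold:
  assumes B: "smooth_atlas B" and F: "smooth_at B A F p" and Fp: "F p \<in> carrier_of M"
    and V: "openin (manifold_topology B) V" "p \<in> V" "F ` V \<subseteq> S"
  shows "smooth_at B M F p"
proof -
  obtain c where c: "c \<in> M" "F p \<in> fst c" using Fp by (auto simp: carrier_of_def)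
  obtain W where W: "openin (manifold_topology A) W" "fst c = W \<inter> S"
    using submanifold_chart(1)[OF c(1)] by (auto simp: openin_subtopology)
  obtain V' \<Psi> where V': "openin (manifold_topology A) V'" "F p \<in> V'"
    "\<forall>q\<in>V'. smooth_at A \<E> \<Psi> q" "\<forall>q\<in>V' \<inter> fst c. \<Psi> q = snd c q"
    using submanifold_chart(5)[OF c] by blast
  have "openin (manifold_topology A) (V' \<inter> W)" using V' W by blast
  then obtain N where N: "openin (manifold_topology B) N" "p \<in> N" "F ` N \<subseteq> V' \<inter> W"
    using smooth_at_continuous[OF B A F, of "V' \<inter> W"] V' W c by auto
  have NV: "openin (manifold_topology B) (N \<inter> V)" "p \<in> N \<inter> V" using N V by auto
  have im: "F q \<in> V' \<inter> fst c" if "q \<in> N \<inter> V" for q using that N V W by auto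
  show ?thesis
  proof (rule smooth_at_into_chart[OF B smooth_atlas_submanifold c(1) NV])
    show "F ` (N \<inter> V) \<subseteq> fst c" using im by blast
    show "smooth_at B \<E> (\<lambda>q. snd c (F q)) p"
    proof (rule smooth_at_cong[OF B _ NV])
      show "smooth_at B \<E> (\<lambda>q. \<Psi> (F q)) p"
        by (rule smooth_at_compose[OF B A smooth_atlas_euclidean F]) (use V' in blast)
      show "\<Psi> (F q) = snd c (F q)" if "q \<in> N \<inter> V" for q using im[OF that] V' by blast
    qed
  qed
qed

end

section \<open>Quotients\<close>

lemma quotient_atlas_iff:
  fixes A :: "('a, 'e::euclidean_space) atlas" and \<phi> :: "'a set \<Rightarrow> 'f::euclidean_space"
  assumes A: "smooth_atlas A" and P: "P = {p \<in> carrier_of A. R `` {p} \<in> U}"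
  shows "(U, \<phi>) \<in> quotient_atlas A R \<longleftrightarrow>
    U \<subseteq> carrier_of A // R \<and> inj_on \<phi> U \<and> open (\<phi> ` U) \<and> openin (manifold_topology A) P \<and>
    (\<forall>p\<in>P. smooth_at A \<E> (\<lambda>p. \<phi> (R `` {p})) p) \<and>
    (\<forall>p\<in>P. \<exists>X \<sigma>. open X \<and> \<phi> (R `` {p}) \<in> X \<and> (\<forall>x\<in>X. smooth_at \<E> A \<sigma> x) \<and>
        \<sigma> (\<phi> (R `` {p})) = p \<and> (\<forall>x\<in>X. \<sigma> x \<in> P \<and> \<phi> (R `` {\<sigma> x}) = x))"
proof -
  have mP: "x \<in> carrier_of A \<and> R `` {x} \<in> U \<longleftrightarrow> x \<in> P" for x by (simp add: P)
  have dup: "open X \<and> a \<and> (open X \<and> b) \<and> c \<longleftrightarrow> open X \<and> a \<and> b \<and> c" for X :: "'f set" and a b c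
    by blast
  have dup': "openin (manifold_topology A) P \<and> (openin (manifold_topology A) P \<and> b) \<and> c \<longleftrightarrow>
      openin (manifold_topology A) P \<and> b \<and> c" for b c
    by blast
  show ?thesis
    unfolding quotient_atlas_def mem_Collect_eq prod.case smooth_map_on_iff[OF A] Let_def
      smooth_map_on_iff[OF smooth_atlas_euclidean] openin_euclidean mP Collect_mem_eq dup dup' by (rule refl)
qed

context
  fixes A :: "('a, 'e::euclidean_space) atlas" and R :: "('a \<times> 'a) set"
    and N :: "('a set, 'f::euclidean_space) atlas"
  assumes A: "smooth_atlas A" and N: "N = quotient_atlas A R"
begin

lemma quotient_chart:
  assumes "c \<in> N"
  shows "fst c \<subseteq> carrier_of A // R" "inj_on (snd c) (fst c)" "open (snd c ` fst c)"
    "openin (manifold_topology A) {p \<in> carrier_of A. R `` {p} \<in> fst c}"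
    "\<And>p. p \<in> carrier_of A \<Longrightarrow> R `` {p} \<in> fst c \<Longrightarrow> smooth_at A \<E> (\<lambda>p. snd c (R `` {p})) p"
    "\<And>p. p \<in> carrier_of A \<Longrightarrow> R `` {p} \<in> fst c \<Longrightarrow>
      \<exists>X \<sigma>. open X \<and> snd c (R `` {p}) \<in> X \<and> (\<forall>x\<in>X. smooth_at \<E> A \<sigma> x) \<and>
        \<sigma> (snd c (R `` {p})) = p \<and> (\<forall>x\<in>X. \<sigma> x \<in> carrier_of A \<and> R `` {\<sigma> x} \<in> fst c \<and> snd c (R `` {\<sigma> x}) = x)"
  using assms quotient_atlas_iff[OF A refl, of "fst c" "snd c" R] unfolding N by simp_all

text \<open>The transition map is \<open>d \<circ> \<pi> \<circ> \<sigma>\<close> for the projection \<open>\<pi>\<close> and a local section \<open>\<sigma>\<close> belonging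
  to the chart \<open>c\<close>, and \<open>d \<circ> \<pi>\<close> is smooth.\<close>

lemma quotient_chart_transition:
  assumes c: "c \<in> N" and d: "d \<in> N" and u: "u \<in> fst c" "u \<in> fst d"
  shows "(\<exists>Y. open Y \<and> snd c u \<in> Y \<and> Y \<subseteq> snd c ` (fst c \<inter> fst d)) \<and>
    smooth_at \<E> \<E> (snd d \<circ> chart_inv c) (snd c u)"
proof -
  note SE = smooth_atlas_euclidean
  obtain p where p: "p \<in> carrier_of A" "u = R `` {p}"
    using quotient_chart(1)[OF c] u by (auto simp: quotient_def)
  obtain X \<sigma> where X: "open X" "snd c u \<in> X" "\<forall>x\<in>X. smooth_at \<E> A \<sigma> x" "\<sigma> (snd c u) = p"
    "\<forall>x\<in>X. \<sigma> x \<in> carrier_of A \<and> R `` {\<sigma> x} \<in> fst c \<and> snd c (R `` {\<sigma> x}) = x"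
    using quotient_chart(6)[OF c p(1)] u(1) unfolding p(2) by blast
  have s: "smooth_at \<E> A \<sigma> (snd c u)" using X by blast
  obtain V where V: "openin (manifold_topology \<E>) V" "snd c u \<in> V"
      "\<sigma> ` V \<subseteq> {p \<in> carrier_of A. R `` {p} \<in> fst d}"
    using smooth_at_continuous[OF SE A s quotient_chart(4)[OF d]] X(4) p u by auto
  let ?Y = "X \<inter> V"
  have oY: "open ?Y" using X V by (auto simp: openin_euclidean)
  have in_d: "R `` {\<sigma> x} \<in> fst c" "R `` {\<sigma> x} \<in> fst d" "snd c (R `` {\<sigma> x}) = x" if "x \<in> ?Y" for x
    using that X(5) V(3) by auto
  have "?Y \<subseteq> snd c ` (fst c \<inter> fst d)"
  proof
    fix x assume "x \<in> ?Y"
    from in_d[OF this] show "x \<in> snd c ` (fst c \<inter> fst d)" by (metis IntI image_eqI)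
  qed
  moreover have "smooth_at \<E> \<E> (snd d \<circ> chart_inv c) (snd c u)"
  proof (rule smooth_at_cong[OF SE])
    show "smooth_at \<E> \<E> (\<lambda>x. snd d (R `` {\<sigma> x})) (snd c u)"
      by (rule smooth_at_compose[OF SE A SE s quotient_chart(5)[OF d]]) (use X p u in auto)
    show "openin (manifold_topology \<E>) ?Y" using oY by (simp add: openin_euclidean)
    show "snd c u \<in> ?Y" using X V by blast
    show "snd d (R `` {\<sigma> x}) = (snd d \<circ> chart_inv c) x" if "x \<in> ?Y" for x
    proof -
      have "chart_inv c x = R `` {\<sigma> x}"
        using in_d[OF that] quotient_chart(2)[OF c] by (metis inv_into_f_f)
      then show ?thesis by simp
    qed
  qed
  ultimately show ?thesis using oY X(2) V(2) by blast
qed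

lemma smooth_atlas_quotient: "smooth_atlas N"
  by (rule smooth_atlasI) (use quotient_chart(2,3) quotient_chart_transition in auto)

lemma carrier_quotient_subset: "carrier_of N \<subseteq> carrier_of A // R"
  using quotient_chart(1) by (fastforce simp: carrier_of_def)

lemma smooth_at_quotient_projection:
  assumes p: "p \<in> carrier_of A" "R `` {p} \<in> carrier_of N"
  shows "smooth_at A N (\<lambda>p. R `` {p}) p"
proof -
  obtain c where c: "c \<in> N" "R `` {p} \<in> fst c" using p by (auto simp: carrier_of_def)
  show ?thesis
    by (rule smooth_at_into_chart[OF A smooth_atlas_quotient c(1) quotient_chart(4)[OF c(1)] _ _ quotient_chart(5)[OF c(1) p(1) c(2)]])
      (use p c in auto)
qed

text \<open>The projection to a quotient manifold is a submersion.\<close>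

lemma quotient_local_section:
  assumes p: "p \<in> carrier_of A" "R `` {p} \<in> carrier_of N"
  obtains \<sigma> V where "smooth_at N A \<sigma> (R `` {p})" "\<sigma> (R `` {p}) = p"
    "openin (manifold_topology N) V" "R `` {p} \<in> V" "\<And>z. z \<in> V \<Longrightarrow> \<sigma> z \<in> carrier_of A \<and> R `` {\<sigma> z} = z"
proof -
  obtain c where c: "c \<in> N" "R `` {p} \<in> fst c" using p by (auto simp: carrier_of_def)
  obtain X \<sigma> where X: "open X" "snd c (R `` {p}) \<in> X" "\<forall>x\<in>X. smooth_at \<E> A \<sigma> x" "\<sigma> (snd c (R `` {p})) = p"
    "\<forall>x\<in>X. \<sigma> x \<in> carrier_of A \<and> R `` {\<sigma> x} \<in> fst c \<and> snd c (R `` {\<sigma> x}) = x"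
    using quotient_chart(6)[OF c(1) p(1) c(2)] by blast
  let ?V = "{z \<in> fst c. snd c z \<in> X}"
  have "smooth_at N A (\<lambda>z. \<sigma> (snd c z)) (R `` {p})"
    by (rule smooth_at_compose[OF smooth_atlas_quotient smooth_atlas_euclidean A smooth_at_chart[OF smooth_atlas_quotient c]])
      (use X in blast)
  moreover have "openin (manifold_topology N) ?V" by (rule openin_chart_preimage[OF smooth_atlas_quotient c(1) X(1)])
  moreover have "\<sigma> (snd c z) \<in> carrier_of A \<and> R `` {\<sigma> (snd c z)} = z" if "z \<in> ?V" for z
    using that X(5) quotient_chart(2)[OF c(1)] by (auto dest: inj_onD)
  ultimately show thesis using that[of "\<lambda>z. \<sigma> (snd c z)" ?V] c X by simp
qed

text \<open>Precomposing with a local section recovers \<open>G\<close> from its lift.\<close>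

lemma smooth_at_quotient_descends:
  assumes B: "smooth_atlas B" and p: "p \<in> carrier_of A" "R `` {p} \<in> carrier_of N"
    and G: "smooth_at A B (\<lambda>p. G (R `` {p})) p"
  shows "smooth_at N B G (R `` {p})"
proof -
  obtain \<sigma> V where s: "smooth_at N A \<sigma> (R `` {p})" "\<sigma> (R `` {p}) = p"
    "openin (manifold_topology N) V" "R `` {p} \<in> V" "\<And>z. z \<in> V \<Longrightarrow> \<sigma> z \<in> carrier_of A \<and> R `` {\<sigma> z} = z"
    by (rule quotient_local_section[OF p]) blast
  show ?thesis
  proof (rule smooth_at_cong[OF smooth_atlas_quotient _ s(3,4)])
    show "smooth_at N B (\<lambda>z. G (R `` {\<sigma> z})) (R `` {p})"
      by (rule smooth_at_compose[OF smooth_atlas_quotient A B s(1)]) (use s G in simp)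
    show "G (R `` {\<sigma> z}) = G z" if "z \<in> V" for z using s(5)[OF that] by simp
  qed
qed

end

section \<open>Coorientability from a global defining form\<close>

text \<open>The trivialisation sends the class of \<open>(p, v)\<close> to \<open>(p, \<alpha>\<^sub>p(v))\<close>.  It is well defined and
  injective because the classes over \<open>p\<close> are the cosets of \<open>ker \<alpha>\<^sub>p\<close>, and surjective because \<open>\<alpha>\<^sub>p\<close> does
  not vanish.  The maps \<open>[(p, v)] \<mapsto> (c(p), \<alpha>\<^sub>p(v))\<close> are charts of the line bundle that cover it, and in
  these charts the trivialisation is the identity.\<close>

lemma coorientable_if_global_form:
  fixes A :: "('a, 'e::euclidean_space) atlas"
  assumes A: "smooth_atlas A"
    and lin: "\<And>p. p \<in> carrier_of A \<Longrightarrow> tangent_linear A p (\<alpha> p)"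
    and nz: "\<And>p. p \<in> carrier_of A \<Longrightarrow> \<exists>v\<in>tangent_space A p. \<alpha> p v \<noteq> 0"
    and ker: "\<And>p. p \<in> carrier_of A \<Longrightarrow> \<xi> p = {v \<in> tangent_space A p. \<alpha> p v = 0}"
    and sm: "\<And>c e p. c \<in> A \<Longrightarrow> p \<in> fst c \<Longrightarrow> smooth_at A \<E> (\<lambda>q. \<alpha> q (coord_vec A c q e)) p"
  shows "coorientable A \<xi>"
proof -
  note SE = smooth_atlas_euclidean
  let ?T = "tangent_atlas A"
  define R where "R = normal_rel A \<xi>"
  define L where "L = normal_line_bundle A \<xi>"
  have L: "L = quotient_atlas ?T R" by (simp add: L_def R_def normal_line_bundle_def)
  note ST = smooth_atlas_tangent[OF A]
  note SL = smooth_atlas_quotient[OF ST L]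
  have cls: "R `` {(p, v)} = {(p, w) | w. w \<in> tangent_space A p \<and> \<alpha> p w = \<alpha> p v}"
    if p: "p \<in> carrier_of A" and v: "v \<in> tangent_space A p" for p v
  proof -
    have "(\<lambda>c. v c - w c) \<in> \<xi> p \<longleftrightarrow> \<alpha> p w = \<alpha> p v" if w: "w \<in> tangent_space A p" for w
      using tangent_linear_diff[OF A lin[OF p] v w] tangent_space_diff[OF A v w] ker[OF p] by auto
    then show ?thesis using p v unfolding R_def normal_rel_def by auto
  qed
  define F where "F = (\<lambda>Z. let z = (SOME z. z \<in> Z) in (fst z, \<alpha> (fst z) (snd z)))"
  have F: "F (R `` {(p, v)}) = (p, \<alpha> p v)" if p: "p \<in> carrier_of A" and v: "v \<in> tangent_space A p" for p v
  proof -
    have "(p, v) \<in> R `` {(p, v)}" using v by (simp add: cls[OF p v])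
    then have "(SOME z. z \<in> R `` {(p, v)}) \<in> R `` {(p, v)}" by (rule someI)
    then show ?thesis by (auto simp: cls[OF p v] F_def Let_def)
  qed
  have F_inj: "R `` {(p, v)} = R `` {(q, w)}"
    if "p \<in> carrier_of A" "v \<in> tangent_space A p" "q \<in> carrier_of A" "w \<in> tangent_space A q"
      "(p, \<alpha> p v) = (q, \<alpha> q w)" for p v q w
    using that cls[OF that(1,2)] cls[OF that(3,4)] by auto
  have surj: "\<exists>v\<in>tangent_space A p. \<alpha> p v = t" if p: "p \<in> carrier_of A" for p t
  proof -
    obtain v where v: "v \<in> tangent_space A p" "\<alpha> p v \<noteq> 0" using nz[OF p] by blast
    let ?w = "\<lambda>c. (t / \<alpha> p v) *\<^sub>R v c + 0 *\<^sub>R v c"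
    have "?w \<in> tangent_space A p" by (rule tangent_space_lincomb[OF A v(1) v(1)])
    moreover have "\<alpha> p ?w = t / \<alpha> p v * \<alpha> p v + 0 * \<alpha> p v"
      using lin[OF p] v unfolding tangent_linear_def by blast
    ultimately show ?thesis using v by (intro bexI[of _ ?w]) auto
  qed
  define U where "U = (\<lambda>c :: ('a, 'e) chart. {R `` {(p, v)} | p v. p \<in> fst c \<and> v \<in> tangent_space A p})"
  define \<phi> where "\<phi> = (\<lambda>(c :: ('a, 'e) chart) Z. (snd c (fst (F Z)), snd (F Z)))"
  have U_iff: "R `` {(p, v)} \<in> U c \<longleftrightarrow> p \<in> fst c" if c: "c \<in> A" and p: "p \<in> carrier_of A" and v: "v \<in> tangent_space A p" for c p v
  proof
    assume "R `` {(p, v)} \<in> U c"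
    then obtain q w where q: "R `` {(p, v)} = R `` {(q, w)}" "q \<in> fst c" "w \<in> tangent_space A q"
      unfolding U_def by blast
    moreover have "q \<in> carrier_of A" using q c by (auto simp: carrier_of_def)
    ultimately show "p \<in> fst c" using F[OF p v] F[of q w] by simp
  qed (use v in \<open>auto simp: U_def\<close>)
  have phi: "\<phi> c (R `` {(p, v)}) = (snd c p, \<alpha> p v)" if "p \<in> carrier_of A" "v \<in> tangent_space A p" for c p v
    using F[OF that] by (simp add: \<phi>_def)
  have chart: "(U c, \<phi> c) \<in> L" if c: "c \<in> A" for c
  proof -
    have carr: "p \<in> carrier_of A" if "p \<in> fst c" for p using c that by (auto simp: carrier_of_def)
    have "U c \<subseteq> carrier_of ?T // R"
      using carr by (auto simp: U_def carrier_tangent intro!: quotientI)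
    moreover have "inj_on (\<phi> c) (U c)"
    proof (rule inj_onI)
      fix Z Z' assume "Z \<in> U c" "Z' \<in> U c" and eq: "\<phi> c Z = \<phi> c Z'"
      then obtain p v q w where Z: "Z = R `` {(p, v)}" "p \<in> fst c" "v \<in> tangent_space A p"
          "Z' = R `` {(q, w)}" "q \<in> fst c" "w \<in> tangent_space A q" unfolding U_def by blast
      with eq have "snd c p = snd c q" "\<alpha> p v = \<alpha> q w" using phi carr by simp_all
      moreover from this(1) have "p = q" using inj_chart[OF A c] Z by (auto dest: inj_onD)
      ultimately have "(p, \<alpha> p v) = (q, \<alpha> q w)" by simp
      then show "Z = Z'" unfolding Z(1) Z(4) by (rule F_inj[OF carr[OF Z(2)] Z(3) carr[OF Z(5)] Z(6)])
    qed
    moreover have "\<phi> c ` U c = snd c ` fst c \<times> UNIV"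
    proof (intro equalityI subsetI)
      fix y assume "y \<in> \<phi> c ` U c"
      then obtain p v where y: "y = \<phi> c (R `` {(p, v)})" "p \<in> fst c" "v \<in> tangent_space A p"
        unfolding U_def by blast
      then show "y \<in> snd c ` fst c \<times> UNIV" using phi[OF carr[OF y(2)] y(3), of c] by simp
    next
      fix y assume "y \<in> snd c ` fst c \<times> (UNIV :: real set)"
      then obtain p t where y: "p \<in> fst c" "y = (snd c p, t)" by auto
      obtain v where v: "v \<in> tangent_space A p" "\<alpha> p v = t" using surj[OF carr[OF y(1)]] by blast
      have "R `` {(p, v)} \<in> U c" using y v unfolding U_def by blast
      moreover have "\<phi> c (R `` {(p, v)}) = y" using phi[OF carr[OF y(1)] v(1)] v y by simp
      ultimately show "y \<in> \<phi> c ` U c" by blast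
    qed
    then have "open (\<phi> c ` U c)" using open_chart[OF A c] by (simp add: open_Times)
    moreover have P: "fst (tangent_chart A c) = {x \<in> carrier_of ?T. R `` {x} \<in> U c}"
      using U_iff[OF c] carr by (auto simp: carrier_tangent)
    moreover have "openin (manifold_topology ?T) (fst (tangent_chart A c))"
      using openin_chart_domain[OF ST tangent_chart_in[OF c]] by simp
    moreover have "smooth_at ?T \<E> (\<lambda>x. \<phi> c (R `` {x})) x \<and>
      (\<exists>X \<sigma>. open X \<and> \<phi> c (R `` {x}) \<in> X \<and> (\<forall>y\<in>X. smooth_at \<E> ?T \<sigma> y) \<and>
        \<sigma> (\<phi> c (R `` {x})) = x \<and>
        (\<forall>y\<in>X. \<sigma> y \<in> fst (tangent_chart A c) \<and> \<phi> c (R `` {\<sigma> y}) = y))"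
      if xc: "x \<in> fst (tangent_chart A c)" for x
    proof
      have x: "x \<in> carrier_of ?T" "R `` {x} \<in> U c" using xc P by blast+
      obtain p0 v0 where p0: "x = (p0, v0)" "p0 \<in> fst c" "v0 \<in> tangent_space A p0" using xc by auto
      define b where "b = (\<lambda>e q. \<alpha> q (coord_vec A c q e))"
      have b: "smooth_at A \<E> (b e) q" if "q \<in> fst c" for e q
        unfolding b_def by (rule sm[OF c that])
      have \<alpha>b: "\<alpha> q (coord_vec A c q e) = b e q" for q e by (simp add: b_def)
      show "smooth_at ?T \<E> (\<lambda>x. \<phi> c (R `` {x})) x"
      proof (rule smooth_at_cong[OF ST _ openin_chart_domain[OF ST tangent_chart_in[OF c]] xc])
        note ch = smooth_at_chart[OF ST tangent_chart_in[OF c] xc]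
        have f: "smooth_at ?T A fst x" by (rule smooth_at_tangent_fst[OF A x(1)])
        show "smooth_at ?T \<E> (\<lambda>z. (fst (snd (tangent_chart A c) z),
            \<Sum>e\<in>Basis. (snd (snd (tangent_chart A c) z) \<bullet> e) * b e (fst z))) x"
        proof (intro smooth_at_Pair[OF ST] smooth_at_sum[OF ST x(1)] smooth_at_mult[OF ST])
          show "smooth_at ?T \<E> (\<lambda>z. fst (snd (tangent_chart A c) z)) x"
            by (rule smooth_at_linear[OF ST bounded_linear_fst ch])
          show "smooth_at ?T \<E> (\<lambda>z. snd (snd (tangent_chart A c) z) \<bullet> e) x" for e
            by (rule smooth_at_linear[OF ST bounded_linear_inner_left smooth_at_linear[OF ST bounded_linear_snd ch]])
          show "smooth_at ?T \<E> (\<lambda>z. b e (fst z)) x" for e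
            by (rule smooth_at_compose[OF ST A SE f]) (use b p0 in simp)
        qed
        fix z assume "z \<in> fst (tangent_chart A c)"
        then obtain p v where z: "z = (p, v)" "p \<in> fst c" "v \<in> tangent_space A p" by auto
        show "(fst (snd (tangent_chart A c) z),
            \<Sum>e\<in>Basis. (snd (snd (tangent_chart A c) z) \<bullet> e) * b e (fst z)) = \<phi> c (R `` {z})"
          using phi[OF carr[OF z(2)] z(3)] covector_expand[OF A c z(2) lin[OF carr[OF z(2)]] z(3)] z(1)
          by (simp add: b_def)
      qed
      obtain v1 where v1: "v1 \<in> tangent_space A p0" "\<alpha> p0 v1 \<noteq> 0" using nz[OF carr[OF p0(2)]] by blast
      let ?e0 = "v0 c" and ?e1 = "v1 c"
      have b0: "b ?e0 p0 = \<alpha> p0 v0" and b1: "b ?e1 p0 \<noteq> 0"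
        using tangent_vec_eq_coord_vec[OF A c p0(2)] p0(3) v1 by (simp_all add: b_def)
      let ?i = "chart_inv c"
      have bi: "smooth_at \<E> \<E> (\<lambda>y. b e (?i y)) y" if "y \<in> snd c ` fst c" for e y
        by (rule smooth_at_compose[OF SE A SE smooth_at_chart_inv[OF A c that]])
          (use that A c b in auto)
      have oY: "open (snd c ` fst c \<inter> (\<lambda>y. b ?e1 (?i y)) -` {t. t \<noteq> 0})"
        by (rule smooth_on_open_preimage[OF smooth_on_if_smooth_at[OF bi] open_chart[OF A c]])
          (auto simp: open_Collect_neq)
      \<comment> \<open>The section moves \<open>v\<^sub>0\<close> in the direction of a vector \<open>v\<^sub>1\<close> on which \<open>\<alpha>\<close> does not vanish, by the
        multiple for which \<open>\<alpha>\<close> takes the prescribed value; it passes through \<open>v\<^sub>0\<close>.\<close>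
      define X where "X = (snd c ` fst c \<inter> (\<lambda>y. b ?e1 (?i y)) -` {t. t \<noteq> 0}) \<times> (UNIV :: real set)"
      have X: "open X" unfolding X_def using oY by (rule open_Times) auto
      define g where "g = (\<lambda>y::'e \<times> real. (fst y, ?e0 + ((snd y + - b ?e0 (?i (fst y))) / b ?e1 (?i (fst y))) *\<^sub>R ?e1))"
      define \<sigma> where "\<sigma> = (\<lambda>y. (?i (fst y), coord_vec A c (?i (fst y)) (snd (g y))))"
      have \<sigma>P: "?i (fst y) \<in> fst c \<and> snd c (?i (fst y)) = fst y" if "y \<in> X" for y
        using that A c unfolding X_def by auto
      have \<sigma>T: "\<sigma> y \<in> fst (tangent_chart A c)" if "y \<in> X" for y
        using \<sigma>P[OF that] coord_vec_in_tangent_space[OF A c] by (simp add: \<sigma>_def)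
      have sg: "smooth_on X g"
      proof (rule smooth_on_if_smooth_at)
        fix y assume y: "y \<in> X"
        note f = smooth_at_euclidean_fst smooth_at_euclidean_snd
        have fy: "fst y \<in> snd c ` fst c" "b ?e1 (?i (fst y)) \<noteq> 0" using y by (auto simp: X_def)
        have bf: "smooth_at \<E> \<E> (\<lambda>y::'e \<times> real. b e (?i (fst y))) y" for e
          by (rule smooth_at_compose[OF SE SE SE f(1) bi[OF fy(1)]])
        show "smooth_at \<E> \<E> g y"
          unfolding g_def
          by (intro smooth_at_Pair[OF SE f(1)] smooth_at_add[OF SE] smooth_at_const[OF SE SE]
              smooth_at_scaleR[OF SE] smooth_at_divide[OF SE _ bf] smooth_at_uminus[OF SE bf] f(2) fy(2)) auto
      qed
      show "\<exists>X \<sigma>. open X \<and> \<phi> c (R `` {x}) \<in> X \<and> (\<forall>y\<in>X. smooth_at \<E> ?T \<sigma> y) \<and>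
        \<sigma> (\<phi> c (R `` {x})) = x \<and>
        (\<forall>y\<in>X. \<sigma> y \<in> fst (tangent_chart A c) \<and> \<phi> c (R `` {\<sigma> y}) = y)"
      proof (intro exI[of _ X] exI[of _ \<sigma>] conjI X ballI)
        have px: "\<phi> c (R `` {x}) = (snd c p0, \<alpha> p0 v0)" using phi[OF carr[OF p0(2)] p0(3)] p0 by simp
        show "\<phi> c (R `` {x}) \<in> X" unfolding px X_def using p0 b1 A c by simp
        show "\<sigma> (\<phi> c (R `` {x})) = x"
          unfolding px \<sigma>_def g_def using p0 A c b0 b1 tangent_vec_eq_coord_vec[OF A c p0(2,3)] by simp
        fix y assume y: "y \<in> X"
        show "smooth_at \<E> ?T \<sigma> y"
        proof (rule smooth_at_from_euclidean[OF tangent_chart_in[OF c] X y \<sigma>T _ sg])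
          show "snd (tangent_chart A c) (\<sigma> z) = g z" if "z \<in> X" for z
            using \<sigma>P[OF that] coord_vec_self[OF A c] by (simp add: \<sigma>_def) (simp add: g_def)
        qed
        let ?p = "?i (fst y)"
        have p: "?p \<in> fst c" "snd c ?p = fst y" using \<sigma>P[OF y] by auto
        have v: "coord_vec A c ?p (snd (g y)) \<in> tangent_space A ?p" by (rule coord_vec_in_tangent_space[OF A c p(1)])
        show "\<sigma> y \<in> fst (tangent_chart A c)" by (rule \<sigma>T[OF y])
        have l: "linear (\<lambda>e. b e ?p)"
          unfolding b_def by (rule linear_covector_coord[OF A c p(1) lin[OF carr[OF p(1)]]])
        have y_nz: "b ?e1 ?p \<noteq> 0" using y by (auto simp: X_def)
        have "\<alpha> ?p (coord_vec A c ?p (snd (g y))) = b (snd (g y)) ?p" by (simp add: b_def)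
        also have "\<dots> = snd y"
          using y_nz by (simp add: g_def linear_add[OF l] linear_cmul[OF l])
        finally show "\<phi> c (R `` {\<sigma> y}) = y"
          unfolding \<sigma>_def using phi[OF carr[OF p(1)] v] p by simp
      qed
    qed
    ultimately show ?thesis unfolding L quotient_atlas_iff[OF ST P] by blast
  qed
  have carrierL: "carrier_of L = {R `` {(p, v)} | p v. p \<in> carrier_of A \<and> v \<in> tangent_space A p}"
  proof (intro equalityI subsetI)
    fix Z assume "Z \<in> carrier_of L"
    then show "Z \<in> {R `` {(p, v)} | p v. p \<in> carrier_of A \<and> v \<in> tangent_space A p}"
      using subsetD[OF carrier_quotient_subset[OF ST L]] by (force simp: quotient_def carrier_tangent)
  next
    fix Z assume "Z \<in> {R `` {(p, v)} | p v. p \<in> carrier_of A \<and> v \<in> tangent_space A p}"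
    then obtain p v where Z: "Z = R `` {(p, v)}" "p \<in> carrier_of A" "v \<in> tangent_space A p" by blast
    obtain c where c: "c \<in> A" "p \<in> fst c" using Z carrierE[OF A] by blast
    have "Z \<in> U c" using U_iff[OF c(1) Z(2,3)] Z c by simp
    then show "Z \<in> carrier_of L" using chart[OF c(1)] by (force simp: carrier_of_def)
  qed
  let ?PA = "product_atlas A (\<E> :: (real, real) atlas)"
  note SP = smooth_atlas_product[OF A SE]
  have cP: "(fst c \<times> UNIV, map_prod (snd c) (\<lambda>x::real. x)) \<in> ?PA" if "c \<in> A" for c
    using product_atlasI[OF that euclidean_chart] by simp
  have bij: "bij_betw F (carrier_of L) (carrier_of ?PA)"
    unfolding bij_betw_def
  proof
    show "inj_on F (carrier_of L)"
    proof (rule inj_onI)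
      fix Z Z' assume "Z \<in> carrier_of L" "Z' \<in> carrier_of L" and eq: "F Z = F Z'"
      then obtain p v q w where Z: "Z = R `` {(p, v)}" "p \<in> carrier_of A" "v \<in> tangent_space A p"
          "Z' = R `` {(q, w)}" "q \<in> carrier_of A" "w \<in> tangent_space A q" unfolding carrierL by blast
      then have "(p, \<alpha> p v) = (q, \<alpha> q w)" using eq F[OF Z(2,3)] F[OF Z(5,6)] by metis
      then show "Z = Z'" unfolding Z(1) Z(4) by (rule F_inj[OF Z(2,3,5,6)])
    qed
    show "F ` carrier_of L = carrier_of ?PA"
    proof (intro equalityI subsetI)
      fix y assume "y \<in> F ` carrier_of L"
      then obtain p v where y: "y = F (R `` {(p, v)})" "p \<in> carrier_of A" "v \<in> tangent_space A p"
        unfolding carrierL by blast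
      then show "y \<in> carrier_of ?PA" unfolding carrier_product using F[OF y(2,3)] by simp
    next
      fix y assume "y \<in> carrier_of ?PA"
      then obtain p t where y: "y = (p, t)" "p \<in> carrier_of A" unfolding carrier_product by auto
      obtain v where v: "v \<in> tangent_space A p" "\<alpha> p v = t" using surj[OF y(2)] by blast
      have "F (R `` {(p, v)}) = y" using F[OF y(2) v(1)] v y by simp
      moreover have "R `` {(p, v)} \<in> carrier_of L" unfolding carrierL using y v by blast
      ultimately show "y \<in> F ` carrier_of L" by blast
    qed
  qed
  have "smooth_map_on L ?PA (carrier_of L) F"
    unfolding smooth_map_on_iff[OF SL]
  proof (intro conjI ballI openin_carrier[OF SL])
    fix Z assume Z: "Z \<in> carrier_of L"
    then obtain p v where Z: "Z = R `` {(p, v)}" "p \<in> carrier_of A" "v \<in> tangent_space A p" unfolding carrierL by blast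
    obtain c where c: "c \<in> A" "p \<in> fst c" using Z carrierE[OF A] by blast
    have ZU: "Z \<in> U c" using U_iff[OF c(1) Z(2,3)] Z c by simp
    show "smooth_at L ?PA F Z"
    proof (rule smooth_atI[OF SL chart[OF c(1)] _ cP[OF c(1)] open_UNIV, where g = "\<lambda>x. x"])
      show "smooth_on UNIV (\<lambda>x :: 'e \<times> real. x)" by (rule smooth_on_bounded_linear) auto
      fix Z' assume "Z' \<in> fst (U c, \<phi> c)"
      then obtain q w where q: "Z' = R `` {(q, w)}" "q \<in> fst c" "w \<in> tangent_space A q" unfolding U_def by auto
      then have "q \<in> carrier_of A" using c by (auto simp: carrier_of_def)
      with F[OF this q(3)] phi[OF this q(3)] q
      show "F Z' \<in> fst (fst c \<times> UNIV, map_prod (snd c) (\<lambda>x. x))"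
        "snd (fst c \<times> UNIV, map_prod (snd c) (\<lambda>x. x)) (F Z') = snd (U c, \<phi> c) Z'" by simp_all
    qed (use ZU in auto)
  qed
  moreover have "smooth_map_on ?PA L (carrier_of ?PA) (inv_into (carrier_of L) F)"
    unfolding smooth_map_on_iff[OF SP]
  proof (intro conjI ballI openin_carrier[OF SP])
    fix y assume "y \<in> carrier_of ?PA"
    then obtain c where c: "c \<in> A" "fst y \<in> fst c" unfolding carrier_product by (auto simp: carrier_of_def)
    show "smooth_at ?PA L (inv_into (carrier_of L) F) y"
    proof (rule smooth_atI[OF SP cP[OF c(1)] _ chart[OF c(1)] open_UNIV, where g = "\<lambda>x. x"])
      show "smooth_on UNIV (\<lambda>x :: 'e \<times> real. x)" by (rule smooth_on_bounded_linear) auto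
      fix z assume "z \<in> fst (fst c \<times> (UNIV :: real set), map_prod (snd c) (\<lambda>x::real. x))"
      then have zc: "fst z \<in> fst c" by auto
      then have za: "fst z \<in> carrier_of A" using c by (auto simp: carrier_of_def)
      obtain v where v: "v \<in> tangent_space A (fst z)" "\<alpha> (fst z) v = snd z" using surj[OF za] by blast
      have "R `` {(fst z, v)} \<in> carrier_of L" unfolding carrierL using za v by blast
      moreover have Fz: "F (R `` {(fst z, v)}) = z" using F[OF za v(1)] v by simp
      ultimately have i: "inv_into (carrier_of L) F z = R `` {(fst z, v)}"
        using bij by (metis bij_betw_def inv_into_f_f)
      show "inv_into (carrier_of L) F z \<in> fst (U c, \<phi> c)" unfolding i using U_iff[OF c(1) za v(1)] zc by simp
      show "snd (U c, \<phi> c) (inv_into (carrier_of L) F z) = snd (fst c \<times> UNIV, map_prod (snd c) (\<lambda>x. x)) z"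
        unfolding i using phi[OF za v(1)] v by (simp add: map_prod_def split_beta)
    qed (use c in \<open>auto simp: mem_Times_iff\<close>)
  qed
  ultimately have "diffeomorphism L ?PA F" using bij by (simp add: diffeomorphism_def)
  moreover have "fst (F (R `` {(p, v)})) = p" if "p \<in> carrier_of A" "v \<in> tangent_space A p" for p v
    using F[OF that] by simp
  moreover have "tangent_linear A p (\<lambda>v. snd (F (R `` {(p, v)})))" if p: "p \<in> carrier_of A" for p
    using lin[OF p] F[OF p] tangent_space_lincomb[OF A] by (simp add: tangent_linear_def)
  ultimately show ?thesis
    unfolding coorientable_def L_def R_def by blast
qed

section \<open>The symplectization\<close>

lemma local_defining_form_smooth_at:
  assumes A: "smooth_atlas A" and \<alpha>: "local_defining_form A \<xi> W \<alpha>" and c: "c \<in> A" "p \<in> fst c" "p \<in> W"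
  shows "smooth_at A \<E> (\<lambda>q. \<alpha> q (coord_vec A c q e)) p"
proof -
  let ?N = "snd c ` (W \<inter> fst c)"
  have "openin (manifold_topology A) W" using \<alpha> by (simp add: local_defining_form_def)
  then have "open ?N" using c openin_atlas[OF A] by blast
  then show ?thesis
  proof (rule smooth_atI[OF A c(1,2) euclidean_chart])
    show "smooth_on ?N (\<lambda>x. \<alpha> (chart_inv c x) (coord_vec A c (chart_inv c x) e))"
      using \<alpha> c by (simp add: local_defining_form_def smooth_form1_on_def)
  qed (use c A in auto)
qed

lemma scale_covec_apply: "scale_covec r x = (fst x, \<lambda>v. r * snd x v)"
  by (simp add: scale_covec_def split_beta)

lemma fst_scale_covec [simp]: "fst (scale_covec r x) = fst x" by (simp add: scale_covec_apply)

lemma scale_covec_one [simp]: "scale_covec 1 x = x" by (simp add: scale_covec_apply)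

lemma scale_covec_scale_covec [simp]: "scale_covec r (scale_covec s x) = scale_covec (r * s) x"
  by (simp add: scale_covec_apply mult.assoc)

lemma cotangent_space_scale: "\<beta> \<in> cotangent_space A p \<Longrightarrow> (\<lambda>v. r * \<beta> v) \<in> cotangent_space A p"
  by (simp add: cotangent_space_def tangent_linear_def algebra_simps)

lemma symplectization_set_scale:
  assumes "x \<in> symplectization_set Q \<xi>" "r \<noteq> 0"
  shows "scale_covec r x \<in> symplectization_set Q \<xi>"
  using assms cotangent_space_scale
  by (auto simp: symplectization_set_def scale_covec_def fun_eq_iff)

text \<open>Let \<open>e\<close> be a vector transverse to \<open>\<xi>\<close> near \<open>p\<^sub>0\<close>, with constant coordinates in \<open>c\<close>.  Covectors that
  vanish on \<open>\<xi>\<close> are determined by their value at \<open>e\<close>, so \<open>(p, \<beta>) \<mapsto> (c(p), \<beta>(e))\<close> is a chart.  It is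
  defined over a full neighbourhood of \<open>p\<^sub>0\<close>, on covectors of both signs, and the scaling acts linearly
  on its last coordinate.\<close>

lemma symplectization_chart:
  fixes Q :: "('a, 'e::euclidean_space) atlas"
  assumes Q: "smooth_atlas Q" and h: "hyperplane_distribution Q \<xi>" and p0: "p0 \<in> carrier_of Q"
  obtains k c N where "k \<in> symplectization Q \<xi>" "c \<in> Q" "openin (manifold_topology Q) N" "p0 \<in> N" "N \<subseteq> fst c"
    "fst k = {x \<in> symplectization_set Q \<xi>. fst x \<in> N}"
    "snd k ` fst k = snd c ` N \<times> (- {0})"
    "\<And>x. x \<in> fst k \<Longrightarrow> fst (snd k x) = snd c (fst x)"
    "\<And>x. x \<in> fst k \<Longrightarrow> snd (snd k x) \<noteq> 0"
    "\<And>x r. x \<in> fst k \<Longrightarrow> r > 0 \<Longrightarrow> scale_covec r x \<in> fst k"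
    "\<And>x r. x \<in> fst k \<Longrightarrow> r > 0 \<Longrightarrow> snd k (scale_covec r x) = (fst (snd k x), r * snd (snd k x))"
proof -
  note SE = smooth_atlas_euclidean and SC = smooth_atlas_cotangent[OF Q]
  let ?C = "cotangent_atlas Q" and ?S = "symplectization_set Q \<xi>"
  obtain W \<alpha> where W: "p0 \<in> W" and \<alpha>: "local_defining_form Q \<xi> W \<alpha>"
    using h p0 unfolding hyperplane_distribution_def by blast
  have oW: "openin (manifold_topology Q) W" and lin: "\<And>p. p \<in> W \<Longrightarrow> tangent_linear Q p (\<alpha> p)"
    and ker: "\<And>p. p \<in> W \<Longrightarrow> \<xi> p = {v \<in> tangent_space Q p. \<alpha> p v = 0}"
    using \<alpha> unfolding local_defining_form_def smooth_form1_on_def by blast+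
  obtain v0 where v0: "v0 \<in> tangent_space Q p0" "\<alpha> p0 v0 \<noteq> 0"
    using \<alpha> W unfolding local_defining_form_def by blast
  obtain c where c: "c \<in> Q" "p0 \<in> fst c" using p0 carrierE[OF Q] by blast
  define e where "e = v0 c"
  define a where "a = (\<lambda>b p. \<alpha> p (coord_vec Q c p b))"
  have a_smooth: "smooth_at Q \<E> (a b) p" if "p \<in> W" "p \<in> fst c" for b p
    unfolding a_def by (rule local_defining_form_smooth_at[OF Q \<alpha> c(1) that(2,1)])
  have "coord_vec Q c p0 e = v0" unfolding e_def using tangent_vec_eq_coord_vec[OF Q c v0(1)] by simp
  then have a0: "a e p0 \<noteq> 0" using v0 by (simp add: a_def)
  obtain V where V: "openin (manifold_topology Q) V" "p0 \<in> V" "a e ` V \<subseteq> {t. t \<noteq> 0}"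
  proof -
    have "openin (manifold_topology \<E>) {t::real. t \<noteq> 0}"
      by (simp add: openin_euclidean open_Collect_neq)
    then show thesis
      using smooth_at_continuous[OF Q SE a_smooth[OF W c(2)], of "{t. t \<noteq> 0}" e] a0 that by blast
  qed
  define N where "N = V \<inter> W \<inter> fst c"
  have oN: "openin (manifold_topology Q) N"
    unfolding N_def using V oW openin_chart_domain[OF Q c(1)] by blast
  have pN: "p0 \<in> N" unfolding N_def using V W c by blast
  have Nc: "p \<in> fst c" and NW: "p \<in> W" and Nne: "a e p \<noteq> 0" and NQ: "p \<in> carrier_of Q" if "p \<in> N" for p
    using that V c unfolding N_def by (auto simp: carrier_of_def)
  have cN: "open (snd c ` N)"
  proof -
    have "N \<inter> fst c = N" using Nc by blast
    then show ?thesis using oN c openin_atlas[OF Q] by metis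
  qed
  define D where "D = {x \<in> ?S. fst x \<in> N}"
  define \<psi> where "\<psi> = (\<lambda>x::('a, 'e) spt. (snd c (fst x), snd x (coord_vec Q c (fst x) e)))"
  define \<gamma> where "\<gamma> = (\<lambda>(y, t). let p = chart_inv c y in
      (p, \<lambda>v. if v \<in> tangent_space Q p then t / a e p * \<alpha> p v else 0))"
  \<comment> \<open>A covector vanishing on \<open>ker \<alpha>\<close> is determined by its value on a vector not in \<open>ker \<alpha>\<close>.\<close>
  have determined: "\<beta> v = \<beta> (coord_vec Q c p e) / a e p * \<alpha> p v"
    if x: "(p, \<beta>) \<in> D" and v: "v \<in> tangent_space Q p" for p \<beta> v
  proof -
    have p: "p \<in> N" and \<beta>: "tangent_linear Q p \<beta>" "\<forall>v\<in>\<xi> p. \<beta> v = 0"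
      using x by (auto simp: D_def symplectization_set_def cotangent_space_def)
    have ce: "coord_vec Q c p e \<in> tangent_space Q p" by (rule coord_vec_in_tangent_space[OF Q c(1) Nc[OF p]])
    let ?t = "\<alpha> p v / a e p"
    let ?w = "\<lambda>d. 1 *\<^sub>R v d + (- ?t) *\<^sub>R coord_vec Q c p e d"
    have w: "?w \<in> tangent_space Q p" by (rule tangent_space_lincomb[OF Q v ce])
    have "\<alpha> p ?w = 1 * \<alpha> p v + (- ?t) * \<alpha> p (coord_vec Q c p e)"
      using lin[OF NW[OF p]] v ce unfolding tangent_linear_def by blast
    also have "\<dots> = 0" using Nne[OF p] by (simp add: a_def)
    finally have "?w \<in> \<xi> p" using w ker[OF NW[OF p]] by simp
    then have "\<beta> ?w = 0" using \<beta> by blast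
    moreover have "\<beta> ?w = 1 * \<beta> v + (- ?t) * \<beta> (coord_vec Q c p e)"
      using \<beta>(1) v ce unfolding tangent_linear_def by blast
    ultimately show ?thesis by (simp add: field_simps)
  qed
  have \<psi>ne: "snd (\<psi> x) \<noteq> 0" if "x \<in> D" for x
  proof
    assume "snd (\<psi> x) = 0"
    then have "snd x v = 0" if "v \<in> tangent_space Q (fst x)" for v
      using determined[of "fst x" "snd x" v] \<open>x \<in> D\<close> that by (simp add: \<psi>_def)
    moreover have "snd x v = 0" if "v \<notin> tangent_space Q (fst x)" for v
      using \<open>x \<in> D\<close> that by (auto simp: D_def symplectization_set_def cotangent_space_def)
    ultimately have "snd x = (\<lambda>_. 0)" by blast
    then show False using \<open>x \<in> D\<close> by (auto simp: D_def symplectization_set_def)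
  qed
  have \<gamma>\<psi>: "\<gamma> (\<psi> x) = x" if "x \<in> D" for x
  proof -
    obtain p \<beta> where x: "x = (p, \<beta>)" by (cases x)
    have p: "p \<in> N" using that x by (simp add: D_def)
    have "(if v \<in> tangent_space Q p then \<beta> (coord_vec Q c p e) / a e p * \<alpha> p v else 0) = \<beta> v" for v
    proof (cases "v \<in> tangent_space Q p")
      case True
      then show ?thesis using determined[of p \<beta> v] that x by simp
    next
      case False
      then show ?thesis using that x by (auto simp: D_def symplectization_set_def cotangent_space_def)
    qed
    then show ?thesis using x Q c Nc[OF p] by (simp add: \<gamma>_def \<psi>_def)
  qed
  have \<gamma>D: "\<gamma> (snd c p, t) \<in> D" and \<psi>\<gamma>: "\<psi> (\<gamma> (snd c p, t)) = (snd c p, t)" if p: "p \<in> N" and t: "t \<noteq> 0" for p t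
  proof -
    let ?\<beta> = "\<lambda>v. if v \<in> tangent_space Q p then t / a e p * \<alpha> p v else 0"
    have g: "\<gamma> (snd c p, t) = (p, ?\<beta>)" using Q c Nc[OF p] by (simp add: \<gamma>_def)
    have ce: "coord_vec Q c p e \<in> tangent_space Q p" by (rule coord_vec_in_tangent_space[OF Q c(1) Nc[OF p]])
    have be: "?\<beta> (coord_vec Q c p e) = t" using ce Nne[OF p] by (simp add: a_def)
    then have "?\<beta> \<noteq> (\<lambda>_. 0)" using t by metis
    moreover have "?\<beta> \<in> cotangent_space Q p"
      using lin[OF NW[OF p]] tangent_space_lincomb[OF Q]
      by (simp add: cotangent_space_def tangent_linear_def distrib_left mult.left_commute)
    moreover have "\<forall>v\<in>\<xi> p. ?\<beta> v = 0" using ker[OF NW[OF p]] by simp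
    ultimately show "\<gamma> (snd c p, t) \<in> D" unfolding g using NQ[OF p] p by (simp add: D_def symplectization_set_def)
    show "\<psi> (\<gamma> (snd c p, t)) = (snd c p, t)" unfolding g using be by (simp add: \<psi>_def)
  qed
  have im: "\<psi> ` D = snd c ` N \<times> (- {0})"
  proof (intro equalityI subsetI)
    fix y assume "y \<in> \<psi> ` D"
    then obtain x where "x \<in> D" "y = \<psi> x" by blast
    then show "y \<in> snd c ` N \<times> (- {0})" using \<psi>ne[of x] by (auto simp: \<psi>_def D_def)
  next
    fix y :: "'e \<times> real" assume "y \<in> snd c ` N \<times> (- {0})"
    then obtain p t where "p \<in> N" "t \<noteq> 0" "y = (snd c p, t)" by auto
    then show "y \<in> \<psi> ` D" using \<gamma>D \<psi>\<gamma> by (metis image_eqI)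
  qed
  have inj: "inj_on \<psi> D" by (rule inj_on_inverseI[of D \<gamma>]) (rule \<gamma>\<psi>)
  have op: "open (\<psi> ` D)" unfolding im using cN by (intro open_Times) auto
  have inv: "inv_into D \<psi> y = \<gamma> y" if "y \<in> \<psi> ` D" for y
    using that inj \<gamma>\<psi> by auto
  have oT: "openin (manifold_topology ?C) {x \<in> fst (cotangent_chart Q c). fst x \<in> N}"
  proof -
    have "{x \<in> fst (cotangent_chart Q c). fst x \<in> N} =
        {x \<in> fst (cotangent_chart Q c). snd (cotangent_chart Q c) x \<in> snd c ` N \<times> UNIV}"
      using inj_chart[OF Q c(1)] Nc by (auto dest: inj_onD)
    then show ?thesis
      using openin_chart_preimage[OF SC cotangent_chart_in[OF c(1)], of "snd c ` N \<times> UNIV"] cN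
      by (simp add: open_Times)
  qed
  have chart: "(D, \<psi>) \<in> symplectization Q \<xi>"
    unfolding symplectization_def submanifold_atlas_iff[OF SC]
  proof (intro conjI inj op ballI)
    have "D = {x \<in> fst (cotangent_chart Q c). fst x \<in> N} \<inter> ?S"
      using Nc by (auto simp: D_def symplectization_set_def)
    then show "openin (subtopology (manifold_topology ?C) ?S) D"
      using oT openin_subtopology by blast
  next
    fix y assume y: "y \<in> \<psi> ` D"
    let ?g = "\<lambda>z::'e \<times> real. (fst z, \<Sum>b\<in>Basis. (snd z / a e (chart_inv c (fst z)) * a b (chart_inv c (fst z))) *\<^sub>R b)"
    show "smooth_at \<E> ?C (inv_into D \<psi>) y"
    proof (rule smooth_at_from_euclidean[OF cotangent_chart_in[OF c(1)] op y, where g = ?g])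
      fix z assume z: "z \<in> \<psi> ` D"
      then obtain p t where p: "p \<in> N" "t \<noteq> 0" "z = (snd c p, t)" unfolding im by auto
      have "\<gamma> z \<in> D" using \<gamma>D p by simp
      then show "inv_into D \<psi> z \<in> fst (cotangent_chart Q c)"
        unfolding inv[OF z] using Nc by (auto simp: D_def symplectization_set_def)
      have g: "\<gamma> z = (p, \<lambda>v. if v \<in> tangent_space Q p then t / a e p * \<alpha> p v else 0)"
        using p Q c Nc[OF p(1)] by (simp add: \<gamma>_def)
      show "snd (cotangent_chart Q c) (inv_into D \<psi> z) = ?g z"
        unfolding inv[OF z] g using p Q c Nc[OF p(1)]
        by (simp add: coord_vec_in_tangent_space[OF Q c(1) Nc[OF p(1)]] a_def)
    next
      show "smooth_on (\<psi> ` D) ?g"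
      proof (rule smooth_on_if_smooth_at)
        fix z assume z: "z \<in> \<psi> ` D"
        then obtain p t where p: "p \<in> N" "t \<noteq> 0" "z = (snd c p, t)" unfolding im by auto
        note f = smooth_at_euclidean_fst smooth_at_euclidean_snd
        have i: "smooth_at \<E> Q (\<lambda>z::'e \<times> real. chart_inv c (fst z)) z"
          by (rule smooth_at_compose[OF SE SE Q f(1) smooth_at_chart_inv[OF Q c(1)]]) (use p Nc in auto)
        have ip: "chart_inv c (fst z) = p" using p Q c Nc[OF p(1)] by simp
        have ab: "smooth_at \<E> \<E> (\<lambda>z::'e \<times> real. a b (chart_inv c (fst z))) z" for b
          by (rule smooth_at_compose[OF SE Q SE i]) (use a_smooth ip NW Nc p in simp)
        show "smooth_at \<E> \<E> ?g z"
          by (intro smooth_at_Pair[OF SE f(1)] smooth_at_sum[OF SE] smooth_at_linear[OF SE bounded_linear_scaleR_left]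
              smooth_at_mult[OF SE] smooth_at_divide[OF SE f(2)] ab) (use ip Nne p in simp_all)
      qed
    qed
  next
    fix x assume x: "x \<in> D"
    let ?V = "{x \<in> fst (cotangent_chart Q c). fst x \<in> N}"
    let ?\<Psi> = "\<lambda>x. (fst (snd (cotangent_chart Q c) x), snd (snd (cotangent_chart Q c) x) \<bullet> e)"
    have "smooth_at ?C \<E> ?\<Psi> q" if "q \<in> ?V" for q
    proof -
      have ch: "smooth_at ?C \<E> (snd (cotangent_chart Q c)) q"
        by (rule smooth_at_chart[OF SC cotangent_chart_in[OF c(1)]]) (use that in blast)
      show ?thesis
        by (intro smooth_at_Pair[OF SC] smooth_at_linear[OF SC bounded_linear_fst ch]
            smooth_at_linear[OF SC bounded_linear_inner_left smooth_at_linear[OF SC bounded_linear_snd ch]])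
    qed
    moreover have "?\<Psi> q = \<psi> q" if qV: "q \<in> ?V" for q
    proof -
      obtain p \<beta> where q: "q = (p, \<beta>)" "p \<in> fst c" "\<beta> \<in> cotangent_space Q p" using qV by auto
      have "\<beta> (coord_vec Q c p e) = (\<Sum>b\<in>Basis. \<beta> (coord_vec Q c p b) *\<^sub>R b) \<bullet> coord_vec Q c p e c"
        by (rule covector_change_chart[OF Q c(1) q(2,3) coord_vec_in_tangent_space[OF Q c(1) q(2)]])
      then show ?thesis using q coord_vec_self[OF Q c(1) q(2)] by (simp add: \<psi>_def)
    qed
    moreover have "x \<in> ?V" using x Nc by (auto simp: D_def symplectization_set_def)
    ultimately show "\<exists>V \<Psi>. openin (manifold_topology ?C) V \<and> x \<in> V \<and>
        (\<forall>q\<in>V. smooth_at ?C \<E> \<Psi> q) \<and> (\<forall>q\<in>V \<inter> D. \<Psi> q = \<psi> q)"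
      using oT by (intro exI[of _ ?V] exI[of _ ?\<Psi>]) blast
  qed
  show thesis
    by (rule that[OF chart c(1) oN pN])
      (use Nc im \<psi>ne symplectization_set_scale[of _ Q \<xi>] in \<open>auto simp: D_def \<psi>_def scale_covec_apply\<close>)
qed

context
  fixes Q :: "('a, 'e::euclidean_space) atlas" and \<xi>
  assumes Q: "smooth_atlas Q" and h: "hyperplane_distribution Q \<xi>"
begin

lemma smooth_atlas_symplectization: "smooth_atlas (symplectization Q \<xi>)"
  by (rule smooth_atlas_submanifold[OF smooth_atlas_cotangent[OF Q] symplectization_def])

lemma carrier_symplectization: "carrier_of (symplectization Q \<xi>) = symplectization_set Q \<xi>"
proof
  show "carrier_of (symplectization Q \<xi>) \<subseteq> symplectization_set Q \<xi>"
    by (rule carrier_submanifold_subset[OF smooth_atlas_cotangent[OF Q] symplectization_def])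
  show "symplectization_set Q \<xi> \<subseteq> carrier_of (symplectization Q \<xi>)"
  proof
    fix x assume x: "x \<in> symplectization_set Q \<xi>"
    then have p: "fst x \<in> carrier_of Q" by (auto simp: symplectization_set_def)
    obtain k c N where k: "k \<in> symplectization Q \<xi>" "fst x \<in> N" "fst k = {x \<in> symplectization_set Q \<xi>. fst x \<in> N}"
      by (rule symplectization_chart[OF Q h p]) blast
    then show "x \<in> carrier_of (symplectization Q \<xi>)" using x by (auto simp: carrier_of_def)
  qed
qed

lemma smooth_at_symplectization_inclusion:
  "x \<in> symplectization_set Q \<xi> \<Longrightarrow> smooth_at (symplectization Q \<xi>) (cotangent_atlas Q) (\<lambda>x. x) x"
  by (rule smooth_at_inclusion[OF smooth_atlas_cotangent[OF Q] symplectization_def])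
    (simp add: carrier_symplectization)

lemma symplectization_in_cotangent:
  "x \<in> symplectization_set Q \<xi> \<Longrightarrow> x \<in> carrier_of (cotangent_atlas Q)"
  by (auto simp: carrier_cotangent symplectization_set_def)

lemma smooth_at_symplectization_fst:
  assumes "x \<in> symplectization_set Q \<xi>"
  shows "smooth_at (symplectization Q \<xi>) Q fst x"
  by (rule smooth_at_compose[OF smooth_atlas_symplectization smooth_atlas_cotangent[OF Q] Q
        smooth_at_symplectization_inclusion[OF assms] smooth_at_cotangent_fst[OF Q symplectization_in_cotangent[OF assms]]])

lemma symplectization_form_eq:
  assumes x: "x \<in> symplectization_set Q \<xi>" and u: "u \<in> tangent_space (symplectization Q \<xi>) x"
  shows "symplectization_form Q \<xi> x u = snd x (tangent_map (symplectization Q \<xi>) Q fst x u)"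
  using tangent_map_compose[OF smooth_atlas_symplectization smooth_atlas_cotangent[OF Q] Q
      smooth_at_symplectization_inclusion[OF x] smooth_at_cotangent_fst[OF Q symplectization_in_cotangent[OF x]] u]
  by (simp add: symplectization_form_def pullback_form1_def liouville_form_def)

end

text \<open>In the charts of the cotangent bundle the scaling acts linearly on the fibre coordinates.\<close>

lemma smooth_at_scale_covec:
  assumes B: "smooth_atlas B" and Q: "smooth_atlas Q"
    and F: "smooth_at B (cotangent_atlas Q) F p" and g: "smooth_at B \<E> g p"
  shows "smooth_at B (cotangent_atlas Q) (\<lambda>x. scale_covec (g x) (F x)) p"
proof -
  note SC = smooth_atlas_cotangent[OF Q]
  have "F p \<in> carrier_of (cotangent_atlas Q)" using smooth_at_carrier[OF F] by blast
  then obtain c where c: "c \<in> Q" "F p \<in> fst (cotangent_chart Q c)"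
    unfolding carrier_cotangent by (auto elim!: carrierE[OF Q])
  obtain V where V: "openin (manifold_topology B) V" "p \<in> V" "F ` V \<subseteq> fst (cotangent_chart Q c)"
    using smooth_at_continuous[OF B SC F openin_chart_domain[OF SC cotangent_chart_in[OF c(1)]] c(2)] by blast
  show ?thesis
  proof (rule smooth_at_into_chart[OF B SC cotangent_chart_in[OF c(1)] V(1,2)])
    show "(\<lambda>x. scale_covec (g x) (F x)) ` V \<subseteq> fst (cotangent_chart Q c)"
      using V(3) by (auto simp: scale_covec_apply cotangent_space_scale)
    have ch: "smooth_at B \<E> (\<lambda>x. snd (cotangent_chart Q c) (F x)) p"
      by (rule smooth_at_compose[OF B SC smooth_atlas_euclidean F smooth_at_chart[OF SC cotangent_chart_in[OF c(1)] c(2)]])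
    have "smooth_at B \<E> (\<lambda>x. (fst (snd (cotangent_chart Q c) (F x)), g x *\<^sub>R snd (snd (cotangent_chart Q c) (F x)))) p"
      by (intro smooth_at_Pair[OF B] smooth_at_scaleR[OF B g] smooth_at_linear[OF B bounded_linear_fst ch]
          smooth_at_linear[OF B bounded_linear_snd ch])
    then show "smooth_at B \<E> (\<lambda>x. snd (cotangent_chart Q c) (scale_covec (g x) (F x))) p"
      by (simp add: scale_covec_apply split_beta scaleR_sum_right)
  qed
qed

section \<open>The contact product\<close>

context
  fixes Q1 :: "('a, 'e::euclidean_space) atlas" and \<xi>1 and Q2 :: "('b, 'f::euclidean_space) atlas" and \<xi>2
    and S1 S2 P R C
  assumes Q1: "smooth_atlas Q1" and h1: "hyperplane_distribution Q1 \<xi>1"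
    and Q2: "smooth_atlas Q2" and h2: "hyperplane_distribution Q2 \<xi>2"
    and S1: "S1 = symplectization_set Q1 \<xi>1" and S2: "S2 = symplectization_set Q2 \<xi>2"
    and P: "P = symplectization_product Q1 \<xi>1 Q2 \<xi>2"
    and R: "R = ray_rel Q1 \<xi>1 Q2 \<xi>2"
    and C: "C = contact_product Q1 \<xi>1 Q2 \<xi>2"
begin

lemma contact_product_quotient: "C = quotient_atlas P R"
  by (simp add: C P R contact_product_def)

lemma smooth_atlas_P: "smooth_atlas P"
  unfolding P symplectization_product_def
  by (intro smooth_atlas_product smooth_atlas_symplectization Q1 Q2 h1 h2)

lemma carrier_P: "carrier_of P = S1 \<times> S2"
  unfolding P symplectization_product_def carrier_product
  by (simp add: carrier_symplectization[OF Q1 h1] carrier_symplectization[OF Q2 h2] S1 S2)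

lemma smooth_atlas_C: "smooth_atlas C"
  by (rule smooth_atlas_quotient[OF smooth_atlas_P contact_product_quotient])

lemma ray_class: "x \<in> S1 \<Longrightarrow> y \<in> S2 \<Longrightarrow> R `` {(x, y)} = {(scale_covec r x, scale_covec r y) | r. r > 0}"
  unfolding R ray_rel_def S1 S2 by blast

lemma ray_class_self: "w \<in> carrier_of P \<Longrightarrow> w \<in> R `` {w}"
proof -
  assume "w \<in> carrier_of P"
  then obtain x y where w: "w = (x, y)" "x \<in> S1" "y \<in> S2" unfolding carrier_P by blast
  have "(scale_covec 1 x, scale_covec 1 y) \<in> R `` {(x, y)}" unfolding ray_class[OF w(2,3)] using zero_less_one by blast
  then show ?thesis using w by simp
qed

lemma ray_class_eqI:
  assumes "x \<in> S1" "y \<in> S2" "r > 0"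
  shows "R `` {(scale_covec r x, scale_covec r y)} = R `` {(x, y)}"
proof -
  have "scale_covec r x \<in> S1" "scale_covec r y \<in> S2"
    using assms unfolding S1 S2 by (auto intro: symplectization_set_scale)
  then have e: "R `` {(scale_covec r x, scale_covec r y)} = {(scale_covec (t * r) x, scale_covec (t * r) y) | t. t > 0}"
    by (simp add: ray_class)
  have "\<exists>t>0. s = t * r" if "s > 0" for s using that assms by (intro exI[of _ "s / r"]) auto
  moreover have "t * r > 0" if "t > 0" for t using that assms(3) by simp
  ultimately show ?thesis
    unfolding e ray_class[OF assms(1,2)] by blast
qed

text \<open>Let \<open>(y\<^sub>i, t\<^sub>i)\<close> be the coordinates of the two covectors in charts as above.  Scaling fixes \<open>y\<^sub>i\<close>
  and multiplies both \<open>t\<^sub>i\<close> by \<open>r > 0\<close>, so the rays on which \<open>t\<^sub>1\<close> has a given sign have the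
  coordinates \<open>(y\<^sub>1, y\<^sub>2, t\<^sub>2 / \<bar>t\<^sub>1\<bar>)\<close>.  Fixing the value of \<open>t\<^sub>1\<close> gives the sections.\<close>

lemma contact_product_chart:
  assumes w0: "w0 \<in> carrier_of P"
  shows "R `` {w0} \<in> carrier_of C"
proof -
  note SE = smooth_atlas_euclidean and SP = smooth_atlas_P
  note SM1 = smooth_atlas_symplectization[OF Q1 h1] and SM2 = smooth_atlas_symplectization[OF Q2 h2]
  obtain x0 y0 where xy0: "w0 = (x0, y0)" "x0 \<in> S1" "y0 \<in> S2" using w0 unfolding carrier_P by auto
  have pr1: "fst x0 \<in> carrier_of Q1" using xy0 by (auto simp: S1 symplectization_set_def)
  obtain k1 c1 N1 where k1: "k1 \<in> symplectization Q1 \<xi>1" "c1 \<in> Q1" "openin (manifold_topology Q1) N1"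
    "fst x0 \<in> N1" "N1 \<subseteq> fst c1" "fst k1 = {x \<in> S1. fst x \<in> N1}" "snd k1 ` fst k1 = snd c1 ` N1 \<times> (- {0})"
    "\<And>x. x \<in> fst k1 \<Longrightarrow> fst (snd k1 x) = snd c1 (fst x)"
    and ne1: "\<And>x. x \<in> fst k1 \<Longrightarrow> snd (snd k1 x) \<noteq> 0"
    and sc1: "\<And>x r. x \<in> fst k1 \<Longrightarrow> r > 0 \<Longrightarrow> scale_covec r x \<in> fst k1"
    "\<And>x r. x \<in> fst k1 \<Longrightarrow> r > 0 \<Longrightarrow> snd k1 (scale_covec r x) = (fst (snd k1 x), r * snd (snd k1 x))"
    by (rule symplectization_chart[OF Q1 h1 pr1, folded S1]) (rule that)
  have pr2: "fst y0 \<in> carrier_of Q2" using xy0 by (auto simp: S2 symplectization_set_def)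
  obtain k2 c2 N2 where k2: "k2 \<in> symplectization Q2 \<xi>2" "c2 \<in> Q2" "openin (manifold_topology Q2) N2"
    "fst y0 \<in> N2" "N2 \<subseteq> fst c2" "fst k2 = {x \<in> S2. fst x \<in> N2}" "snd k2 ` fst k2 = snd c2 ` N2 \<times> (- {0})"
    "\<And>x. x \<in> fst k2 \<Longrightarrow> fst (snd k2 x) = snd c2 (fst x)"
    and ne2: "\<And>x. x \<in> fst k2 \<Longrightarrow> snd (snd k2 x) \<noteq> 0"
    and sc2: "\<And>x r. x \<in> fst k2 \<Longrightarrow> r > 0 \<Longrightarrow> scale_covec r x \<in> fst k2"
    "\<And>x r. x \<in> fst k2 \<Longrightarrow> r > 0 \<Longrightarrow> snd k2 (scale_covec r x) = (fst (snd k2 x), r * snd (snd k2 x))"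
    by (rule symplectization_chart[OF Q2 h2 pr2, folded S2]) (rule that)
  have o1: "open (snd c1 ` N1)" "open (snd c2 ` N2)"
    using k1 k2 openin_atlas[OF Q1] openin_atlas[OF Q2] by (metis Int_absorb2)+
  have x0k: "x0 \<in> fst k1" "y0 \<in> fst k2" using xy0 k1 k2 by auto
  define s0 where "s0 = snd (snd k1 x0)"
  have s0: "s0 \<noteq> 0" using ne1 x0k by (simp add: s0_def)
  \<comment> \<open>The chart \<open>k1\<close> contains covectors of both signs; \<open>s0\<close> selects the sign
    of \<open>x0\<close>.\<close>
  define D where "D = {(x, y). x \<in> fst k1 \<and> y \<in> fst k2 \<and> snd (snd k1 x) * s0 > 0}"
  define f where "f = (\<lambda>(x, y). (fst (snd k1 x), fst (snd k2 y), snd (snd k2 y) / \<bar>snd (snd k1 x)\<bar>))"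
  have DP: "D \<subseteq> carrier_of P" unfolding carrier_P D_def by (auto simp: k1(6) k2(6))
  have D_scale: "(scale_covec r x, scale_covec r y) \<in> D" "f (scale_covec r x, scale_covec r y) = f (x, y)"
    if "(x, y) \<in> D" "r > 0" for x y r
    using that sc1[of x r] sc2[of y r] by (auto simp: D_def f_def abs_mult mult.assoc)
  define \<phi> where "\<phi> = (\<lambda>Z. f (SOME w. w \<in> Z))"
  have \<phi>: "\<phi> (R `` {w}) = f w" if "w \<in> D" for w
  proof -
    obtain x y where w: "w = (x, y)" "x \<in> S1" "y \<in> S2" using DP \<open>w \<in> D\<close> unfolding carrier_P by auto
    have "(SOME w'. w' \<in> R `` {w}) \<in> R `` {w}"
      by (rule someI) (use ray_class_self DP that in blast)
    then obtain r where "r > 0" "(SOME w'. w' \<in> R `` {w}) = (scale_covec r x, scale_covec r y)"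
      unfolding w(1) ray_class[OF w(2,3)] by blast
    then show ?thesis using D_scale(2)[of x y r] that w by (simp add: \<phi>_def)
  qed
  define U where "U = (\<lambda>w. R `` {w}) ` D"
  have sat: "w \<in> D" if w: "w \<in> carrier_of P" "R `` {w} \<in> U" for w
  proof -
    obtain w' where w': "w' \<in> D" "R `` {w} = R `` {w'}" using w unfolding U_def by blast
    obtain x y where xy: "w' = (x, y)" "x \<in> S1" "y \<in> S2" using DP w' unfolding carrier_P by auto
    have "w \<in> R `` {(x, y)}" using ray_class_self[OF w(1)] w' xy by simp
    then show ?thesis using D_scale(1)[of x y] w'(1) xy(1) unfolding ray_class[OF xy(2,3)] by blast
  qed
  have P_eq: "D = {w \<in> carrier_of P. R `` {w} \<in> U}" using sat DP unfolding U_def by blast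
  have f_inj: "R `` {w} = R `` {w'}" if w: "w \<in> D" "w' \<in> D" "f w = f w'" for w w'
  proof -
    obtain x y x' y' where xy: "w = (x, y)" "w' = (x', y')" by (cases w, cases w')
    have k: "x \<in> fst k1" "y \<in> fst k2" "x' \<in> fst k1" "y' \<in> fst k2" "snd (snd k1 x) * s0 > 0" "snd (snd k1 x') * s0 > 0"
      using w xy by (auto simp: D_def)
    define r where "r = snd (snd k1 x') / snd (snd k1 x)"
    have r: "r > 0" using k(5,6) unfolding r_def by (auto simp: zero_less_mult_iff zero_less_divide_iff)
    have "\<bar>r\<bar> = \<bar>snd (snd k1 x')\<bar> / \<bar>snd (snd k1 x)\<bar>" unfolding r_def by (rule abs_divide)
    with r have ra: "r = \<bar>snd (snd k1 x')\<bar> / \<bar>snd (snd k1 x)\<bar>" by simp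
    have eq: "fst (snd k1 x) = fst (snd k1 x')" "fst (snd k2 y) = fst (snd k2 y')"
      "snd (snd k2 y) / \<bar>snd (snd k1 x)\<bar> = snd (snd k2 y') / \<bar>snd (snd k1 x')\<bar>"
      using w(3) xy by (auto simp: f_def)
    have "snd k1 (scale_covec r x) = snd k1 x'"
      using sc1(2)[OF k(1) r] eq ne1[OF k(1)] by (simp add: r_def prod_eq_iff)
    then have x': "x' = scale_covec r x" using inj_chart[OF SM1 k1(1)] sc1(1)[OF k(1) r] k by (auto dest: inj_onD)
    have "snd k2 (scale_covec r y) = snd k2 y'"
      using sc2(2)[OF k(2) r] eq ne1[OF k(1)] ne1[OF k(3)] by (simp add: ra prod_eq_iff field_simps)
    then have y': "y' = scale_covec r y" using inj_chart[OF SM2 k2(1)] sc2(1)[OF k(2) r] k by (auto dest: inj_onD)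
    show ?thesis
      unfolding xy x' y' by (rule ray_class_eqI[symmetric]) (use k r k1(6) k2(6) in auto)
  qed
  let ?X = "snd c1 ` N1 \<times> snd c2 ` N2 \<times> (- {0::real})"
  have oX: "open ?X" using o1 by (intro open_Times) auto
  have fX: "f w \<in> ?X" if wD: "w \<in> D" for w
  proof -
    obtain x y where w: "w = (x, y)" "x \<in> fst k1" "y \<in> fst k2" using wD by (auto simp: D_def)
    have "fst (snd k1 x) \<in> snd c1 ` N1" "fst (snd k2 y) \<in> snd c2 ` N2"
      using k1(6,8) k2(6,8) w by auto
    then show ?thesis using w ne1[OF w(2)] ne2[OF w(3)] by (simp add: f_def)
  qed
  define \<sigma> where "\<sigma> = (\<lambda>s z. (chart_inv k1 (fst z, s), chart_inv k2 (fst (snd z), snd (snd z) * \<bar>s\<bar>)))"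
  have \<sigma>: "\<sigma> s z \<in> D" "f (\<sigma> s z) = z" if s: "s * s0 > 0" and z: "z \<in> ?X" for s z
  proof -
    obtain u v t where uvt: "z = (u, v, t)" "u \<in> snd c1 ` N1" "v \<in> snd c2 ` N2" "t \<noteq> 0" using z by auto
    have "s \<noteq> 0" using s by auto
    then have "(u, s) \<in> snd k1 ` fst k1" "(v, t * \<bar>s\<bar>) \<in> snd k2 ` fst k2" using uvt unfolding k1(7) k2(7) by auto
    then have "chart_inv k1 (u, s) \<in> fst k1" "snd k1 (chart_inv k1 (u, s)) = (u, s)"
      "chart_inv k2 (v, t * \<bar>s\<bar>) \<in> fst k2" "snd k2 (chart_inv k2 (v, t * \<bar>s\<bar>)) = (v, t * \<bar>s\<bar>)"
      by (auto intro: inv_into_into f_inv_into_f)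
    then show "\<sigma> s z \<in> D" "f (\<sigma> s z) = z" using s \<open>s \<noteq> 0\<close> by (simp_all add: \<sigma>_def D_def f_def uvt(1))
  qed
  have im: "\<phi> ` U = ?X"
  proof (intro equalityI subsetI)
    fix z assume "z \<in> \<phi> ` U"
    then show "z \<in> ?X" using \<phi> fX unfolding U_def by auto
  next
    fix z assume z: "z \<in> ?X"
    have "s0 * s0 > 0" using s0 by (auto simp: zero_less_mult_iff neq_iff)
    note \<sigma>z = \<sigma>[OF this z]
    have "R `` {\<sigma> s0 z} \<in> U" unfolding U_def using \<sigma>z(1) by (rule imageI)
    moreover have "z = \<phi> (R `` {\<sigma> s0 z})" using \<phi>[OF \<sigma>z(1)] \<sigma>z(2) by simp
    ultimately show "z \<in> \<phi> ` U" by blast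
  qed
  let ?K = "(fst k1 \<times> fst k2, map_prod (snd k1) (snd k2))"
  have K: "?K \<in> P" unfolding P symplectization_product_def by (rule product_atlasI[OF k1(1) k2(1)])
  have oD: "openin (manifold_topology P) D"
  proof -
    have "open {z::('e \<times> real) \<times> ('f \<times> real). 0 < snd (fst z) * s0}"
      by (intro open_Collect_less continuous_intros)
    then have "openin (manifold_topology P) {p \<in> fst ?K. snd ?K p \<in> {z. 0 < snd (fst z) * s0}}"
      by (rule openin_chart_preimage[OF SP K])
    moreover have "{p \<in> fst ?K. snd ?K p \<in> {z. 0 < snd (fst z) * s0}} = D" by (auto simp: D_def)
    ultimately show ?thesis by simp
  qed
  have fs: "smooth_at P \<E> f w" if w: "w \<in> D" for w
  proof (rule smooth_at_cong[OF SP _ oD w])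
    have wK: "w \<in> fst ?K" using w by (auto simp: D_def)
    note ch = smooth_at_chart[OF SP K wK]
    note fs = smooth_at_linear[OF SP bounded_linear_fst] and sn = smooth_at_linear[OF SP bounded_linear_snd]
    show "smooth_at P \<E> (\<lambda>w. (fst (fst (snd ?K w)), fst (snd (snd ?K w)), snd (snd (snd ?K w)) / \<bar>snd (fst (snd ?K w))\<bar>)) w"
      by (intro smooth_at_Pair[OF SP] smooth_at_divide[OF SP] smooth_at_abs[OF SP] fs[OF fs[OF ch]] fs[OF sn[OF ch]]
          sn[OF sn[OF ch]] sn[OF fs[OF ch]]) (use w ne1 in \<open>auto simp: D_def\<close>)
    show "(fst (fst (snd ?K q)), fst (snd (snd ?K q)), snd (snd (snd ?K q)) / \<bar>snd (fst (snd ?K q))\<bar>) = f q" if "q \<in> D" for q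
      by (simp add: f_def split_beta)
  qed
  have "(U, \<phi>) \<in> C"
    unfolding contact_product_quotient quotient_atlas_iff[OF SP P_eq]
  proof (intro conjI oD ballI)
    show "U \<subseteq> carrier_of P // R" using DP unfolding U_def by (auto intro!: quotientI)
    show "inj_on \<phi> U"
    proof (rule inj_onI)
      fix Z Z' assume "Z \<in> U" "Z' \<in> U" and eq: "\<phi> Z = \<phi> Z'"
      then obtain w w' where w: "w \<in> D" "w' \<in> D" "Z = R `` {w}" "Z' = R `` {w'}" unfolding U_def by blast
      then have "f w = f w'" using eq \<phi>[OF w(1)] \<phi>[OF w(2)] by simp
      then show "Z = Z'" unfolding w(3,4) by (rule f_inj[OF w(1,2)])
    qed
    show "open (\<phi> ` U)" unfolding im by (rule oX)
    fix w assume w: "w \<in> D"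
    show "smooth_at P \<E> (\<lambda>p. \<phi> (R `` {p})) w"
      by (rule smooth_at_cong[OF SP fs[OF w] oD w]) (simp add: \<phi>)
    obtain x y where xy: "w = (x, y)" "x \<in> fst k1" "y \<in> fst k2" "snd (snd k1 x) * s0 > 0" using w by (auto simp: D_def)
    let ?s = "snd (snd k1 x)"
    show "\<exists>X \<sigma>. open X \<and> \<phi> (R `` {w}) \<in> X \<and> (\<forall>x\<in>X. smooth_at \<E> P \<sigma> x) \<and>
        \<sigma> (\<phi> (R `` {w})) = w \<and> (\<forall>x\<in>X. \<sigma> x \<in> D \<and> \<phi> (R `` {\<sigma> x}) = x)"
    proof (intro exI[of _ ?X] exI[of _ "\<sigma> ?s"] conjI ballI oX)
      show "\<phi> (R `` {w}) \<in> ?X" using fX[OF w] \<phi>[OF w] by simp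
      have "chart_inv k1 (snd k1 x) = x" "chart_inv k2 (snd k2 y) = y" using SM1 SM2 k1(1) k2(1) xy by simp_all
      then show "\<sigma> ?s (\<phi> (R `` {w})) = w"
        unfolding \<phi>[OF w] using xy ne1[OF xy(2)] by (simp add: \<sigma>_def f_def)
      fix z assume z: "z \<in> ?X"
      show \<sigma>D: "\<sigma> ?s z \<in> D" by (rule \<sigma>(1)[OF xy(4) z])
      show "\<phi> (R `` {\<sigma> ?s z}) = z" unfolding \<phi>[OF \<sigma>D] by (rule \<sigma>(2)[OF xy(4) z])
      have id: "smooth_at \<E> \<E> (\<lambda>z :: 'e \<times> 'f \<times> real. z) z"
        by (rule smooth_at_id[OF SE]) simp
      note fs = smooth_at_linear[OF SE bounded_linear_fst] and sn = smooth_at_linear[OF SE bounded_linear_snd]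
      have "(fst z, ?s) \<in> snd k1 ` fst k1" "(fst (snd z), snd (snd z) * \<bar>?s\<bar>) \<in> snd k2 ` fst k2"
        unfolding k1(7) k2(7) using z ne1[OF xy(2)] by auto
      note ks = smooth_at_chart_inv[OF SM1 k1(1) this(1)] smooth_at_chart_inv[OF SM2 k2(1) this(2)]
      show "smooth_at \<E> P (\<sigma> ?s) z"
        unfolding \<sigma>_def P symplectization_product_def
      proof (rule smooth_at_Pair_product[OF SE SM1 SM2])
        show "smooth_at \<E> (symplectization Q1 \<xi>1) (\<lambda>z :: 'e \<times> 'f \<times> real. chart_inv k1 (fst z, ?s)) z"
          by (rule smooth_at_compose[OF SE SE SM1 smooth_at_Pair[OF SE fs[OF id] smooth_at_const[OF SE SE]] ks(1)]) auto
        show "smooth_at \<E> (symplectization Q2 \<xi>2)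
            (\<lambda>z :: 'e \<times> 'f \<times> real. chart_inv k2 (fst (snd z), snd (snd z) * \<bar>?s\<bar>)) z"
          by (rule smooth_at_compose[OF SE SE SM2 smooth_at_Pair[OF SE fs[OF sn[OF id]]
                  smooth_at_mult[OF SE sn[OF sn[OF id]] smooth_at_const[OF SE SE]]] ks(2)]) auto
      qed
    qed
  qed
  moreover have "w0 \<in> D" using xy0 x0k s0 by (auto simp: D_def s0_def zero_less_mult_iff neq_iff)
  ultimately show ?thesis unfolding U_def by (force simp: carrier_of_def)
qed

lemma carrier_C: "carrier_of C = carrier_of P // R"
proof
  show "carrier_of C \<subseteq> carrier_of P // R"
    by (rule carrier_quotient_subset[OF smooth_atlas_P contact_product_quotient])
  show "carrier_of P // R \<subseteq> carrier_of C" using contact_product_chart by (auto elim!: quotientE)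
qed

end

section \<open>A positive homogeneous function on the symplectization\<close>

text \<open>A flat function of the distance in a chart, extended by zero.  The extension is smooth
  because the closed coordinate ball that contains the support is compact, and hence closed in the
  Hausdorff space.\<close>

lemma smooth_bump:
  fixes A :: "('a, 'e::euclidean_space) atlas"
  assumes A: "smooth_manifold A" and p: "p \<in> N" "p \<in> carrier_of A" and N: "openin (manifold_topology A) N"
  obtains \<phi> :: "'a \<Rightarrow> real" where "\<phi> p > 0" "\<And>x. \<phi> x \<ge> 0"
    "\<And>x. x \<in> carrier_of A \<Longrightarrow> smooth_at A \<E> \<phi> x"
    "\<And>x. x \<in> carrier_of A \<Longrightarrow> x \<in> N \<or> (\<exists>V. openin (manifold_topology A) V \<and> x \<in> V \<and> (\<forall>y\<in>V. \<phi> y = 0))"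
proof -
  note SA = smooth_manifold_atlas[OF A] and SE = smooth_atlas_euclidean
  let ?T = "manifold_topology A"
  obtain c where c: "c \<in> A" "p \<in> fst c" using p(2) carrierE[OF SA] by blast
  have op: "open (snd c ` (N \<inter> fst c))" using N c openin_atlas[OF SA] by blast
  obtain r where r: "r > 0" "cball (snd c p) r \<subseteq> snd c ` (N \<inter> fst c)"
    using open_contains_cball[of "snd c ` (N \<inter> fst c)"] op p c by blast
  define K where "K = chart_inv c ` cball (snd c p) r"
  have Kc: "q \<in> N \<inter> fst c \<and> snd c q \<in> cball (snd c p) r" if qK: "q \<in> K" for q
  proof -
    obtain y where y: "y \<in> cball (snd c p) r" "q = chart_inv c y" using qK unfolding K_def by blast
    then obtain q' where "q' \<in> N \<inter> fst c" "y = snd c q'" using r(2) by blast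
    then show ?thesis using y SA c by simp
  qed
  have K_iff: "q \<in> K" if "q \<in> fst c" "snd c q \<in> cball (snd c p) r" for q
    unfolding K_def using that SA c by (metis chart_inv_apply image_eqI)
  have "compactin (top_of_set (cball (snd c p) r)) (cball (snd c p) r)"
    by (simp add: compactin_subtopology)
  moreover have "continuous_map (top_of_set (cball (snd c p) r)) ?T (chart_inv c)"
    unfolding continuous_map_def
  proof (intro conjI allI impI)
    show "chart_inv c \<in> topspace (top_of_set (cball (snd c p) r)) \<rightarrow> topspace ?T"
      using Kc unfolding topspace_atlas[OF SA] K_def by (auto simp: carrier_of_def intro!: bexI[OF _ c(1)])
    fix U assume U: "openin ?T U"
    then have "open (snd c ` (U \<inter> fst c))" using c openin_atlas[OF SA] by blast
    then have "openin (top_of_set (cball (snd c p) r)) (cball (snd c p) r \<inter> snd c ` (U \<inter> fst c))" by (rule openin_open_Int)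
    moreover have "{y \<in> topspace (top_of_set (cball (snd c p) r)). chart_inv c y \<in> U} = cball (snd c p) r \<inter> snd c ` (U \<inter> fst c)"
    proof (intro equalityI subsetI)
      fix y assume "y \<in> {y \<in> topspace (top_of_set (cball (snd c p) r)). chart_inv c y \<in> U}"
      then have y: "y \<in> cball (snd c p) r" "chart_inv c y \<in> U" by auto
      then obtain q where "q \<in> fst c" "y = snd c q" using r(2) by blast
      then show "y \<in> cball (snd c p) r \<inter> snd c ` (U \<inter> fst c)" using y SA c by simp
    next
      fix y assume "y \<in> cball (snd c p) r \<inter> snd c ` (U \<inter> fst c)"
      then show "y \<in> {y \<in> topspace (top_of_set (cball (snd c p) r)). chart_inv c y \<in> U}" using SA c by auto
    qed
    ultimately show "openin (top_of_set (cball (snd c p) r)) {y \<in> topspace (top_of_set (cball (snd c p) r)). chart_inv c y \<in> U}"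
      by simp
  qed
  ultimately have "compactin ?T K" unfolding K_def by (rule image_compactin)
  moreover have "Hausdorff_space ?T" using A by (simp add: smooth_manifold_def)
  ultimately have "closedin ?T K" by (rule compactin_imp_closedin[rotated])
  then have oK: "openin ?T (carrier_of A - K)" using topspace_atlas[OF SA] unfolding closedin_def by simp
  define \<phi> where "\<phi> = (\<lambda>q. if q \<in> fst c then flat 0 (r\<^sup>2 + - ((snd c q - snd c p) \<bullet> (snd c q - snd c p))) else 0)"
  have \<phi>0: "\<phi> q = 0" if "q \<in> carrier_of A - K" for q
  proof (cases "q \<in> fst c")
    case True
    then have "snd c q \<notin> cball (snd c p) r" using K_iff that by blast
    then have "r < norm (snd c q - snd c p)" by (simp add: dist_norm norm_minus_commute)
    then have "r\<^sup>2 < (snd c q - snd c p) \<bullet> (snd c q - snd c p)"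
      using r(1) by (simp add: power2_norm_eq_inner[symmetric] power_strict_mono)
    then show ?thesis using True by (simp add: \<phi>_def flat_zero_iff)
  qed (simp add: \<phi>_def)
  have "\<phi> p > 0" using c r by (simp add: \<phi>_def flat_pos_iff)
  moreover have "\<phi> x \<ge> 0" for x by (simp add: \<phi>_def flat_nonneg)
  moreover have "smooth_at A \<E> \<phi> x" if x: "x \<in> carrier_of A" for x
  proof (cases "x \<in> K")
    case False
    have "smooth_at A \<E> (\<lambda>_. 0::real) x" by (rule smooth_at_const[OF SA SE x]) simp
    then show ?thesis
      by (rule smooth_at_cong[OF SA _ oK]) (use x False \<phi>0 in auto)
  next
    case True
    then have xc: "x \<in> fst c" using Kc by blast
    note ch = smooth_at_chart[OF SA c(1) xc]
    have k: "smooth_at A \<E> (\<lambda>_. b) x" for b :: 'e by (rule smooth_at_const[OF SA SE x]) simp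
    have k': "smooth_at A \<E> (\<lambda>_. b) x" for b :: real by (rule smooth_at_const[OF SA SE x]) simp
    have d: "smooth_at A \<E> (\<lambda>q. snd c q - snd c p) x"
      using smooth_at_add[OF SA ch k[of "- snd c p"]] by simp
    have "smooth_at A \<E> (\<lambda>q. flat 0 (r\<^sup>2 + - ((snd c q - snd c p) \<bullet> (snd c q - snd c p)))) x"
      by (intro smooth_at_flat[OF SA] smooth_at_add[OF SA k'] smooth_at_uminus[OF SA] smooth_at_inner[OF SA d d])
    then show ?thesis
      by (rule smooth_at_cong[OF SA _ openin_chart_domain[OF SA c(1)] xc]) (simp add: \<phi>_def)
  qed
  moreover have "x \<in> N \<or> (\<exists>V. openin ?T V \<and> x \<in> V \<and> (\<forall>y\<in>V. \<phi> y = 0))" if x: "x \<in> carrier_of A" for x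
  proof (cases "x \<in> K")
    case True
    then show ?thesis using Kc by blast
  next
    case False
    then have "x \<in> carrier_of A - K" using x by blast
    then show ?thesis using oK \<phi>0 by blast
  qed
  ultimately show thesis by (rule that)
qed

lemma smooth_at_neighbourhood_gt:
  fixes f :: "'a \<Rightarrow> real"
  assumes A: "smooth_atlas A" and f: "smooth_at A \<E> f p" "f p > t"
  obtains V where "openin (manifold_topology A) V" "p \<in> V" "\<And>x. x \<in> V \<Longrightarrow> f x > t"
proof -
  have "openin (manifold_topology \<E>) {t<..}" by (simp add: openin_euclidean)
  then obtain V where "openin (manifold_topology A) V" "p \<in> V" "f ` V \<subseteq> {t<..}"
    using smooth_at_continuous[OF A smooth_atlas_euclidean f(1)] f(2) by blast
  then show thesis using that by blast
qed

text \<open>A countable family of bump functions \<open>f\<^sub>n\<close> whose supports are subordinate to \<open>N\<close>, and of which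
  at least one is positive at each point, exists by second countability.  It is made locally finite
  without an exhaustion by compact sets: \<open>f\<^sub>n\<close> is multiplied by a smooth function that vanishes where
  \<open>f\<^sub>j \<ge> 1 / (n + 1)\<close> for some \<open>j < n\<close>.  Near a point where \<open>f\<^sub>k\<close> is positive this makes all members of large
  index vanish, while the first \<open>f\<^sub>k\<close> that is positive at a point keeps its positivity there.\<close>

lemma locally_finite_bump_family:
  fixes A :: "('a, 'e::euclidean_space) atlas"
  assumes A: "smooth_manifold A"
    and N: "\<And>p. p \<in> carrier_of A \<Longrightarrow> p \<in> N p \<and> openin (manifold_topology A) (N p)"
  obtains \<rho> :: "nat \<Rightarrow> 'a \<Rightarrow> real" and q where
    "\<And>n x. \<rho> n x \<ge> 0"
    "\<And>n x. x \<in> carrier_of A \<Longrightarrow> smooth_at A \<E> (\<rho> n) x"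
    "\<And>n x. x \<in> carrier_of A \<Longrightarrow> q n \<in> carrier_of A"
    "\<And>n x. x \<in> carrier_of A \<Longrightarrow> x \<in> N (q n) \<or> (\<exists>V. openin (manifold_topology A) V \<and> x \<in> V \<and> (\<forall>y\<in>V. \<rho> n y = 0))"
    "\<And>x. x \<in> carrier_of A \<Longrightarrow> \<exists>V m. openin (manifold_topology A) V \<and> x \<in> V \<and> (\<forall>y\<in>V. \<forall>n\<ge>m. \<rho> n y = 0)"
    "\<And>x. x \<in> carrier_of A \<Longrightarrow> \<exists>n. \<rho> n x > 0"
proof -
  note SA = smooth_manifold_atlas[OF A] and SE = smooth_atlas_euclidean
  let ?T = "manifold_topology A" and ?M = "carrier_of A"
  have "\<exists>\<phi> :: 'a \<Rightarrow> real. \<phi> p > 0 \<and> (\<forall>x. \<phi> x \<ge> 0) \<and> (\<forall>x\<in>?M. smooth_at A \<E> \<phi> x) \<and>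
      (\<forall>x\<in>?M. x \<in> N p \<or> (\<exists>V. openin ?T V \<and> x \<in> V \<and> (\<forall>y\<in>V. \<phi> y = 0)))" if pM: "p \<in> ?M" for p
  proof -
    obtain \<phi> :: "'a \<Rightarrow> real" where "\<phi> p > 0" "\<And>x. \<phi> x \<ge> 0" "\<And>x. x \<in> ?M \<Longrightarrow> smooth_at A \<E> \<phi> x"
      "\<And>x. x \<in> ?M \<Longrightarrow> x \<in> N p \<or> (\<exists>V. openin ?T V \<and> x \<in> V \<and> (\<forall>y\<in>V. \<phi> y = 0))"
      using smooth_bump[OF A, of p "N p"] N[OF pM] pM by blast
    then show ?thesis by (intro exI[of _ \<phi>]) simp
  qed
  then have "\<forall>p\<in>?M. \<exists>\<phi> :: 'a \<Rightarrow> real. \<phi> p > 0 \<and> (\<forall>x. \<phi> x \<ge> 0) \<and> (\<forall>x\<in>?M. smooth_at A \<E> \<phi> x) \<and>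
      (\<forall>x\<in>?M. x \<in> N p \<or> (\<exists>V. openin ?T V \<and> x \<in> V \<and> (\<forall>y\<in>V. \<phi> y = 0)))" ..
  from bchoice[OF this] obtain \<phi> :: "'a \<Rightarrow> 'a \<Rightarrow> real" where
    bump: "\<forall>p\<in>?M. \<phi> p p > 0 \<and> (\<forall>x. \<phi> p x \<ge> 0) \<and> (\<forall>x\<in>?M. smooth_at A \<E> (\<phi> p) x) \<and>
      (\<forall>x\<in>?M. x \<in> N p \<or> (\<exists>V. openin ?T V \<and> x \<in> V \<and> (\<forall>y\<in>V. \<phi> p y = 0)))" ..
  have \<phi>: "\<And>p. p \<in> ?M \<Longrightarrow> \<phi> p p > 0"
    "\<And>p x. p \<in> ?M \<Longrightarrow> \<phi> p x \<ge> 0" "\<And>p x. p \<in> ?M \<Longrightarrow> x \<in> ?M \<Longrightarrow> smooth_at A \<E> (\<phi> p) x"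
    "\<And>p x. p \<in> ?M \<Longrightarrow> x \<in> ?M \<Longrightarrow> x \<in> N p \<or> (\<exists>V. openin ?T V \<and> x \<in> V \<and> (\<forall>y\<in>V. \<phi> p y = 0))"
    using bump by simp_all
  have "second_countable ?T" using A by (simp add: smooth_manifold_def)
  then obtain \<B> where cB: "countable \<B>" and bB: "\<forall>U x. openin ?T U \<and> x \<in> U \<longrightarrow> (\<exists>B\<in>\<B>. x \<in> B \<and> B \<subseteq> U)"
    unfolding second_countable_def by (elim exE conjE) (rule that)
  have \<B>: "\<exists>B\<in>\<B>. x \<in> B \<and> B \<subseteq> U" if "openin ?T U" "x \<in> U" for U x
    using bB that by simp
  define G where "G = (\<lambda>B p. p \<in> ?M \<and> (\<forall>x\<in>B. \<phi> p x > 0))"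
  define \<C> where "\<C> = {B \<in> \<B>. \<exists>p. G B p}"
  have cC: "countable \<C>" unfolding \<C>_def using cB by simp
  define q where "q = (\<lambda>n. SOME p. G (from_nat_into \<C> n) p)"
  have cover: "\<exists>n. x \<in> from_nat_into \<C> n \<and> from_nat_into \<C> n \<in> \<C>" if x: "x \<in> ?M" for x
  proof -
    obtain V where V: "openin ?T V" "x \<in> V" "\<And>y. y \<in> V \<Longrightarrow> \<phi> x y > 0"
      by (rule smooth_at_neighbourhood_gt[OF SA \<phi>(3)[OF x x] \<phi>(1)[OF x]]) (rule that)
    obtain B where B: "B \<in> \<B>" "x \<in> B" "B \<subseteq> V" using \<B>[OF V(1,2)] by blast
    then have "G B x" using V x by (auto simp: G_def)
    then have "B \<in> \<C>" using B by (auto simp: \<C>_def)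
    then show ?thesis using from_nat_into_surj[OF cC] B by metis
  qed
  have Gq: "G (from_nat_into \<C> n) (q n)" if "x \<in> ?M" for n x
  proof -
    have "\<C> \<noteq> {}" using cover[OF that] by blast
    then have "from_nat_into \<C> n \<in> \<C>" by (rule from_nat_into)
    then show ?thesis unfolding q_def \<C>_def by (auto intro: someI)
  qed
  have qM: "q n \<in> ?M" if "x \<in> ?M" for n x using Gq[OF that, of n] by (simp add: G_def)
  define f where "f = (\<lambda>n x. if x \<in> ?M then \<phi> (q n) x else 0)"
  have f_nonneg: "f n x \<ge> 0" for n x using \<phi>(2) qM by (simp add: f_def)
  have f_smooth: "smooth_at A \<E> (f n) x" if x: "x \<in> ?M" for n x
    by (rule smooth_at_cong[OF SA \<phi>(3)[OF qM[OF x] x] openin_carrier[OF SA] x]) (simp add: f_def)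
  have f_pos: "\<exists>n. f n x > 0" if x: "x \<in> ?M" for x
  proof -
    obtain n where "x \<in> from_nat_into \<C> n" using cover[OF x] by blast
    then have "f n x > 0" using Gq[OF x, of n] x by (simp add: G_def f_def)
    then show ?thesis ..
  qed
  \<comment> \<open>The second factor switches the \<open>n\<close>-th bump off where an earlier one is larger than \<open>1 / (n + 1)\<close>.\<close>
  define \<rho> where "\<rho> = (\<lambda>n x. f n x * (\<Prod>j<n. flat 0 (inverse (real (Suc n)) + - f j x)))"
  show thesis
  proof (rule that[of \<rho> q])
    show "\<rho> n x \<ge> 0" for n x
      unfolding \<rho>_def by (intro mult_nonneg_nonneg f_nonneg prod_nonneg) (simp add: flat_nonneg)
    show "smooth_at A \<E> (\<rho> n) x" if x: "x \<in> ?M" for n x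
      unfolding \<rho>_def
      by (intro smooth_at_mult[OF SA] f_smooth[OF x] smooth_at_prod[OF SA x] smooth_at_flat[OF SA] smooth_at_add[OF SA]
          smooth_at_const[OF SA SE x] smooth_at_uminus[OF SA]) simp
    show "q n \<in> ?M" if "x \<in> ?M" for n x by (rule qM[OF that])
    show "x \<in> N (q n) \<or> (\<exists>V. openin ?T V \<and> x \<in> V \<and> (\<forall>y\<in>V. \<rho> n y = 0))" if x: "x \<in> ?M" for n x
    proof -
      have "\<rho> n y = 0" if "\<phi> (q n) y = 0" for y using that by (simp add: \<rho>_def f_def)
      then show ?thesis using \<phi>(4)[OF qM[OF x] x, of n] by blast
    qed
    show "\<exists>V m. openin ?T V \<and> x \<in> V \<and> (\<forall>y\<in>V. \<forall>n\<ge>m. \<rho> n y = 0)" if x: "x \<in> ?M" for x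
    proof -
      obtain k where k: "f k x > 0" using f_pos[OF x] by blast
      then obtain V where V: "openin ?T V" "x \<in> V" "\<And>y. y \<in> V \<Longrightarrow> f k y > f k x / 2"
        using smooth_at_neighbourhood_gt[OF SA f_smooth[OF x, of k], of "f k x / 2"] by auto
      obtain m0 where m0: "inverse (real (Suc m0)) < f k x / 2" using reals_Archimedean[of "f k x / 2"] k by auto
      have "\<rho> n y = 0" if y: "y \<in> V" and n: "n \<ge> max m0 (Suc k)" for n y
      proof -
        have "inverse (real (Suc n)) \<le> inverse (real (Suc m0))" using n by (intro le_imp_inverse_le) auto
        then have "inverse (real (Suc n)) + - f k y \<le> 0" using V(3)[OF y] m0 by linarith
        then have "flat 0 (inverse (real (Suc n)) + - f k y) = 0" by (simp only: flat_zero_iff)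
        moreover have "k < n" using n by simp
        ultimately have "(\<Prod>j<n. flat 0 (inverse (real (Suc n)) + - f j y)) = 0"
          by (intro prod_zero) auto
        then show ?thesis unfolding \<rho>_def by (simp only: mult_zero_right)
      qed
      then show ?thesis using V by blast
    qed
    show "\<exists>n. \<rho> n x > 0" if x: "x \<in> ?M" for x
    proof -
      define k where "k = (LEAST n. f n x > 0)"
      have k: "f k x > 0" unfolding k_def using f_pos[OF x] by (rule LeastI_ex)
      have "f j x = 0" if "j < k" for j
        using not_less_Least[of j "\<lambda>n. f n x > 0"] that f_nonneg[of j x] unfolding k_def by simp
      then have "\<rho> k x > 0"
        unfolding \<rho>_def using k by (intro mult_pos_pos prod_pos) (auto simp: flat_pos_iff)
      then show ?thesis ..
    qed
  qed
qed

text \<open>The sum of the local functions \<open>\<bar>\<beta>(e)\<bar>\<close>, read off from the charts of the symplectization,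
  with the bump functions as weights.\<close>

lemma positive_homogeneous_function:
  fixes Q :: "('a, 'e::euclidean_space) atlas"
  assumes Q: "smooth_manifold Q" and hd: "hyperplane_distribution Q \<xi>"
  obtains h :: "('a, 'e) spt \<Rightarrow> real" where
    "\<And>x. x \<in> symplectization_set Q \<xi> \<Longrightarrow> h x > 0"
    "\<And>x r. x \<in> symplectization_set Q \<xi> \<Longrightarrow> r > 0 \<Longrightarrow> h (scale_covec r x) = r * h x"
    "\<And>x. x \<in> symplectization_set Q \<xi> \<Longrightarrow> smooth_at (symplectization Q \<xi>) \<E> h x"
proof -
  note SQ = smooth_manifold_atlas[OF Q] and SE = smooth_atlas_euclidean
  note SM = smooth_atlas_symplectization[OF SQ hd]
  let ?T = "manifold_topology Q" and ?S = "symplectization_set Q \<xi>" and ?M = "symplectization Q \<xi>"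
  have "\<exists>k N. k \<in> ?M \<and> openin ?T N \<and> p \<in> N \<and> fst k = {x \<in> ?S. fst x \<in> N} \<and>
      (\<forall>x\<in>fst k. snd (snd k x) \<noteq> 0) \<and> (\<forall>x\<in>fst k. \<forall>r>0. snd (snd k (scale_covec r x)) = r * snd (snd k x))"
    if p: "p \<in> carrier_of Q" for p
  proof -
    obtain k c N where k: "k \<in> ?M" "c \<in> Q" "openin ?T N" "p \<in> N" "N \<subseteq> fst c"
      "fst k = {x \<in> ?S. fst x \<in> N}" "snd k ` fst k = snd c ` N \<times> (- {0})"
      "\<And>x. x \<in> fst k \<Longrightarrow> fst (snd k x) = snd c (fst x)" "\<And>x. x \<in> fst k \<Longrightarrow> snd (snd k x) \<noteq> 0"
      "\<And>x r. x \<in> fst k \<Longrightarrow> r > 0 \<Longrightarrow> scale_covec r x \<in> fst k"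
      "\<And>x r. x \<in> fst k \<Longrightarrow> r > 0 \<Longrightarrow> snd k (scale_covec r x) = (fst (snd k x), r * snd (snd k x))"
      by (rule symplectization_chart[OF SQ hd p]) (rule that)
    have "\<forall>x\<in>fst k. \<forall>r>0. snd (snd k (scale_covec r x)) = r * snd (snd k x)" using k(11) by simp
    then show ?thesis using k(1,3,4,6,9) by blast
  qed
  then have "\<forall>p\<in>carrier_of Q. \<exists>k N. k \<in> ?M \<and> openin ?T N \<and> p \<in> N \<and> fst k = {x \<in> ?S. fst x \<in> N} \<and>
      (\<forall>x\<in>fst k. snd (snd k x) \<noteq> 0) \<and> (\<forall>x\<in>fst k. \<forall>r>0. snd (snd k (scale_covec r x)) = r * snd (snd k x))" ..
  from bchoice[OF this] obtain k where
    "\<forall>p\<in>carrier_of Q. \<exists>N. (k p) \<in> ?M \<and> openin ?T N \<and> p \<in> N \<and> fst (k p) = {x \<in> ?S. fst x \<in> N} \<and>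
      (\<forall>x\<in>fst (k p). snd (snd (k p) x) \<noteq> 0) \<and> (\<forall>x\<in>fst (k p). \<forall>r>0. snd (snd (k p) (scale_covec r x)) = r * snd (snd (k p) x))" ..
  from bchoice[OF this] obtain N where
    kN: "\<forall>p\<in>carrier_of Q. (k p) \<in> ?M \<and> openin ?T (N p) \<and> p \<in> (N p) \<and> fst (k p) = {x \<in> ?S. fst x \<in> N p} \<and>
      (\<forall>x\<in>fst (k p). snd (snd (k p) x) \<noteq> 0) \<and> (\<forall>x\<in>fst (k p). \<forall>r>0. snd (snd (k p) (scale_covec r x)) = r * snd (snd (k p) x))" ..
  have k: "\<And>p. p \<in> carrier_of Q \<Longrightarrow> k p \<in> ?M" "\<And>p. p \<in> carrier_of Q \<Longrightarrow> p \<in> N p \<and> openin ?T (N p)"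
    "\<And>p. p \<in> carrier_of Q \<Longrightarrow> fst (k p) = {x \<in> ?S. fst x \<in> N p}"
    "\<And>p x. p \<in> carrier_of Q \<Longrightarrow> x \<in> fst (k p) \<Longrightarrow> snd (snd (k p) x) \<noteq> 0"
    "\<And>p x r. p \<in> carrier_of Q \<Longrightarrow> x \<in> fst (k p) \<Longrightarrow> r > 0 \<Longrightarrow> snd (snd (k p) (scale_covec r x)) = r * snd (snd (k p) x)"
    using kN by blast+
  obtain \<rho> :: "nat \<Rightarrow> 'a \<Rightarrow> real" and q where \<rho>: "\<And>n x. \<rho> n x \<ge> 0"
    "\<And>n x. x \<in> carrier_of Q \<Longrightarrow> smooth_at Q \<E> (\<rho> n) x"
    and q: "\<And>n x. x \<in> carrier_of Q \<Longrightarrow> q n \<in> carrier_of Q"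
    and supp: "\<And>n x. x \<in> carrier_of Q \<Longrightarrow> x \<in> N (q n) \<or> (\<exists>V. openin ?T V \<and> x \<in> V \<and> (\<forall>y\<in>V. \<rho> n y = 0))"
    and lf: "\<And>x. x \<in> carrier_of Q \<Longrightarrow> \<exists>V m. openin ?T V \<and> x \<in> V \<and> (\<forall>y\<in>V. \<forall>n\<ge>m. \<rho> n y = 0)"
    and pos: "\<And>x. x \<in> carrier_of Q \<Longrightarrow> \<exists>n. \<rho> n x > 0"
    by (rule locally_finite_bump_family[OF Q k(2)]) (assumption, rule that)
  have SQc: "fst x \<in> carrier_of Q" if "x \<in> ?S" for x using that by (auto simp: symplectization_set_def)
  have xk: "x \<in> fst (k (q n))" if "x \<in> ?S" "\<rho> n (fst x) \<noteq> 0" for x n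
    using supp[OF SQc[OF that(1)], of n] that k(3)[OF q[OF SQc[OF that(1)]], of n] by auto
  define t where "t = (\<lambda>n x. \<rho> n (fst x) * \<bar>snd (snd (k (q n)) x)\<bar>)"
  have preimage: "\<exists>V'. openin (manifold_topology ?M) V' \<and> x \<in> V' \<and> fst ` V' \<subseteq> V"
    if x: "x \<in> ?S" and V: "openin ?T V" "fst x \<in> V" for x V
    by (rule smooth_at_continuous[OF SM SQ smooth_at_symplectization_fst[OF SQ hd x] V]) blast
  have t_smooth: "smooth_at ?M \<E> (t n) x" if x: "x \<in> ?S" for n x
    using supp[OF SQc[OF x], of n]
  proof
    assume "fst x \<in> N (q n)"
    then have kx: "x \<in> fst (k (q n))" using k(3)[OF q[OF SQc[OF x]]] x by simp
    show ?thesis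
      unfolding t_def
      by (intro smooth_at_mult[OF SM] smooth_at_abs[OF SM] smooth_at_linear[OF SM bounded_linear_snd]
          smooth_at_compose[OF SM SQ SE smooth_at_symplectization_fst[OF SQ hd x] \<rho>(2)[OF SQc[OF x]]]
          smooth_at_chart[OF SM k(1)[OF q[OF SQc[OF x]]] kx] k(4)[OF q[OF SQc[OF x]] kx])
  next
    assume "\<exists>V. openin ?T V \<and> fst x \<in> V \<and> (\<forall>y\<in>V. \<rho> n y = 0)"
    then obtain V where V: "openin ?T V" "fst x \<in> V" "\<And>y. y \<in> V \<Longrightarrow> \<rho> n y = 0" by blast
    obtain V' where V': "openin (manifold_topology ?M) V'" "x \<in> V'" "fst ` V' \<subseteq> V" using preimage[OF x V(1,2)] by blast
    have "smooth_at ?M \<E> (\<lambda>_. 0::real) x"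
      by (rule smooth_at_const[OF SM SE]) (use x carrier_symplectization[OF SQ hd] in auto)
    then show ?thesis
      by (rule smooth_at_cong[OF SM _ V'(1,2)]) (use V' V(3) in \<open>auto simp: t_def\<close>)
  qed
  define h where "h = (\<lambda>x. \<Sum>n. t n x)"
  have h_fin: "h x = (\<Sum>n<m. t n x)" if "\<forall>n\<ge>m. \<rho> n (fst x) = 0" for x m
    unfolding h_def by (rule suminf_finite) (use that in \<open>auto simp: t_def\<close>)
  show thesis
  proof (rule that[of h])
    fix x assume x: "x \<in> ?S"
    obtain V m where V: "openin ?T V" "fst x \<in> V" "\<forall>y\<in>V. \<forall>n\<ge>m. \<rho> n y = 0" using lf[OF SQc[OF x]] by blast
    then have hx: "h x = (\<Sum>n<m. t n x)" by (intro h_fin) blast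
    have t_nonneg: "t n x \<ge> 0" for n unfolding t_def using \<rho>(1) by simp
    obtain n where n: "\<rho> n (fst x) > 0" using pos[OF SQc[OF x]] by blast
    have nm: "n < m"
    proof (rule ccontr)
      assume "\<not> n < m"
      then have "\<rho> n (fst x) = 0" using V by simp
      then show False using n by simp
    qed
    have "t n x > 0" unfolding t_def using n k(4)[OF q[OF SQc[OF x]] xk[OF x]] by simp
    then show "h x > 0" unfolding hx using nm t_nonneg by (intro sum_pos2[of _ n]) auto
    show "h (scale_covec r x) = r * h x" if r: "r > 0" for r
    proof -
      have "t n (scale_covec r x) = r * t n x" for n
      proof (cases "\<rho> n (fst x) = 0")
        case False
        then show ?thesis
          unfolding t_def using k(5)[OF q[OF SQc[OF x]] xk[OF x False] r] r by (simp add: abs_mult)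
      qed (simp add: t_def)
      moreover have "h (scale_covec r x) = (\<Sum>n<m. t n (scale_covec r x))" using V by (intro h_fin) simp
      ultimately show ?thesis by (simp add: hx sum_distrib_left)
    qed
    obtain V' where V': "openin (manifold_topology ?M) V'" "x \<in> V'" "fst ` V' \<subseteq> V" using preimage[OF x V(1,2)] by blast
    have "smooth_at ?M \<E> (\<lambda>x. \<Sum>n<m. t n x) x"
      by (rule smooth_at_sum[OF SM _ t_smooth[OF x]]) (use x carrier_symplectization[OF SQ hd] in auto)
    then show "smooth_at ?M \<E> h x"
    proof (rule smooth_at_cong[OF SM _ V'(1,2)])
      fix y assume "y \<in> V'"
      then have "fst y \<in> V" using V' by blast
      then show "(\<Sum>n<m. t n y) = h y" using V by (intro h_fin[symmetric]) blast
    qed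
  qed
qed

section \<open>The global contact form\<close>

lemma tangent_linear_pullback:
  assumes A: "smooth_atlas A" and Q: "smooth_atlas Q" and F: "smooth_at A Q F p"
    and \<beta>: "\<beta> \<in> cotangent_space Q (F p)"
  shows "tangent_linear A p (\<lambda>v. \<beta> (tangent_map A Q F p v))"
  using \<beta> tangent_map_lincomb[OF A Q F] tangent_map_in_tangent_space[OF A Q F]
  by (simp add: tangent_linear_def cotangent_space_def)

text \<open>For \<open>\<eta>\<close> the fibre coordinates of the cotangent bundle and \<open>x\<close> those of the base, the Liouville
  form is \<open>\<eta> \<bullet> dx\<close>; its pullback by \<open>G\<close> pairs the fibre coordinates of \<open>G\<close> with the derivative of
  the base coordinates.\<close>

lemma smooth_at_pullback_liouville:
  assumes A: "smooth_atlas A" and Q: "smooth_atlas Q"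
    and G: "\<And>q. q \<in> carrier_of A \<Longrightarrow> smooth_at A (cotangent_atlas Q) G q"
    and c: "c \<in> A" "p \<in> fst c"
  shows "smooth_at A \<E> (\<lambda>q. snd (G q) (tangent_map A Q (\<lambda>q. fst (G q)) q (coord_vec A c q e))) p"
proof -
  note SC = smooth_atlas_cotangent[OF Q] and SE = smooth_atlas_euclidean
  let ?F = "\<lambda>q. fst (G q)"
  have carr: "q \<in> carrier_of A" if "q \<in> fst c" for q using c(1) that by (auto simp: carrier_of_def)
  have F: "smooth_at A Q ?F q" if "q \<in> carrier_of A" for q
    using smooth_at_compose[OF A SC Q G[OF that] smooth_at_cotangent_fst[OF Q]] smooth_at_carrier[OF G[OF that]] by blast
  have "G p \<in> carrier_of (cotangent_atlas Q)" using smooth_at_carrier[OF G[OF carr[OF c(2)]]] by blast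
  then obtain d where d: "d \<in> Q" "G p \<in> fst (cotangent_chart Q d)"
    unfolding carrier_cotangent by (auto elim!: carrierE[OF Q])
  then have Fd: "?F p \<in> fst d" by auto
  let ?D = "cotangent_chart Q d"
  obtain V where V: "openin (manifold_topology A) V" "p \<in> V" "G ` V \<subseteq> fst ?D"
    using smooth_at_continuous[OF A SC G[OF carr[OF c(2)]] openin_chart_domain[OF SC cotangent_chart_in[OF d(1)]] d(2)] by blast
  let ?V = "V \<inter> fst c"
  have oV: "openin (manifold_topology A) ?V" "p \<in> ?V"
    using V(1,2) openin_chart_domain[OF A c(1)] c(2) by (auto intro: openin_Int)
  show ?thesis
  proof (rule smooth_at_cong[OF A _ oV])
    obtain N where N: "open N" "snd c p \<in> N" "smooth_on N (snd d \<circ> ?F \<circ> chart_inv c)"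
      by (rule smooth_atE[OF A Q F[OF carr[OF c(2)]] c d(1) Fd]) (rule that)
    have r: "smooth_at A \<E> (\<lambda>q. rep_deriv c d ?F q e) p"
      by (rule smooth_atI[OF A c euclidean_chart N(1,2) _ _ smooth_on_frechet_derivative[OF N(3)]])
        (simp_all add: rep_deriv_def)
    have ch: "smooth_at A \<E> (\<lambda>q. snd ?D (G q)) p"
      by (rule smooth_at_compose[OF A SC SE G[OF carr[OF c(2)]] smooth_at_chart[OF SC cotangent_chart_in[OF d(1)] d(2)]])
    show "smooth_at A \<E> (\<lambda>q. snd (snd ?D (G q)) \<bullet> rep_deriv c d ?F q e) p"
      by (rule smooth_at_inner[OF A smooth_at_linear[OF A bounded_linear_snd ch] r])
    fix q assume q: "q \<in> ?V"
    then have "G q \<in> fst ?D" using V(3) by blast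
    then obtain \<beta> where \<beta>: "G q = (?F q, \<beta>)" "?F q \<in> fst d" "\<beta> \<in> cotangent_space Q (?F q)"
      by (cases "G q") auto
    have qc: "q \<in> fst c" using q by blast
    let ?w = "rep_deriv c d ?F q e"
    have "tangent_map A Q ?F q (coord_vec A c q e) = coord_vec Q d (?F q) ?w"
      by (rule tangent_map_coord_vec[OF A Q F[OF carr[OF qc]] c(1) qc d(1) \<beta>(2)])
    moreover have "\<beta> (coord_vec Q d (?F q) ?w) =
        (\<Sum>b\<in>Basis. \<beta> (coord_vec Q d (?F q) b) *\<^sub>R b) \<bullet> coord_vec Q d (?F q) ?w d"
      by (rule covector_change_chart[OF Q d(1) \<beta>(2,3) coord_vec_in_tangent_space[OF Q d(1) \<beta>(2)]])
    moreover have "snd (snd ?D (G q)) = (\<Sum>b\<in>Basis. \<beta> (coord_vec Q d (?F q) b) *\<^sub>R b)"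
      by (subst \<beta>(1)) simp
    moreover have "snd (G q) = \<beta>" using \<beta>(1) by (metis snd_conv)
    ultimately show "snd (snd ?D (G q)) \<bullet> ?w = snd (G q) (tangent_map A Q ?F q (coord_vec A c q e))"
      using coord_vec_self[OF Q d(1) \<beta>(2)] by simp
  qed
qed

text \<open>A local section \<open>\<tau>\<close> of the projection to the base through any given covector, obtained by
  fixing the last coordinate of a chart.  It lifts tangent vectors of the base, which shows that
  the contact form does not vanish.\<close>

lemma symplectization_local_section:
  fixes Q :: "('a, 'e::euclidean_space) atlas"
  assumes Q: "smooth_atlas Q" and hd: "hyperplane_distribution Q \<xi>" and x: "x \<in> symplectization_set Q \<xi>"
  obtains \<tau> N where "smooth_at Q (symplectization Q \<xi>) \<tau> (fst x)" "\<tau> (fst x) = x"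
    "openin (manifold_topology Q) N" "fst x \<in> N" "\<And>p. p \<in> N \<Longrightarrow> fst (\<tau> p) = p"
proof -
  note SM = smooth_atlas_symplectization[OF Q hd] and SE = smooth_atlas_euclidean
  have p: "fst x \<in> carrier_of Q" using x by (auto simp: symplectization_set_def)
  obtain k c N where k: "k \<in> symplectization Q \<xi>" "c \<in> Q" "openin (manifold_topology Q) N" "fst x \<in> N" "N \<subseteq> fst c"
    "fst k = {x \<in> symplectization_set Q \<xi>. fst x \<in> N}" "snd k ` fst k = snd c ` N \<times> (- {0})"
    "\<And>x. x \<in> fst k \<Longrightarrow> fst (snd k x) = snd c (fst x)" "\<And>x. x \<in> fst k \<Longrightarrow> snd (snd k x) \<noteq> 0"
    by (rule symplectization_chart[OF Q hd p]) (rule that)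
  have xk: "x \<in> fst k" using x k(4,6) by simp
  define s where "s = snd (snd k x)"
  have sx: "snd k x = (snd c (fst x), s)" using k(8)[OF xk] by (simp add: s_def prod_eq_iff)
  have s: "s \<noteq> 0" unfolding s_def by (rule k(9)[OF xk])
  define \<tau> where "\<tau> = (\<lambda>p. chart_inv k (snd c p, s))"
  have im: "(snd c p, s) \<in> snd k ` fst k" if "p \<in> N" for p unfolding k(7) using that s by simp
  have pc: "fst x \<in> fst c" using k by blast
  have ch: "smooth_at Q \<E> (\<lambda>p. (snd c p, s)) (fst x)"
    by (rule smooth_at_Pair[OF Q smooth_at_chart[OF Q k(2) pc] smooth_at_const[OF Q SE p]]) simp
  have "smooth_at Q (symplectization Q \<xi>) \<tau> (fst x)"
    unfolding \<tau>_def by (rule smooth_at_compose[OF Q SE SM ch smooth_at_chart_inv[OF SM k(1) im[OF k(4)]]])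
  moreover have "\<tau> (fst x) = x" unfolding \<tau>_def sx[symmetric] by (rule chart_inv_apply[OF SM k(1) xk])
  moreover have "fst (\<tau> p) = p" if pN: "p \<in> N" for p
  proof -
    have "\<tau> p \<in> fst k" "snd k (\<tau> p) = (snd c p, s)"
      unfolding \<tau>_def using im[OF pN] by (auto intro: inv_into_into f_inv_into_f)
    then have "snd c (fst (\<tau> p)) = snd c p" "fst (\<tau> p) \<in> fst c" using k(8)[of "\<tau> p"] k(5,6) by auto
    then show ?thesis using inj_chart[OF Q k(2)] k(5) pN by (auto dest: inj_onD)
  qed
  ultimately show thesis using k(3,4) by (intro that) 
qed

text \<open>With \<open>w = (\<beta>\<^sub>1, \<beta>\<^sub>2)\<close>, the form \<open>\<theta>\<^sub>w(u)\<close> is the sum of \<open>\<beta>\<^sub>i(T p\<^sub>i u)\<close>, where \<open>p\<^sub>i\<close> is the projection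
  to \<open>Q\<^sub>i\<close>.  Since \<open>p\<^sub>i\<close> factors as \<open>q\<^sub>i \<circ> \<pi>\<close>, the form \<open>\<alpha>\<^sub>z(v)\<close>, the sum of \<open>\<gamma>\<^sub>i(T q\<^sub>i v)\<close> with
  \<open>(\<gamma>\<^sub>1, \<gamma>\<^sub>2) = s(z)\<close>, satisfies \<open>\<alpha>(T\<pi> u) = \<theta>(u) / h\<close>.  Hence \<open>T\<pi>\<close> maps \<open>ker \<theta>\<close> into \<open>ker \<alpha>\<close>, and all of
  \<open>ker \<alpha>\<close> is reached by lifting along \<open>s\<close>.\<close>

lemma contact_product_coorientable:
  fixes Q1 :: "('a, 'e::euclidean_space) atlas" and Q2 :: "('b, 'f::euclidean_space) atlas"
  assumes M1: "smooth_manifold Q1" and h1: "hyperplane_distribution Q1 \<xi>1"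
    and Q2: "smooth_atlas Q2" and h2: "hyperplane_distribution Q2 \<xi>2"
  shows "coorientable (contact_product Q1 \<xi>1 Q2 \<xi>2) (contact_product_distribution Q1 \<xi>1 Q2 \<xi>2)"
proof -
  note SE = smooth_atlas_euclidean
  note Q1 = smooth_manifold_atlas[OF M1]
  define S1 where "S1 = symplectization_set Q1 \<xi>1"
  define S2 where "S2 = symplectization_set Q2 \<xi>2"
  define P where "P = symplectization_product Q1 \<xi>1 Q2 \<xi>2"
  define R where "R = ray_rel Q1 \<xi>1 Q2 \<xi>2"
  define C where "C = contact_product Q1 \<xi>1 Q2 \<xi>2"
  let ?M1 = "symplectization Q1 \<xi>1" and ?M2 = "symplectization Q2 \<xi>2"
  note SM1 = smooth_atlas_symplectization[OF Q1 h1] and SM2 = smooth_atlas_symplectization[OF Q2 h2]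
  note SC1 = smooth_atlas_cotangent[OF Q1] and SC2 = smooth_atlas_cotangent[OF Q2]
  note ctx = Q1 h1 Q2 h2 S1_def S2_def P_def R_def C_def
  note SP = smooth_atlas_P[OF ctx] and SC = smooth_atlas_C[OF ctx]
  note cP = carrier_P[OF ctx] and cC = carrier_C[OF ctx]
  note quot = contact_product_quotient[OF ctx] and cls = ray_class[OF ctx] and cls_eq = ray_class_eqI[OF ctx]
  have P: "P = product_atlas ?M1 ?M2" by (simp add: P_def symplectization_product_def)
  let ?\<pi> = "\<lambda>w. R `` {w}"
  obtain h where h: "\<And>x. x \<in> S1 \<Longrightarrow> h x > 0" "\<And>x r. x \<in> S1 \<Longrightarrow> r > 0 \<Longrightarrow> h (scale_covec r x) = r * h x"
    "\<And>x. x \<in> S1 \<Longrightarrow> smooth_at ?M1 \<E> h x"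
    by (rule positive_homogeneous_function[OF M1 h1, folded S1_def]) (rule that)
  have p1: "smooth_at P ?M1 fst w" and p2: "smooth_at P ?M2 snd w" if "w \<in> carrier_of P" for w
    using smooth_at_fst[OF SM1 SM2, of w] smooth_at_snd[OF SM1 SM2, of w] that by (simp_all add: P)
  have b1: "smooth_at P Q1 (\<lambda>w. fst (fst w)) w" and b2: "smooth_at P Q2 (\<lambda>w. fst (snd w)) w" if w: "w \<in> carrier_of P" for w
  proof -
    have x: "fst w \<in> symplectization_set Q1 \<xi>1" "snd w \<in> symplectization_set Q2 \<xi>2"
      using w unfolding cP by (auto simp: S1_def S2_def)
    show "smooth_at P Q1 (\<lambda>w. fst (fst w)) w"
      by (rule smooth_at_compose[OF SP SM1 Q1 p1[OF w] smooth_at_symplectization_fst[OF Q1 h1 x(1)]])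
    show "smooth_at P Q2 (\<lambda>w. fst (snd w)) w"
      by (rule smooth_at_compose[OF SP SM2 Q2 p2[OF w] smooth_at_symplectization_fst[OF Q2 h2 x(2)]])
  qed
  define \<theta> where "\<theta> = (\<lambda>w u. snd (fst w) (tangent_map P Q1 (\<lambda>w. fst (fst w)) w u) +
      snd (snd w) (tangent_map P Q2 (\<lambda>w. fst (snd w)) w u))"
  have form: "contact_product_form Q1 \<xi>1 Q2 \<xi>2 w u = \<theta> w u"
    if w: "w \<in> carrier_of P" and u: "u \<in> tangent_space P w" for w u
  proof -
    have x: "fst w \<in> symplectization_set Q1 \<xi>1" "snd w \<in> symplectization_set Q2 \<xi>2"
      using w unfolding cP by (auto simp: S1_def S2_def)
    have "symplectization_form Q1 \<xi>1 (fst w) (tangent_map P ?M1 fst w u) =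
        snd (fst w) (tangent_map P Q1 (\<lambda>w. fst (fst w)) w u)"
      using symplectization_form_eq[OF Q1 h1 x(1) tangent_map_in_tangent_space[OF SP SM1 p1[OF w] u]]
        tangent_map_compose[OF SP SM1 Q1 p1[OF w] smooth_at_symplectization_fst[OF Q1 h1 x(1)] u] by simp
    moreover have "symplectization_form Q2 \<xi>2 (snd w) (tangent_map P ?M2 snd w u) =
        snd (snd w) (tangent_map P Q2 (\<lambda>w. fst (snd w)) w u)"
      using symplectization_form_eq[OF Q2 h2 x(2) tangent_map_in_tangent_space[OF SP SM2 p2[OF w] u]]
        tangent_map_compose[OF SP SM2 Q2 p2[OF w] smooth_at_symplectization_fst[OF Q2 h2 x(2)] u] by simp
    ultimately show ?thesis
      by (simp add: contact_product_form_def pullback_form1_def \<theta>_def P_def)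
  qed
  \<comment> \<open>The normalisation \<open>h = 1\<close> within a ray.\<close>
  define m where "m = (\<lambda>w :: ('a, 'e) spt \<times> ('b, 'f) spt. (scale_covec (1 / h (fst w)) (fst w), scale_covec (1 / h (fst w)) (snd w)))"
  have hw: "h (fst w) > 0" if "w \<in> carrier_of P" for w using h(1) that unfolding cP by auto
  have mP: "m w \<in> carrier_of P" if w: "w \<in> carrier_of P" for w
    using w hw[OF w] unfolding cP m_def S1_def S2_def
    by (auto intro!: symplectization_set_scale)
  have \<pi>m: "?\<pi> (m w) = ?\<pi> w" if w: "w \<in> carrier_of P" for w
  proof -
    have "?\<pi> (m w) = ?\<pi> (fst w, snd w)"
      unfolding m_def by (rule cls_eq) (use w hw[OF w] in \<open>simp_all add: cP mem_Times_iff\<close>)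
    then show ?thesis by simp
  qed
  have m_smooth: "smooth_at P P m w" if w: "w \<in> carrier_of P" for w
  proof -
    have x: "fst w \<in> symplectization_set Q1 \<xi>1" "snd w \<in> symplectization_set Q2 \<xi>2"
      using w unfolding cP by (auto simp: S1_def S2_def)
    have hs: "smooth_at P \<E> (\<lambda>w. 1 / h (fst w)) w"
      by (rule smooth_at_divide[OF SP smooth_at_const[OF SP SE w] smooth_at_compose[OF SP SM1 SE p1[OF w]]])
        (use x h(3) hw[OF w] in \<open>auto simp: S1_def\<close>)
    have i1: "smooth_at P (cotangent_atlas Q1) fst w"
      by (rule smooth_at_compose[OF SP SM1 SC1 p1[OF w] smooth_at_symplectization_inclusion[OF Q1 h1 x(1)]])
    have i2: "smooth_at P (cotangent_atlas Q2) snd w"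
      by (rule smooth_at_compose[OF SP SM2 SC2 p2[OF w] smooth_at_symplectization_inclusion[OF Q2 h2 x(2)]])
    show ?thesis
      unfolding m_def P
    proof (rule smooth_at_Pair_product[OF SP[unfolded P] SM1 SM2]; unfold P[symmetric])
      show "smooth_at P ?M1 (\<lambda>w. scale_covec (1 / h (fst w)) (fst w)) w"
      proof (rule smooth_at_into_submanifold[OF SC1 symplectization_def SP smooth_at_scale_covec[OF SP Q1 i1 hs] _ openin_carrier[OF SP] w])
        show "scale_covec (1 / h (fst w)) (fst w) \<in> carrier_of ?M1"
          unfolding carrier_symplectization[OF Q1 h1] using mP[OF w] unfolding cP by (simp add: m_def S1_def)
        show "(\<lambda>w. scale_covec (1 / h (fst w)) (fst w)) ` carrier_of P \<subseteq> symplectization_set Q1 \<xi>1"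
          using mP unfolding cP by (auto simp: m_def S1_def)
      qed
      show "smooth_at P ?M2 (\<lambda>w. scale_covec (1 / h (fst w)) (snd w)) w"
      proof (rule smooth_at_into_submanifold[OF SC2 symplectization_def SP smooth_at_scale_covec[OF SP Q2 i2 hs] _ openin_carrier[OF SP] w])
        show "scale_covec (1 / h (fst w)) (snd w) \<in> carrier_of ?M2"
          unfolding carrier_symplectization[OF Q2 h2] using mP[OF w] unfolding cP by (simp add: m_def S2_def)
        show "(\<lambda>w. scale_covec (1 / h (fst w)) (snd w)) ` carrier_of P \<subseteq> symplectization_set Q2 \<xi>2"
          using mP unfolding cP by (auto simp: m_def S2_def)
      qed
    qed
  qed
  \<comment> \<open>The section of the projection through the points where \<open>h = 1\<close>.\<close>
  define s where "s = (\<lambda>z. m (SOME w. w \<in> z))"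
  have s: "s (?\<pi> w) = m w" if w: "w \<in> carrier_of P" for w
  proof -
    obtain x y where xy: "w = (x, y)" "x \<in> S1" "y \<in> S2" using w unfolding cP by auto
    have "(SOME w'. w' \<in> ?\<pi> w) \<in> ?\<pi> w" by (rule someI) (rule ray_class_self[OF ctx w])
    then obtain r where r: "r > 0" "(SOME w'. w' \<in> ?\<pi> w) = (scale_covec r x, scale_covec r y)"
      unfolding xy(1) cls[OF xy(2,3)] by blast
    have "m (scale_covec r x, scale_covec r y) = m (x, y)"
      using r(1) h(2)[OF xy(2) r(1)] by (simp add: m_def)
    then show ?thesis unfolding s_def r(2) by (simp add: xy(1))
  qed
  have zE: "\<exists>w\<in>carrier_of P. z = ?\<pi> w" if "z \<in> carrier_of C" for z
    using that unfolding cC by (auto elim!: quotientE)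
  have \<pi>C: "?\<pi> w \<in> carrier_of C" if "w \<in> carrier_of P" for w
    unfolding cC using that by (rule quotientI)
  have \<pi>_smooth: "smooth_at P C ?\<pi> w" if w: "w \<in> carrier_of P" for w
    by (rule smooth_at_quotient_projection[OF SP quot w \<pi>C[OF w]])
  have sP: "s z \<in> carrier_of P" and \<pi>s: "?\<pi> (s z) = z" if z: "z \<in> carrier_of C" for z
  proof -
    obtain w where w: "w \<in> carrier_of P" "z = ?\<pi> w" using zE[OF z] by blast
    show "s z \<in> carrier_of P" "?\<pi> (s z) = z" unfolding w(2) s[OF w(1)] using mP[OF w(1)] \<pi>m[OF w(1)] by auto
  qed
  have s_smooth: "smooth_at C P s z" if z: "z \<in> carrier_of C" for z
  proof -
    obtain w where w: "w \<in> carrier_of P" "z = ?\<pi> w" using zE[OF z] by blast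
    have "smooth_at P P (\<lambda>w. s (?\<pi> w)) w"
      by (rule smooth_at_cong[OF SP m_smooth[OF w(1)] openin_carrier[OF SP] w(1)]) (simp add: s)
    then show ?thesis
      unfolding w(2) by (rule smooth_at_quotient_descends[OF SP quot SP w(1) \<pi>C[OF w(1)]])
  qed
  let ?G1 = "\<lambda>z. fst (s z)" and ?G2 = "\<lambda>z. snd (s z)"
  have G: "smooth_at C (cotangent_atlas Q1) ?G1 z" "smooth_at C (cotangent_atlas Q2) ?G2 z" if z: "z \<in> carrier_of C" for z
  proof -
    have x: "?G1 z \<in> symplectization_set Q1 \<xi>1" "?G2 z \<in> symplectization_set Q2 \<xi>2"
      using sP[OF z] unfolding cP by (auto simp: S1_def S2_def)
    show "smooth_at C (cotangent_atlas Q1) ?G1 z"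
      by (rule smooth_at_compose[OF SC SM1 SC1 smooth_at_compose[OF SC SP SM1 s_smooth[OF z] p1[OF sP[OF z]]]
            smooth_at_symplectization_inclusion[OF Q1 h1 x(1)]])
    show "smooth_at C (cotangent_atlas Q2) ?G2 z"
      by (rule smooth_at_compose[OF SC SM2 SC2 smooth_at_compose[OF SC SP SM2 s_smooth[OF z] p2[OF sP[OF z]]]
            smooth_at_symplectization_inclusion[OF Q2 h2 x(2)]])
  qed
  let ?q1 = "\<lambda>z. fst (?G1 z)" and ?q2 = "\<lambda>z. fst (?G2 z)"
  have q: "smooth_at C Q1 ?q1 z" "smooth_at C Q2 ?q2 z" if z: "z \<in> carrier_of C" for z
    by (rule smooth_at_compose[OF SC SP Q1 s_smooth[OF z] b1[OF sP[OF z]]])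
      (rule smooth_at_compose[OF SC SP Q2 s_smooth[OF z] b2[OF sP[OF z]]])
  define \<alpha> where "\<alpha> = (\<lambda>z v. snd (?G1 z) (tangent_map C Q1 ?q1 z v) + snd (?G2 z) (tangent_map C Q2 ?q2 z v))"
  have cot: "snd (?G1 z) \<in> cotangent_space Q1 (?q1 z)" "snd (?G2 z) \<in> cotangent_space Q2 (?q2 z)" if z: "z \<in> carrier_of C" for z
    using sP[OF z] unfolding cP S1_def S2_def symplectization_set_def by auto
  have \<alpha>\<pi>: "\<alpha> (?\<pi> w) (tangent_map P C ?\<pi> w u) = 1 / h (fst w) * \<theta> w u"
    if w: "w \<in> carrier_of P" and u: "u \<in> tangent_space P w" for w u
  proof -
    have "tangent_map C Q1 ?q1 (?\<pi> w) (tangent_map P C ?\<pi> w u) = tangent_map P Q1 (\<lambda>w. ?q1 (?\<pi> w)) w u"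
      by (rule tangent_map_compose[OF SP SC Q1 \<pi>_smooth[OF w] q(1)[OF \<pi>C[OF w]] u, symmetric])
    also have "\<dots> = tangent_map P Q1 (\<lambda>w. fst (fst w)) w u"
      by (rule tangent_map_cong[OF SP Q1 b1[OF w] openin_carrier[OF SP] w]) (simp add: s m_def)
    finally have 1: "tangent_map C Q1 ?q1 (?\<pi> w) (tangent_map P C ?\<pi> w u) = tangent_map P Q1 (\<lambda>w. fst (fst w)) w u" .
    have "tangent_map C Q2 ?q2 (?\<pi> w) (tangent_map P C ?\<pi> w u) = tangent_map P Q2 (\<lambda>w. ?q2 (?\<pi> w)) w u"
      by (rule tangent_map_compose[OF SP SC Q2 \<pi>_smooth[OF w] q(2)[OF \<pi>C[OF w]] u, symmetric])
    also have "\<dots> = tangent_map P Q2 (\<lambda>w. fst (snd w)) w u"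
      by (rule tangent_map_cong[OF SP Q2 b2[OF w] openin_carrier[OF SP] w]) (simp add: s m_def)
    finally have 2: "tangent_map C Q2 ?q2 (?\<pi> w) (tangent_map P C ?\<pi> w u) = tangent_map P Q2 (\<lambda>w. fst (snd w)) w u" .
    show ?thesis
      unfolding \<alpha>_def 1 2 s[OF w] by (simp add: m_def \<theta>_def scale_covec_apply add_divide_distrib)
  qed
  have lift: "\<exists>u\<in>tangent_space P (s z). tangent_map P C ?\<pi> (s z) u = v"
    if z: "z \<in> carrier_of C" and v: "v \<in> tangent_space C z" for z v
  proof
    have \<pi>sz: "smooth_at P C ?\<pi> (s z)" by (rule \<pi>_smooth[OF sP[OF z]])
    have "tangent_map P C ?\<pi> (s z) (tangent_map C P s z v) = tangent_map C C (\<lambda>z. ?\<pi> (s z)) z v"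
      by (rule tangent_map_compose[OF SC SP SC s_smooth[OF z] \<pi>sz v, symmetric])
    also have "\<dots> = tangent_map C C (\<lambda>z. z) z v"
      by (rule tangent_map_cong[OF SC SC smooth_at_id[OF SC z] openin_carrier[OF SC] z]) (simp add: \<pi>s)
    also have "\<dots> = v" by (rule tangent_map_id[OF SC z v])
    finally show "tangent_map P C ?\<pi> (s z) (tangent_map C P s z v) = v" .
    show "tangent_map C P s z v \<in> tangent_space P (s z)"
      by (rule tangent_map_in_tangent_space[OF SC SP s_smooth[OF z] v])
  qed
  have nz: "\<exists>u\<in>tangent_space P w. \<theta> w u \<noteq> 0" if w: "w \<in> carrier_of P" for w
  proof -
    obtain x y where xy: "w = (x, y)" "x \<in> S1" "y \<in> S2" using w unfolding cP by auto
    have x: "x \<in> symplectization_set Q1 \<xi>1" using xy by (simp add: S1_def)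
    obtain \<tau> N where \<tau>: "smooth_at Q1 ?M1 \<tau> (fst x)" "\<tau> (fst x) = x"
      and N: "openin (manifold_topology Q1) N" "fst x \<in> N" "\<And>p. p \<in> N \<Longrightarrow> fst (\<tau> p) = p"
      by (rule symplectization_local_section[OF Q1 h1 x]) (rule that)
    have p: "fst x \<in> carrier_of Q1" using x by (auto simp: symplectization_set_def)
    have "snd x \<in> cotangent_space Q1 (fst x)" "snd x \<noteq> (\<lambda>_. 0)" using x by (auto simp: symplectization_set_def)
    then obtain v where v: "v \<in> tangent_space Q1 (fst x)" "snd x v \<noteq> 0" by (auto simp: cotangent_space_def fun_eq_iff)
    have yM: "y \<in> carrier_of ?M2" using xy(3) by (simp add: carrier_symplectization[OF Q2 h2] S2_def)
    let ?\<sigma> = "\<lambda>p. (\<tau> p, y)"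
    have \<sigma>: "smooth_at Q1 P ?\<sigma> (fst x)"
      unfolding P by (rule smooth_at_Pair_product[OF Q1 SM1 SM2 \<tau>(1) smooth_at_const[OF Q1 SM2 p yM]])
    have \<sigma>x: "?\<sigma> (fst x) = w" using \<tau>(2) xy by simp
    let ?u = "tangent_map Q1 P ?\<sigma> (fst x) v"
    have u: "?u \<in> tangent_space P w"
      using tangent_map_in_tangent_space[OF Q1 SP \<sigma> v(1)] unfolding \<sigma>x .
    have b1': "smooth_at P Q1 (\<lambda>w. fst (fst w)) (?\<sigma> (fst x))" and b2': "smooth_at P Q2 (\<lambda>w. fst (snd w)) (?\<sigma> (fst x))"
      unfolding \<sigma>x by (rule b1[OF w], rule b2[OF w])
    have "tangent_map P Q1 (\<lambda>w. fst (fst w)) w ?u = tangent_map Q1 Q1 (\<lambda>p. fst (fst (?\<sigma> p))) (fst x) v"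
      using tangent_map_compose[OF Q1 SP Q1 \<sigma> b1' v(1)] unfolding \<sigma>x ..
    also have "\<dots> = tangent_map Q1 Q1 (\<lambda>p. p) (fst x) v"
      by (rule tangent_map_cong[OF Q1 Q1 smooth_at_id[OF Q1 p] N(1,2)]) (simp add: N(3))
    also have "\<dots> = v" by (rule tangent_map_id[OF Q1 p v(1)])
    finally have 1: "tangent_map P Q1 (\<lambda>w. fst (fst w)) w ?u = v" .
    have "tangent_map P Q2 (\<lambda>w. fst (snd w)) w ?u = tangent_map Q1 Q2 (\<lambda>p. fst (snd (?\<sigma> p))) (fst x) v"
      using tangent_map_compose[OF Q1 SP Q2 \<sigma> b2' v(1)] unfolding \<sigma>x ..
    then have 2: "tangent_map P Q2 (\<lambda>w. fst (snd w)) w ?u = (\<lambda>_. 0)" by (simp add: tangent_map_const)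
    have "tangent_linear Q2 (fst y) (snd y)"
      using xy(3) by (auto simp: S2_def symplectization_set_def cotangent_space_def)
    then have "snd y (\<lambda>_. 0) = 0" by (rule tangent_linear_zero[OF Q2])
    then have "\<theta> w ?u = snd x v" unfolding \<theta>_def 1 2 by (simp add: xy(1))
    then show ?thesis using u v(2) by (intro bexI[of _ ?u]) simp_all
  qed
  have "coorientable C (contact_product_distribution Q1 \<xi>1 Q2 \<xi>2)"
  proof (rule coorientable_if_global_form[OF SC, of \<alpha>])
    fix z assume z: "z \<in> carrier_of C"
    have "tangent_linear C z (\<lambda>v. snd (?G1 z) (tangent_map C Q1 ?q1 z v))"
      "tangent_linear C z (\<lambda>v. snd (?G2 z) (tangent_map C Q2 ?q2 z v))"
      by (rule tangent_linear_pullback[OF SC Q1 q(1)[OF z] cot(1)[OF z]])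
        (rule tangent_linear_pullback[OF SC Q2 q(2)[OF z] cot(2)[OF z]])
    then show "tangent_linear C z (\<alpha> z)"
      by (simp add: tangent_linear_def \<alpha>_def distrib_left)
    show "\<exists>v\<in>tangent_space C z. \<alpha> z v \<noteq> 0"
    proof -
      obtain u where u: "u \<in> tangent_space P (s z)" "\<theta> (s z) u \<noteq> 0" using nz[OF sP[OF z]] by blast
      have "tangent_map P C ?\<pi> (s z) u \<in> tangent_space C z"
        using tangent_map_in_tangent_space[OF SP SC \<pi>_smooth[OF sP[OF z]] u(1)] unfolding \<pi>s[OF z] .
      moreover have "\<alpha> z (tangent_map P C ?\<pi> (s z) u) \<noteq> 0"
        using \<alpha>\<pi>[OF sP[OF z] u(1)] hw[OF sP[OF z]] u(2) unfolding \<pi>s[OF z] by simp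
      ultimately show ?thesis by blast
    qed
    show "contact_product_distribution Q1 \<xi>1 Q2 \<xi>2 z = {v \<in> tangent_space C z. \<alpha> z v = 0}"
    proof (intro equalityI subsetI)
      fix v assume "v \<in> contact_product_distribution Q1 \<xi>1 Q2 \<xi>2 z"
      then obtain w u where v: "v = tangent_map P C ?\<pi> w u" and w: "w \<in> carrier_of P" "?\<pi> w = z"
        and u: "u \<in> tangent_space P w" "contact_product_form Q1 \<xi>1 Q2 \<xi>2 w u = 0"
        unfolding contact_product_distribution_def P_def[symmetric] C_def[symmetric] R_def[symmetric] by blast
      have "v \<in> tangent_space C z"
        unfolding v using tangent_map_in_tangent_space[OF SP SC \<pi>_smooth[OF w(1)] u(1)] unfolding w(2) .
      moreover have "\<alpha> z v = 0" using \<alpha>\<pi>[OF w(1) u(1)] u(2) form[OF w(1) u(1)] unfolding v w(2) by simp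
      ultimately show "v \<in> {v \<in> tangent_space C z. \<alpha> z v = 0}" by simp
    next
      fix v assume "v \<in> {v \<in> tangent_space C z. \<alpha> z v = 0}"
      then have v: "v \<in> tangent_space C z" "\<alpha> z v = 0" by auto
      obtain u where u: "u \<in> tangent_space P (s z)" "tangent_map P C ?\<pi> (s z) u = v" using lift[OF z v(1)] by blast
      have "1 / h (fst (s z)) * \<theta> (s z) u = 0" using \<alpha>\<pi>[OF sP[OF z] u(1)] v(2) unfolding u(2) \<pi>s[OF z] by simp
      then have "\<theta> (s z) u = 0" using hw[OF sP[OF z]] by simp
      then have "contact_product_form Q1 \<xi>1 Q2 \<xi>2 (s z) u = 0" using form[OF sP[OF z] u(1)] by simp
      then show "v \<in> contact_product_distribution Q1 \<xi>1 Q2 \<xi>2 z"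
        unfolding contact_product_distribution_def P_def[symmetric] C_def[symmetric] R_def[symmetric]
        using u sP[OF z] \<pi>s[OF z] by blast
    qed
  next
    fix c e z assume c: "c \<in> C" "z \<in> fst c"
    show "smooth_at C \<E> (\<lambda>q. \<alpha> q (coord_vec C c q e)) z"
      unfolding \<alpha>_def
      by (intro smooth_at_add[OF SC] smooth_at_pullback_liouville[OF SC Q1 G(1) c] smooth_at_pullback_liouville[OF SC Q2 G(2) c])
  qed
  then show ?thesis by (simp add: C_def)
qed

theorem proposition1p3:
  fixes Q1 :: "('a, 'e::euclidean_space) atlas" and \<xi>1 :: "('a, 'e) distribution"
    and Q2 :: "('b, 'f::euclidean_space) atlas" and \<xi>2 :: "('b, 'f) distribution"
  assumes "contact_manifold Q1 \<xi>1" and "contact_manifold Q2 \<xi>2"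
  shows "coorientable (contact_product Q1 \<xi>1 Q2 \<xi>2) (contact_product_distribution Q1 \<xi>1 Q2 \<xi>2)"
  using assms unfolding contact_manifold_def
  by (intro contact_product_coorientable smooth_manifold_atlas) blast+

end
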